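(* Let $A\in L^2_{\rm loc}(\mathbb{R}^+)$ be the coefficient of a Krein system with spectral measure $\sigma$, and let $(a,b)\subset\mathbb{R}$ be an interval with $(a,b)\cap\operatorname{supp}(d\sigma)=\emptyset$. For $r>0$ let $M_r=\sup_{\lambda\in\mathbb{R}}|P(r,\lambda)|$. Then $P(r,\lambda)$ has no zeroes in $$\Omega_r=\left\{x+iy:\ y>0,\ \int_{-\infty}^\infty\frac{2y\,d\sigma(\lambda)}{(\lambda-x)^2+y^2}<M_r^{-2}\right\}.$$
   Context: Krein system: for complex-valued $A\in L^2_{\rm loc}(\mathbb{R}^+)$ (i.e. $A\in L^2[0,R]$ for all $R>0$) and $\lambda\in\mathbb{C}$, $P(r,\lambda),P_*(r,\lambda)$ solve $P'=i\lambda P-\overline{A(r)}P_*$, $P_*'=-A(r)P$, $P(0,\lambda)=P_*(0,\lambda)=1$. Spectral measure: an accelerant is a function $H\in L^2_{\rm loc}(\mathbb{R})$ with $H(-x)=\overline{H(x)}$ such that for every $r>0$ the operator $(\mathcal{H}_rf)(x)=\int_0^rH(x-t)f(t)dt$ on $L^2[0,r]$ satisfies $I+\mathcal{H}_r>0$; its resolvent kernel $\Gamma_r$ satisfies $\Gamma_r(t,s)+\int_0^rH(t-u)\Gamma_r(u,s)du=H(t-s)$. Each $A\in L^2_{\rm loc}(\mathbb{R}^+)$ has a unique accelerant $H$ with $\overline{A(r)}=H(r)-\int_0^rH(r-u)\Gamma_r(u,0)du$ for a.e. $r$. The spectral measure $\sigma$ is the unique positive Borel measure on $\mathbb{R}$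 with $\int\frac{d\sigma(\lambda)}{1+\lambda^2}<\infty$ such that for some $\beta\in\mathbb{R}$ and all $x\in\mathbb{R}$ $$\frac{|x|}{2}+\int_0^x(x-s)H(s)ds=i\beta x+\int_{-\infty}^\infty\left(1+\frac{i\lambda x}{1+\lambda^2}-e^{i\lambda x}\right)\frac{d\sigma(\lambda)}{\lambda^2}$$ (integrand extended by continuity to $\lambda=0$). Equivalently, $\sigma$ is the weak-$*$ limit of $\frac{d\lambda}{2\pi|P_*(r,\lambda)|^2}$ as $r\to\infty$. *)

theory Defs
  imports "HOL-Analysis.Analysis"
begin

definition L2_on :: "real set \<Rightarrow> (real \<Rightarrow> complex) \<Rightarrow> bool" where
  "L2_on S f \<longleftrightarrow> set_borel_measurable lebesgue S f \<and>
     set_integrable lebesgue S (\<lambda>x. (cmod (f x))\<^sup>2)"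

text \<open>
  Caratheodory form of "\<open>\<phi>\<close> is locally absolutely continuous on \<open>[0,\<infinity>)\<close> and \<open>\<phi>' = g\<close> a.e.".
\<close>
definition locally_AC_with_deriv :: "(real \<Rightarrow> complex) \<Rightarrow> (real \<Rightarrow> complex) \<Rightarrow> bool" where
  "locally_AC_with_deriv \<phi> g \<longleftrightarrow>
     (\<forall>r\<ge>0. set_integrable lebesgue {0..r} g \<and>
            \<phi> r = \<phi> 0 + (LINT s:{0..r}|lebesgue. g s))"

definition krein_system ::
  "(real \<Rightarrow> complex) \<Rightarrow> (real \<Rightarrow> complex \<Rightarrow> complex) \<Rightarrow> (real \<Rightarrow> complex \<Rightarrow> complex) \<Rightarrow> bool" where
  "krein_system A P Ps \<longleftrightarrow>
     (\<forall>z. P 0 z = 1 \<and> Ps 0 z = 1 \<and>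
          locally_AC_with_deriv (\<lambda>r. P r z) (\<lambda>r. \<i> * z * P r z - cnj (A r) * Ps r z) \<and>
          locally_AC_with_deriv (\<lambda>r. Ps r z) (\<lambda>r. - A r * P r z))"

definition accelerant_operator ::
  "(real \<Rightarrow> complex) \<Rightarrow> real \<Rightarrow> (real \<Rightarrow> complex) \<Rightarrow> real \<Rightarrow> complex" where
  "accelerant_operator H r f x = (LINT t:{0..r}|lebesgue. H (x - t) * f t)"

text \<open>
  The last clause is \<open>\<langle>(I + \<H>\<^sub>r) f, f\<rangle> > 0\<close> for all nonzero \<open>f \<in> L\<^sup>2[0,r]\<close>; the form is real because
  \<open>H\<close> is Hermitian, so \<open>Re\<close> only fixes the type.
\<close>
definition accelerant :: "(real \<Rightarrow> complex) \<Rightarrow> bool" where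
  "accelerant H \<longleftrightarrow>
     (\<forall>R>0. L2_on {-R..R} H) \<and>
     (AE x in lebesgue. H (- x) = cnj (H x)) \<and>
     (\<forall>r>0. \<forall>f. L2_on {0..r} f \<longrightarrow> \<not> (AE x in lebesgue. x \<in> {0..r} \<longrightarrow> f x = 0) \<longrightarrow>
        0 < Re (LINT x:{0..r}|lebesgue. (f x + accelerant_operator H r f x) * cnj (f x)))"

text \<open>
  For every fixed \<open>s\<close> the equation has exactly one solution \<open>\<Gamma>(\<cdot>, s)\<close> in \<open>L\<^sup>2[0,r]\<close> up to null sets.
  Asking for it at every \<open>s\<close>, rather than at almost every pair \<open>(t, s)\<close>, gives \<open>\<Gamma>(\<cdot>, 0)\<close> a meaning.
\<close>
definition resolvent_kernel ::
  "(real \<Rightarrow> complex) \<Rightarrow> real \<Rightarrow> (real \<Rightarrow> real \<Rightarrow> complex) \<Rightarrow> bool" where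
  "resolvent_kernel H r \<Gamma> \<longleftrightarrow>
     (\<forall>s\<in>{0..r}. L2_on {0..r} (\<lambda>t. \<Gamma> t s) \<and>
        (AE t in lebesgue. t \<in> {0..r} \<longrightarrow>
           \<Gamma> t s + (LINT u:{0..r}|lebesgue. H (t - u) * \<Gamma> u s) = H (t - s)))"

definition accelerant_of :: "(real \<Rightarrow> complex) \<Rightarrow> (real \<Rightarrow> complex) \<Rightarrow> bool" where
  "accelerant_of A H \<longleftrightarrow> accelerant H \<and>
     (\<exists>\<Gamma>. (\<forall>r>0. resolvent_kernel H r (\<Gamma> r)) \<and>
          (AE r in lebesgue. r > 0 \<longrightarrow>
             cnj (A r) = H r - (LINT u:{0..r}|lebesgue. H (r - u) * \<Gamma> r u 0)))"

text \<open>The value at \<open>\<lambda> = 0\<close> is the limit of the generic expression.\<close>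
definition levy_kernel :: "real \<Rightarrow> real \<Rightarrow> complex" where
  "levy_kernel x l =
     (if l = 0 then of_real (x\<^sup>2 / 2)
      else (1 + \<i> * of_real (l * x / (1 + l\<^sup>2)) - exp (\<i> * of_real (l * x))) / of_real (l\<^sup>2))"

text \<open>The interval integral is oriented, so that \<open>x < 0\<close> is covered.\<close>
definition spectral_measure_of :: "(real \<Rightarrow> complex) \<Rightarrow> real measure \<Rightarrow> bool" where
  "spectral_measure_of A \<sigma> \<longleftrightarrow>
     sets \<sigma> = sets borel \<and>
     integrable \<sigma> (\<lambda>l. 1 / (1 + l\<^sup>2)) \<and>
     (\<exists>H. accelerant_of A H \<and>
        (\<exists>\<beta>::real. \<forall>x::real.
           of_real (\<bar>x\<bar> / 2) + (LINT s=0..x|lebesgue. (of_real (x - s) * H s)) =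
           \<i> * of_real (\<beta> * x) + (LINT l|\<sigma>. levy_kernel x l)))"

definition measure_support :: "real measure \<Rightarrow> real set" where
  "measure_support \<sigma> = {x. \<forall>U. open U \<longrightarrow> x \<in> U \<longrightarrow> emeasure \<sigma> U \<noteq> 0}"

text \<open>
  For a solution \<open>P\<close> of a Krein system the supremum is finite, by Gronwall's inequality and
  \<open>|P| = |P\<^sub>*|\<close> on the real line.
\<close>
definition sup_on_real_line :: "(complex \<Rightarrow> complex) \<Rightarrow> real" where
  "sup_on_real_line p = (SUP l::real. cmod (p (of_real l)))"

definition Omega :: "real measure \<Rightarrow> real \<Rightarrow> complex set" where
  "Omega \<sigma> M = {Complex x y | x y. y > 0 \<and>
     (LINT l|\<sigma>. 2 * y / ((l - x)\<^sup>2 + y\<^sup>2)) < 1 / M\<^sup>2}"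

end

theory Submission
  imports Defs "HOL-Complex_Analysis.Great_Picard"
begin

text \<open>
  If \<open>P(r, z) = 0\<close> with \<open>y = Im z > 0\<close>, then \<open>q(l) = P(r, l) / (l - z)\<close> satisfies \<open>2 y \<integral> |q|\<^sup>2 d\<sigma> = 1\<close>, just as
  \<open>(1 - |z|\<^sup>2) \<parallel>q\<parallel>\<^sup>2 = 1\<close> for an orthonormal polynomial \<open>(l - z) q\<close> on the unit circle. Bounding \<open>|P(r, l)|\<close> on the
  real line by \<open>M\<^sub>r\<close> then keeps \<open>z\<close> outside \<open>\<Omega>\<^sub>r\<close>.

  The identity rests on \<open>P(r, l) = exp(i l r) - \<integral> \<gamma>(v) exp(i l v) dv\<close>, where \<open>\<gamma>\<close> solves \<open>\<gamma>(w) + \<integral> H(v - w) \<gamma>(v) dv = H(r - w)\<close> on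
  \<open>[0, r]\<close>. Here \<open>\<gamma>\<close> comes from a kernel \<open>G\<close> that solves a linear Volterra equation with coefficient \<open>A\<close>. Its residual in the
  resolvent equation satisfies a homogeneous Volterra inequality, whose constant is finite because the resolvents
  \<open>\<Gamma>\<^sub>t(\<cdot>, 0)\<close> are bounded in \<open>L\<^sup>2\<close> for \<open>0 < t \<le> r\<close> (compactness and positivity of \<open>I + \<H>\<^sub>t\<close>), so the residual vanishes.
  The function \<open>q\<close> is the transform of the solution \<open>\<Phi>\<close> of \<open>\<Phi>' = - i z \<Phi> + i \<gamma>\<close>, \<open>\<Phi>(0) = 0\<close>. The Levy-Khintchine formula turns
  \<open>\<integral> |q|\<^sup>2 d\<sigma>\<close> into \<open>\<langle>(I + \<H>\<^sub>r) \<Phi>, \<Phi>\<rangle>\<close>, which the equations for \<open>\<gamma>\<close> and \<open>\<Phi>\<close> evaluate to \<open>1 / (2 y)\<close>.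
\<close>

section \<open>Square integrable functions on the line\<close>

text \<open>Two obstacles shape the proof. The resolvents are given for each length \<open>r\<close>
  separately and up to null sets, so not even measurability in \<open>r\<close> is known, and
  Krein's identity, that \<Gamma>_r(t,s) has \<open>r\<close>-derivative -\<Gamma>_r(t,r)
  \<Gamma>_r(r,s), cannot be extracted from them directly. It serves as a guide instead: with
  \<Gamma>_r(r,0) = cnj (A r) and \<Gamma>_r(s,r) = cnj (\<Gamma>_r(r-s,0)), its integrated form is
  the Volterra equation that defines \<open>G\<close>. The resolvents are then compared with
  \<open>G\<close> at one fixed length at a time.

  Secondly, \<sigma> may have infinite mass, and the Levy-Khintchine formula knows \<open>H\<close>
  only through a second primitive. The form is therefore computed for functions that are primitives
  on \<open>[0, r]\<close>: their transforms decay like 1/l, which makes them square integrable for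
  \<sigma>, and they involve only second differences of the formula, in which the unknown linear
  term with \<beta> cancels.\<close>

lemma borel_measurable_cnj [measurable]:
  "f \<in> borel_measurable M \<Longrightarrow> (\<lambda>x. cnj (f x)) \<in> borel_measurable M"
  by (rule borel_measurable_continuous_on[of cnj]) (auto intro: continuous_intros)

definition square_integrable :: "(real \<Rightarrow> complex) \<Rightarrow> bool" where
  "square_integrable f \<longleftrightarrow> f \<in> borel_measurable borel \<and> integrable lborel (\<lambda>x. (cmod (f x))\<^sup>2)"

definition sq_norm :: "(real \<Rightarrow> complex) \<Rightarrow> real" where
  "sq_norm f = (LBINT x. (cmod (f x))\<^sup>2)"

lemma square_integrable_measurable [measurable_dest]:
  "square_integrable f \<Longrightarrow> f \<in> borel_measurable borel"
  by (simp add: square_integrable_def)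

lemma sq_norm_nonneg [simp]: "sq_norm f \<ge> 0"
  by (simp add: sq_norm_def)

lemma Cauchy_Schwarz_real:
  fixes f g :: "'a \<Rightarrow> real"
  assumes [measurable]: "f \<in> borel_measurable M" "g \<in> borel_measurable M"
    and f2: "integrable M (\<lambda>x. (f x)\<^sup>2)" and g2: "integrable M (\<lambda>x. (g x)\<^sup>2)"
  shows "integrable M (\<lambda>x. f x * g x)"
    and "(LINT x|M. \<bar>f x * g x\<bar>)\<^sup>2 \<le> (LINT x|M. (f x)\<^sup>2) * (LINT x|M. (g x)\<^sup>2)"
proof -
  show int: "integrable M (\<lambda>x. f x * g x)"
  proof (rule Bochner_Integration.integrable_bound)
    show "integrable M (\<lambda>x. (f x)\<^sup>2 + (g x)\<^sup>2)" using f2 g2 by simp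
    have "\<bar>a * b\<bar> \<le> a\<^sup>2 + b\<^sup>2" for a b :: real
    proof -
      have "2 * \<bar>a\<bar> * \<bar>b\<bar> \<le> a\<^sup>2 + b\<^sup>2"
        using zero_le_power2[of "\<bar>a\<bar> - \<bar>b\<bar>"] by (simp add: power2_diff)
      moreover have "0 \<le> \<bar>a\<bar> * \<bar>b\<bar>" by simp
      ultimately show ?thesis unfolding abs_mult by linarith
    qed
    then show "AE x in M. norm (f x * g x) \<le> norm ((f x)\<^sup>2 + (g x)\<^sup>2)" by simp
  qed simp
  define p q c where "p = (LINT x|M. (f x)\<^sup>2)" and "q = (LINT x|M. (g x)\<^sup>2)"
    and "c = (LINT x|M. \<bar>f x * g x\<bar>)"
  have nonneg: "p \<ge> 0" "q \<ge> 0" "c \<ge> 0" by (auto simp: p_def q_def c_def)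
  have "(\<integral>\<^sup>+x. ennreal \<bar>f x\<bar> * ennreal \<bar>g x\<bar> \<partial>M)\<^sup>2
      \<le> (\<integral>\<^sup>+x. (ennreal \<bar>f x\<bar>)\<^sup>2 \<partial>M) * (\<integral>\<^sup>+x. (ennreal \<bar>g x\<bar>)\<^sup>2 \<partial>M)"
    by (rule Cauchy_Schwarz_nn_integral) auto
  also have "(\<integral>\<^sup>+x. (ennreal \<bar>f x\<bar>)\<^sup>2 \<partial>M) = ennreal p"
    unfolding p_def using f2 by (simp add: ennreal_power nn_integral_eq_integral)
  also have "(\<integral>\<^sup>+x. (ennreal \<bar>g x\<bar>)\<^sup>2 \<partial>M) = ennreal q"
    unfolding q_def using g2 by (simp add: ennreal_power nn_integral_eq_integral)
  also have "(\<integral>\<^sup>+x. ennreal \<bar>f x\<bar> * ennreal \<bar>g x\<bar> \<partial>M) = ennreal c"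
    unfolding c_def using integrable_abs[OF int]
    by (simp add: ennreal_mult[symmetric] abs_mult[symmetric] nn_integral_eq_integral del: integrable_abs)
  finally have "c\<^sup>2 \<le> p * q"
    using nonneg by (simp add: ennreal_power ennreal_mult[symmetric])
  then show "(LINT x|M. \<bar>f x * g x\<bar>)\<^sup>2 \<le> (LINT x|M. (f x)\<^sup>2) * (LINT x|M. (g x)\<^sup>2)"
    by (simp add: p_def q_def c_def)
qed

lemma square_integrable_mult:
  assumes f: "square_integrable f" and g: "square_integrable g"
  shows "integrable lborel (\<lambda>x. f x * g x)"
    and "(LBINT x. cmod (f x) * cmod (g x))\<^sup>2 \<le> sq_norm f * sq_norm g"
    and "(cmod (LBINT x. f x * g x))\<^sup>2 \<le> sq_norm f * sq_norm g"
proof -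
  note [measurable] = square_integrable_measurable[OF f] square_integrable_measurable[OF g]
  have f2: "integrable lborel (\<lambda>x. (cmod (f x))\<^sup>2)" and g2: "integrable lborel (\<lambda>x. (cmod (g x))\<^sup>2)"
    using f g by (auto simp: square_integrable_def)
  have "integrable lborel (\<lambda>x. cmod (f x) * cmod (g x))"
    by (rule Cauchy_Schwarz_real(1)[OF _ _ f2 g2]) auto
  then have "integrable lborel (\<lambda>x. cmod (f x * g x))" by (simp add: norm_mult)
  then show int: "integrable lborel (\<lambda>x. f x * g x)"
    by (subst (asm) integrable_norm_iff) auto
  show cs: "(LBINT x. cmod (f x) * cmod (g x))\<^sup>2 \<le> sq_norm f * sq_norm g"
    using Cauchy_Schwarz_real(2)[OF _ _ f2 g2] by (simp add: sq_norm_def)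
  have "cmod (LBINT x. f x * g x) \<le> (LBINT x. cmod (f x * g x))"
    by (rule integral_norm_bound)
  then have "(cmod (LBINT x. f x * g x))\<^sup>2 \<le> (LBINT x. cmod (f x) * cmod (g x))\<^sup>2"
    by (intro power_mono) (auto simp: norm_mult)
  with cs show "(cmod (LBINT x. f x * g x))\<^sup>2 \<le> sq_norm f * sq_norm g" by linarith
qed

lemma square_integrable_bound:
  assumes "square_integrable f" "g \<in> borel_measurable borel" "\<And>x. cmod (g x) \<le> C * cmod (f x)"
  shows "square_integrable g"
  unfolding square_integrable_def
proof
  show "integrable lborel (\<lambda>x. (cmod (g x))\<^sup>2)"
  proof (rule Bochner_Integration.integrable_bound)
    show "integrable lborel (\<lambda>x. C\<^sup>2 * (cmod (f x))\<^sup>2)"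
      using assms(1) by (simp add: square_integrable_def)
    show "AE x in lborel. norm ((cmod (g x))\<^sup>2) \<le> norm (C\<^sup>2 * (cmod (f x))\<^sup>2)"
      using power_mono[OF assms(3), of _ 2] by (auto simp: power_mult_distrib)
  qed (use assms in auto)
qed (use assms in auto)

lemma cmod_add_sq: "(cmod (x + y))\<^sup>2 \<le> 2 * (cmod x)\<^sup>2 + 2 * (cmod y)\<^sup>2"
proof -
  have "(cmod (x + y))\<^sup>2 \<le> (cmod x + cmod y)\<^sup>2" by (intro power_mono norm_triangle_ineq) auto
  also have "\<dots> \<le> 2 * (cmod x)\<^sup>2 + 2 * (cmod y)\<^sup>2"
    using zero_le_power2[of "cmod x - cmod y"] by (simp add: power2_diff power2_sum)
  finally show ?thesis .
qed

lemma square_integrable_add: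
  assumes f: "square_integrable f" and g: "square_integrable g"
  shows "square_integrable (\<lambda>x. f x + g x)"
    and "sq_norm (\<lambda>x. f x + g x) \<le> 2 * sq_norm f + 2 * sq_norm g"
proof -
  note [measurable] = square_integrable_measurable[OF f] square_integrable_measurable[OF g]
  have i: "integrable lborel (\<lambda>x. 2 * (cmod (f x))\<^sup>2 + 2 * (cmod (g x))\<^sup>2)"
    using f g by (auto simp: square_integrable_def)
  have j: "integrable lborel (\<lambda>x. (cmod (f x + g x))\<^sup>2)"
    by (rule Bochner_Integration.integrable_bound[OF i]) (auto intro: order_trans[OF cmod_add_sq])
  then show "square_integrable (\<lambda>x. f x + g x)" by (simp add: square_integrable_def)
  have "sq_norm (\<lambda>x. f x + g x) \<le> (LBINT x. 2 * (cmod (f x))\<^sup>2 + 2 * (cmod (g x))\<^sup>2)"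
    unfolding sq_norm_def by (rule integral_mono[OF j i cmod_add_sq])
  also have "\<dots> = 2 * sq_norm f + 2 * sq_norm g"
    using f g by (simp add: square_integrable_def sq_norm_def)
  finally show "sq_norm (\<lambda>x. f x + g x) \<le> 2 * sq_norm f + 2 * sq_norm g" .
qed

lemma square_integrable_cnj:
  "square_integrable f \<Longrightarrow> square_integrable (\<lambda>x. cnj (f x))"
  by (rule square_integrable_bound[of f _ 1]) (auto intro!: borel_measurable_cnj square_integrable_measurable)

lemma square_integrable_diff:
  assumes "square_integrable f" "square_integrable g"
  shows "square_integrable (\<lambda>x. f x - g x)"
proof -
  have "square_integrable (\<lambda>x. - g x)"
    by (rule square_integrable_bound[of g _ 1]) (use assms in auto)
  from square_integrable_add(1)[OF assms(1) this] show ?thesis by simp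
qed

lemma integral_reflect:
  fixes f :: "real \<Rightarrow> 'a::{banach, second_countable_topology}"
  shows "(LBINT x. f (c - x)) = (LBINT x. f x)"
    and "integrable lborel (\<lambda>x. f (c - x)) \<longleftrightarrow> integrable lborel f"
  using lborel_integral_real_affine[of "-1" f c] lborel_integrable_real_affine_iff[of "-1" f c]
  by simp_all

lemma integral_translate:
  fixes f :: "real \<Rightarrow> 'a::{banach, second_countable_topology}"
  shows "(LBINT x. f (x - c)) = (LBINT x. f x)"
    and "integrable lborel (\<lambda>x. f (x - c)) \<longleftrightarrow> integrable lborel f"
  using lborel_integral_real_affine[of "1" f "-c"] lborel_integrable_real_affine_iff[of "1" f "-c"]
  by simp_all

lemma square_integrable_reflect:
  assumes "square_integrable f"
  shows "square_integrable (\<lambda>x. f (c - x))" and "sq_norm (\<lambda>x. f (c - x)) = sq_norm f"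
  using assms integral_reflect[of "\<lambda>x. (cmod (f x))\<^sup>2" c]
  by (auto simp: square_integrable_def sq_norm_def)

lemma square_integrable_translate:
  assumes "square_integrable f"
  shows "square_integrable (\<lambda>x. f (x - c))" and "sq_norm (\<lambda>x. f (x - c)) = sq_norm f"
  using assms integral_translate[of "\<lambda>x. (cmod (f x))\<^sup>2" c]
  by (auto simp: square_integrable_def sq_norm_def)

lemma sq_norm_cnj [simp]: "sq_norm (\<lambda>x. cnj (f x)) = sq_norm f"
  by (simp add: sq_norm_def)

lemma square_integrable_indicator:
  "square_integrable (\<lambda>x. complex_of_real (indicator {a..b} x))"
proof -
  have "(\<lambda>x::real. (cmod (complex_of_real (indicator {a..b} x)))\<^sup>2) = indicator {a..b}"
    by (auto simp: indicator_def)
  moreover have "integrable lborel (indicator {a..b} :: real \<Rightarrow> real)"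
    by (rule integrable_real_indicator) (auto simp: emeasure_lborel_Icc_eq)
  ultimately show ?thesis by (simp add: square_integrable_def del: of_real_indicator)
qed

lemma square_integrable_imp_integrable:
  assumes f: "square_integrable f" and supp: "\<And>x. x \<notin> {a..b} \<Longrightarrow> f x = 0"
  shows "integrable lborel f"
proof -
  have "integrable lborel (\<lambda>x. complex_of_real (indicator {a..b} x) * f x)"
    by (rule square_integrable_mult[OF square_integrable_indicator f])
  also have "(\<lambda>x. complex_of_real (indicator {a..b} x) * f x) = f"
  proof
    fix x show "complex_of_real (indicator {a..b} x) * f x = f x"
      using supp[of x] by (cases "x \<in> {a..b}") auto
  qed
  finally show ?thesis .
qed

lemma square_integrable_bounded:
  assumes [measurable]: "f \<in> borel_measurable borel" and "\<And>x. x \<notin> {a..b} \<Longrightarrow> f x = 0" "\<And>x. cmod (f x) \<le> C"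
  shows "square_integrable f"
  by (rule square_integrable_bound[OF square_integrable_indicator[of a b], of _ C])
    (use assms in \<open>auto simp: indicator_def\<close>)

lemma integrable_conv_pair:
  fixes f g :: "real \<Rightarrow> complex"
  assumes f: "integrable lborel f" and g: "integrable lborel g"
  shows "integrable (lborel \<Otimes>\<^sub>M lborel) (\<lambda>(x, y). f x * g (x - y))"
proof (rule lborel_pair.Fubini_integrable)
  note [measurable] = borel_measurable_integrable[OF f] borel_measurable_integrable[OF g]
  show "(\<lambda>(x, y). f x * g (x - y)) \<in> borel_measurable (lborel \<Otimes>\<^sub>M lborel)" by measurable
  have "(LBINT y. cmod (g (x - y))) = (LBINT y. cmod (g y))" for x
    using integral_reflect(1)[of "\<lambda>y. cmod (g y)" x] by simp
  then show "integrable lborel (\<lambda>x. LBINT y. norm (case (x, y) of (x, y) \<Rightarrow> f x * g (x - y)))"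
    using f by (simp add: norm_mult)
  show "AE x in lborel. integrable lborel (\<lambda>y. case (x, y) of (x, y) \<Rightarrow> f x * g (x - y))"
    using g integral_reflect(2)[of g] by simp
qed

section \<open>A Volterra equation for the kernel of the Krein system\<close>

text \<open>Terms of the Neumann series for the equation in \<open>volterra_kernel_exists\<close>.
  The argument \<open>\<rho> - s\<close> mirrors the interval \<open>[0, \<rho>]\<close>; the
  support of the preceding term confines the integral to \<open>s \<le> \<rho> \<le> r\<close>.
  Because of the conjugation the recursion is only real linear, which is enough to sum the
  series.\<close>

primrec volterra_term :: "(real \<Rightarrow> complex) \<Rightarrow> nat \<Rightarrow> real \<Rightarrow> real \<Rightarrow> complex" where
  "volterra_term b 0 r s = indicator {0..r} s * b s"
| "volterra_term b (Suc n) r s =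
     - (indicator {0..r} s * (LBINT \<rho>. indicator {..r} \<rho> * b \<rho> * cnj (volterra_term b n \<rho> (\<rho> - s))))"

lemma indicator_Icc_eq: "indicator {0..r} s = (if 0 \<le> s \<and> s \<le> r then 1 else 0 :: complex)"
  by (auto simp: indicator_def)

lemma measurable_volterra_term:
  assumes [measurable]: "b \<in> borel_measurable borel"
  shows "(\<lambda>(r, s). volterra_term b n r s) \<in> borel_measurable (borel \<Otimes>\<^sub>M borel)"
proof (induction n)
  case 0
  show ?case by (simp add: indicator_Icc_eq)
next
  case (Suc n)
  have [measurable]: "(\<lambda>x. volterra_term b n (f x) (g x)) \<in> borel_measurable M"
    if [measurable]: "f \<in> borel_measurable M" "g \<in> borel_measurable M" for f g and M :: "'x measure"
    using measurable_compose[OF measurable_Pair[OF that] Suc] by simp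
  show ?case
    by (simp add: indicator_Icc_eq indicator_def[of "{.._}"])
qed

lemma measurable_volterra_term' [measurable (raw)]:
  assumes [measurable]: "b \<in> borel_measurable borel" "f \<in> borel_measurable M" "g \<in> borel_measurable M"
  shows "(\<lambda>x. volterra_term b n (f x) (g x)) \<in> borel_measurable M"
  using measurable_compose[OF measurable_Pair[OF assms(2,3)] measurable_volterra_term[OF assms(1)]] by simp

lemma integral_exp_bound:
  fixes \<kappa> r :: real
  assumes "\<kappa> > 0" "r \<ge> 0"
  shows "integrable lborel (\<lambda>\<rho>. (indicator {0..r} \<rho> * exp (\<kappa> * \<rho>))\<^sup>2)"
    and "(LBINT \<rho>. (indicator {0..r} \<rho> * exp (\<kappa> * \<rho>))\<^sup>2) \<le> (exp (\<kappa> * r))\<^sup>2 / (2 * \<kappa>)"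
proof -
  have "has_bochner_integral lborel (\<lambda>x. exp (2 * \<kappa> * x) * indicator {0..r} x)
     (exp (2 * \<kappa> * r) / (2 * \<kappa>) - exp (2 * \<kappa> * 0) / (2 * \<kappa>))"
  proof (rule has_bochner_integral_FTC_Icc_real)
    show "0 \<le> r" by fact
    show "((\<lambda>x. exp (2 * \<kappa> * x) / (2 * \<kappa>)) has_real_derivative exp (2 * \<kappa> * x)) (at x)" for x
      using assms by (auto intro!: derivative_eq_intros)
  qed (auto intro!: continuous_intros)
  moreover have "(\<lambda>\<rho>. (indicator {0..r} \<rho> * exp (\<kappa> * \<rho>))\<^sup>2) = (\<lambda>x. exp (2 * \<kappa> * x) * indicator {0..r} x)"
    by (auto simp: indicator_def exp_double[symmetric] mult.assoc)
  ultimately have *: "has_bochner_integral lborel (\<lambda>\<rho>. (indicator {0..r} \<rho> * exp (\<kappa> * \<rho>))\<^sup>2)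
     (exp (2 * \<kappa> * r) / (2 * \<kappa>) - exp (2 * \<kappa> * 0) / (2 * \<kappa>))" by simp
  then show "integrable lborel (\<lambda>\<rho>. (indicator {0..r} \<rho> * exp (\<kappa> * \<rho>))\<^sup>2)"
    by (rule integrable.intros)
  show "(LBINT \<rho>. (indicator {0..r} \<rho> * exp (\<kappa> * \<rho>))\<^sup>2) \<le> (exp (\<kappa> * r))\<^sup>2 / (2 * \<kappa>)"
    unfolding has_bochner_integral_integral_eq[OF *] using assms
    by (simp add: exp_double[symmetric] mult.assoc)
qed

text \<open>The weight \<open>exp (\<kappa> r)\<close> with \<open>\<kappa> = 2 \<parallel>b\<parallel>\<^sup>2 + 1\<close> makes the Volterra operator a contraction with factor 1/2.\<close>
lemma volterra_step:
  fixes h :: "real \<Rightarrow> complex"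
  assumes b: "square_integrable b" and supp: "\<And>x. x < 0 \<Longrightarrow> b x = 0" and "r \<ge> 0"
    and h[measurable]: "h \<in> borel_measurable borel"
    and \<kappa>: "\<kappa> = 2 * sq_norm b + 1"
    and bd: "\<And>\<rho>. cmod (h \<rho>) \<le> B * exp (\<kappa> * \<rho>)" and "B \<ge> 0"
  shows "integrable lborel (\<lambda>\<rho>. indicator {..r} \<rho> * b \<rho> * h \<rho>)"
    and "(LBINT \<rho>. cmod (indicator {..r} \<rho> * b \<rho> * h \<rho>)) \<le> B / 2 * exp (\<kappa> * r)"
proof -
  note [measurable] = square_integrable_measurable[OF b]
  have "\<kappa> > 0" using \<kappa> sq_norm_nonneg[of b] by linarith
  define e where "e \<rho> = indicator {0..r} \<rho> * exp (\<kappa> * \<rho>)" for \<rho>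
  have [measurable]: "e \<in> borel_measurable borel" unfolding e_def by measurable
  have b2: "integrable lborel (\<lambda>x. (cmod (b x))\<^sup>2)" using b by (simp add: square_integrable_def)
  note e2 = integral_exp_bound[OF \<open>\<kappa> > 0\<close> \<open>r \<ge> 0\<close>, folded e_def]
  have int: "integrable lborel (\<lambda>\<rho>. cmod (b \<rho>) * e \<rho>)"
    by (rule Cauchy_Schwarz_real(1)[OF _ _ b2 e2(1)]) measurable
  have pt: "cmod (indicator {..r} \<rho> * b \<rho> * h \<rho>) \<le> B * (cmod (b \<rho>) * e \<rho>)" for \<rho>
  proof (cases "0 \<le> \<rho> \<and> \<rho> \<le> r")
    case True
    then show ?thesis using mult_left_mono[OF bd[of \<rho>], of "cmod (b \<rho>)"]
      by (simp add: e_def norm_mult mult_ac)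
  qed (use supp in \<open>auto simp: e_def\<close>)
  show int': "integrable lborel (\<lambda>\<rho>. indicator {..r} \<rho> * b \<rho> * h \<rho>)"
    by (rule Bochner_Integration.integrable_bound[OF integrable_mult_right[OF int, of B]])
      (use pt order_trans[OF pt abs_ge_self] in auto)
  have "(LBINT \<rho>. cmod (b \<rho>) * e \<rho>)\<^sup>2 \<le> sq_norm b * ((exp (\<kappa> * r))\<^sup>2 / (2 * \<kappa>))"
  proof -
    have "(LBINT \<rho>. cmod (b \<rho>) * e \<rho>)\<^sup>2 = (LBINT \<rho>. \<bar>cmod (b \<rho>) * e \<rho>\<bar>)\<^sup>2"
      by (simp add: e_def abs_mult)
    also have "\<dots> \<le> sq_norm b * (LBINT x. (e x)\<^sup>2)"
      unfolding sq_norm_def by (rule Cauchy_Schwarz_real(2)[OF _ _ b2 e2(1)]) measurable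
    also have "\<dots> \<le> sq_norm b * ((exp (\<kappa> * r))\<^sup>2 / (2 * \<kappa>))"
      by (intro mult_left_mono e2) auto
    finally show ?thesis .
  qed
  \<comment> \<open>Since \<open>\<kappa> > 2 * sq_norm b\<close>, the factor
    \<open>sq_norm b / (2 * \<kappa>)\<close> is at most 1/4, whose root is the contraction factor.
    The summand 1 in \<open>\<kappa>\<close> keeps it positive when \<open>b\<close>
    vanishes.\<close>
  also have "\<dots> \<le> (exp (\<kappa> * r) / 2)\<^sup>2"
    using \<open>\<kappa> > 0\<close> \<kappa> by (simp add: field_simps)
  finally have "(LBINT \<rho>. cmod (b \<rho>) * e \<rho>) \<le> exp (\<kappa> * r) / 2"
    by (rule power2_le_imp_le) simp
  have "(LBINT \<rho>. cmod (indicator {..r} \<rho> * b \<rho> * h \<rho>)) \<le> (LBINT \<rho>. B * (cmod (b \<rho>) * e \<rho>))"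
    by (intro integral_mono integrable_norm int' integrable_mult_right int pt)
  also have "\<dots> = B * (LBINT \<rho>. cmod (b \<rho>) * e \<rho>)" by simp
  also have "\<dots> \<le> B * (exp (\<kappa> * r) / 2)" by (intro mult_left_mono) fact+
  finally show "(LBINT \<rho>. cmod (indicator {..r} \<rho> * b \<rho> * h \<rho>)) \<le> B / 2 * exp (\<kappa> * r)"
    by simp
qed

text \<open>The count starts at \<open>Suc 0\<close> because the zeroth term is \<open>b\<close>
  itself, which is only square integrable. One integration pairs \<open>b\<close> with a translate
  of itself, and Cauchy-Schwarz bounds the result at every point; from then on each application of
  \<open>volterra_step\<close> gains a factor 1/2.\<close>

lemma volterra_term_bound:
  assumes b: "square_integrable b" and supp: "\<And>x. x < 0 \<Longrightarrow> b x = 0"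
    and \<kappa>: "\<kappa> = 2 * sq_norm b + 1"
  shows "cmod (volterra_term b (Suc n) r s) \<le> sq_norm b * (1/2) ^ n * exp (\<kappa> * r)"
proof (induction n arbitrary: r s)
  case 0
  show ?case
  proof (cases "0 \<le> s \<and> s \<le> r")
    case True
    let ?f = "\<lambda>\<rho>. indicator {..r} \<rho> * b \<rho>" and ?g = "\<lambda>\<rho>. cnj (indicator {0..\<rho>} (\<rho> - s) * b (\<rho> - s))"
    note [measurable] = square_integrable_measurable[OF b]
    have f: "square_integrable ?f"
      by (rule square_integrable_bound[OF b, of _ 1]) (auto simp: indicator_def)
    have bs: "square_integrable (\<lambda>\<rho>. cnj (b (\<rho> - s)))"
      by (intro square_integrable_cnj square_integrable_translate b)
    have g: "square_integrable ?g"
      by (rule square_integrable_bound[OF bs, of _ 1]) (auto simp: indicator_Icc_eq)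
    have "sq_norm ?f \<le> sq_norm b" unfolding sq_norm_def
      by (rule integral_mono) (use f b in \<open>auto simp: square_integrable_def indicator_def\<close>)
    moreover have "sq_norm ?g \<le> sq_norm (\<lambda>\<rho>. cnj (b (\<rho> - s)))" unfolding sq_norm_def
      by (rule integral_mono) (use g bs in \<open>auto simp: square_integrable_def indicator_def\<close>)
    ultimately have "(cmod (LBINT \<rho>. ?f \<rho> * ?g \<rho>))\<^sup>2 \<le> (sq_norm b)\<^sup>2" unfolding power2_eq_square[of "sq_norm b"]
      using square_integrable_mult(3)[OF f g] square_integrable_translate(2)[OF b, of s]
      using mult_mono[of "sq_norm ?f" "sq_norm b" "sq_norm ?g" "sq_norm b"] by simp
    then have "cmod (LBINT \<rho>. ?f \<rho> * ?g \<rho>) \<le> sq_norm b"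
      by (rule power2_le_imp_le) simp
    moreover have "1 \<le> exp (\<kappa> * r)" using True \<kappa> by simp
    ultimately have "cmod (LBINT \<rho>. ?f \<rho> * ?g \<rho>) \<le> sq_norm b * exp (\<kappa> * r)"
      using mult_left_mono[of 1 "exp (\<kappa> * r)" "sq_norm b"] by simp
    then show ?thesis using True by (simp add: indicator_Icc_eq[of r s])
  qed (auto simp: indicator_Icc_eq[of r s])
next
  case (Suc n)
  show ?case
  proof (cases "0 \<le> s \<and> s \<le> r")
    case True
    note [measurable] = square_integrable_measurable[OF b]
    have "cmod (LBINT \<rho>. indicator {..r} \<rho> * b \<rho> * cnj (volterra_term b (Suc n) \<rho> (\<rho> - s)))
      \<le> (LBINT \<rho>. cmod (indicator {..r} \<rho> * b \<rho> * cnj (volterra_term b (Suc n) \<rho> (\<rho> - s))))"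
      by (rule integral_norm_bound)
    also have "\<dots> \<le> (sq_norm b * (1/2) ^ n) / 2 * exp (\<kappa> * r)"
    proof (rule volterra_step(2)[OF b supp _ _ \<kappa>, where B = "sq_norm b * (1/2) ^ n"])
      show "cmod (cnj (volterra_term b (Suc n) \<rho> (\<rho> - s))) \<le> sq_norm b * (1/2) ^ n * exp (\<kappa> * \<rho>)" for \<rho>
        unfolding complex_mod_cnj by (rule Suc)
      show "(\<lambda>\<rho>. cnj (volterra_term b (Suc n) \<rho> (\<rho> - s))) \<in> borel_measurable borel"
        by (intro borel_measurable_cnj measurable_volterra_term') measurable
    qed (use True in auto)
    finally show ?thesis
      unfolding volterra_term.simps(2)[of b "Suc n"] using True
      by (simp add: indicator_Icc_eq[of r s] del: volterra_term.simps)
  qed (auto simp: indicator_Icc_eq[of r s])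
qed

text \<open>The series converges at every point and not just almost everywhere. This matters because
  later steps evaluate the kernel along lines \<open>(\<rho>, \<rho> - s)\<close> and on the
  diagonal, which are null sets of the plane. The bound on \<open>G r s - b s\<close> says that the
  whole irregularity of the kernel sits in the first term \<open>b\<close>.\<close>

lemma volterra_kernel_exists:
  fixes b :: "real \<Rightarrow> complex"
  assumes b: "square_integrable b" and supp: "\<And>x. x \<notin> {0..R} \<Longrightarrow> b x = 0"
  obtains G C where "(\<lambda>(r, s). G r s) \<in> borel_measurable (borel \<Otimes>\<^sub>M borel)"
    and "\<And>r s. s \<notin> {0..r} \<Longrightarrow> G r s = 0"
    and "\<And>r s. s \<in> {0..r} \<Longrightarrow>
      G r s = b s - (LBINT \<rho>. indicator {..r} \<rho> * b \<rho> * cnj (G \<rho> (\<rho> - s)))"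
    and "\<And>r s. s \<in> {0..r} \<Longrightarrow> r \<le> R \<Longrightarrow> cmod (G r s - b s) \<le> C"
proof -
  note [measurable] = square_integrable_measurable[OF b]
  define \<kappa> where "\<kappa> = 2 * sq_norm b + 1"
  have "\<kappa> > 0" using \<kappa>_def sq_norm_nonneg[of b] by linarith
  have supp0: "b x = 0" if "x < 0" for x using that supp by auto
  define g where "g = volterra_term b"
  have [measurable]: "(\<lambda>x. g n (u x) (v x)) \<in> borel_measurable M"
    if [measurable]: "u \<in> borel_measurable M" "v \<in> borel_measurable M" for n u v and M :: "'x measure"
    unfolding g_def by measurable
  have bound: "cmod (g (Suc n) r s) \<le> sq_norm b * (1/2) ^ n * exp (\<kappa> * r)" for n r s
    unfolding g_def by (rule volterra_term_bound[OF b supp0 \<kappa>_def])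
  have summ1: "summable (\<lambda>n. cmod (g (Suc n) r s))" for r s
    by (rule summable_comparison_test'[where g = "\<lambda>n. sq_norm b * exp (\<kappa> * r) * (1/2) ^ n" and N = 0])
      (use bound[of _ r s] in \<open>auto intro!: summable_mult summable_geometric simp: mult_ac\<close>)
  then have summ: "summable (\<lambda>n. cmod (g n r s))" for r s
    using summable_Suc_iff[of "\<lambda>n. cmod (g n r s)"] by simp
  define G where "G r s = (\<Sum>n. g n r s)" for r s
  have G_split: "G r s = g 0 r s + (\<Sum>n. g (Suc n) r s)" for r s
    using suminf_split_head[OF summable_norm_cancel[OF summ[of r s]]] by (simp add: G_def)
  show thesis
  proof
    show "(\<lambda>(r, s). G r s) \<in> borel_measurable (borel \<Otimes>\<^sub>M borel)"
      unfolding G_def by measurable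
    show "G r s = 0" if "s \<notin> {0..r}" for r s
    proof -
      have "g n r s = 0" for n using that unfolding g_def by (cases n) auto
      then show ?thesis by (simp add: G_def)
    qed
    show "cmod (G r s - b s) \<le> sq_norm b * 2 * exp (\<kappa> * R)" if "s \<in> {0..r}" "r \<le> R" for r s
    proof -
      have "G r s - b s = (\<Sum>n. g (Suc n) r s)"
        using that by (simp add: G_split g_def[THEN fun_cong, of 0])
      also have "cmod \<dots> \<le> (\<Sum>n. cmod (g (Suc n) r s))" by (rule summable_norm[OF summ1])
      also have "\<dots> \<le> (\<Sum>n. sq_norm b * exp (\<kappa> * r) * (1/2) ^ n)"
        by (intro suminf_le summ1 summable_mult summable_geometric) (use bound[of _ r s] in \<open>auto simp: mult_ac\<close>)
      also have "\<dots> = sq_norm b * exp (\<kappa> * r) * 2"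
        by (subst suminf_mult) (auto simp: suminf_geometric intro!: summable_geometric)
      also have "\<dots> \<le> sq_norm b * 2 * exp (\<kappa> * R)"
        using that \<open>\<kappa> > 0\<close> by (simp add: mult_left_mono)
      finally show ?thesis .
    qed
    show "G r s = b s - (LBINT \<rho>. indicator {..r} \<rho> * b \<rho> * cnj (G \<rho> (\<rho> - s)))" if s: "s \<in> {0..r}" for r s
    proof -
      define k where "k n \<rho> = indicator {..r} \<rho> * b \<rho> * cnj (g n \<rho> (\<rho> - s))" for n \<rho>
      have "r \<ge> 0" using s by auto
      have k_int: "integrable lborel (k (Suc n))" for n
        unfolding k_def by (rule volterra_step(1)[OF b supp0 \<open>r \<ge> 0\<close> _ \<kappa>_def, where B = "sq_norm b * (1/2) ^ n"])
          (use bound in auto)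
      have k_bd: "(LBINT \<rho>. norm (k (Suc n) \<rho>)) \<le> sq_norm b * (1/2) ^ n / 2 * exp (\<kappa> * r)" for n
        unfolding k_def by (rule volterra_step(2)[OF b supp0 \<open>r \<ge> 0\<close> _ \<kappa>_def, where B = "sq_norm b * (1/2) ^ n"])
          (use bound in auto)
      \<comment> \<open>The zeroth summand contains two unbounded factors, so its integrability
        comes from Cauchy-Schwarz; all later summands are covered by
        \<open>volterra_step\<close>.\<close>
      have f: "square_integrable (\<lambda>\<rho>. indicator {..r} \<rho> * b \<rho>)"
        by (rule square_integrable_bound[OF b, of _ 1]) (auto simp: indicator_def)
      have h: "square_integrable (\<lambda>\<rho>. cnj (g 0 \<rho> (\<rho> - s)))" 
        by (rule square_integrable_bound[OF square_integrable_translate(1)[OF b, of s], of _ 1])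
          (auto simp: indicator_def g_def)
      have k0: "integrable lborel (k 0)"
        using square_integrable_mult(1)[OF f h] by (simp add: k_def[abs_def])
      have k_int': "integrable lborel (k n)" for n using k0 k_int by (cases n) auto
      have sN: "summable (\<lambda>n. LBINT \<rho>. norm (k n \<rho>))"
      proof (subst summable_Suc_iff[symmetric], rule summable_comparison_test'[where N = 0])
        show "summable (\<lambda>n. sq_norm b * exp (\<kappa> * r) / 2 * (1/2) ^ n)"
          by (intro summable_mult summable_geometric) auto
        show "norm (LBINT \<rho>. norm (k (Suc n) \<rho>)) \<le> sq_norm b * exp (\<kappa> * r) / 2 * (1/2) ^ n" for n
          using k_bd[of n] by (simp add: mult_ac)
      qed
      have sP: "summable (\<lambda>n. norm (k n \<rho>))" for \<rho>
        using summable_mult[OF summ[of \<rho> "\<rho> - s"], of "cmod (indicator {..r} \<rho> * b \<rho>)"]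
        by (simp add: k_def norm_mult)
      have "(LBINT \<rho>. (\<Sum>n. k n \<rho>)) = (\<Sum>n. LBINT \<rho>. k n \<rho>)"
        by (rule integral_suminf[OF k_int' _ sN]) (use sP in auto)
      moreover have "(\<Sum>n. k n \<rho>) = indicator {..r} \<rho> * b \<rho> * cnj (G \<rho> (\<rho> - s))" for \<rho>
      proof -
        have "(\<lambda>n. g n \<rho> (\<rho> - s)) sums G \<rho> (\<rho> - s)"
          unfolding G_def using summable_norm_cancel[OF summ] by (rule summable_sums)
        then have "(\<lambda>n. indicator {..r} \<rho> * b \<rho> * cnj (g n \<rho> (\<rho> - s))) sums (indicator {..r} \<rho> * b \<rho> * cnj (G \<rho> (\<rho> - s)))"
          by (intro sums_mult) (simp add: sums_cnj)
        then show ?thesis unfolding k_def by (rule sums_unique[symmetric])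
      qed
      moreover have "(LBINT \<rho>. k n \<rho>) = - g (Suc n) r s" for n
        using s by (simp add: k_def g_def)
      ultimately have "(LBINT \<rho>. indicator {..r} \<rho> * b \<rho> * cnj (G \<rho> (\<rho> - s))) = - (\<Sum>n. g (Suc n) r s)"
        using suminf_minus[OF summable_norm_cancel[OF summ1]] by simp
      then show ?thesis using s by (simp add: G_split g_def[THEN fun_cong, of 0])
    qed
  qed
qed

section \<open>Absolutely continuous functions and Gronwall's inequality\<close>

text \<open>The hypotheses speak of \<open>lebesgue\<close>, while the double integrals below are
  taken over \<open>lborel \<Otimes>\<^sub>M lborel\<close>. All data are therefore replaced by
  Borel functions that agree with them almost everywhere.\<close>

lemma borel_version:
  fixes f :: "real \<Rightarrow> complex"
  assumes f: "f \<in> borel_measurable lebesgue"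
  obtains f' where "f' \<in> borel_measurable borel" "AE x in lborel. f x = f' x"
proof -
  have "(\<lambda>x. Re (f x)) \<in> borel_measurable lebesgue" "(\<lambda>x. Im (f x)) \<in> borel_measurable lebesgue"
    using f by measurable
  then obtain u v where uv: "u \<in> borel_measurable lborel" "AE x in lborel. Re (f x) = u x"
    "v \<in> borel_measurable lborel" "AE x in lborel. Im (f x) = v x"
    using completion_ex_borel_measurable_real by metis
  show thesis
  proof
    show "(\<lambda>x. Complex (u x) (v x)) \<in> borel_measurable borel"
      using uv(1,3) by (simp add: Complex_eq)
    show "AE x in lborel. f x = Complex (u x) (v x)"
      using uv(2,4) by eventually_elim (simp add: complex_eq_iff)
  qed
qed

lemma lebesgue_integral_borel_version:
  fixes f f' :: "real \<Rightarrow> 'a::{banach, second_countable_topology}"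
  assumes f: "f \<in> borel_measurable lebesgue" and f': "f' \<in> borel_measurable borel"
    and ae: "AE x in lborel. f x = f' x"
  shows "(LINT x|lebesgue. f x) = (LBINT x. f' x)"
    and "integrable lebesgue f \<longleftrightarrow> integrable lborel f'"
proof -
  have ae': "AE x in lebesgue. f x = f' x" using ae by (rule AE_completion)
  have m: "f' \<in> borel_measurable lebesgue" using f' by (auto intro: measurable_completion)
  show "(LINT x|lebesgue. f x) = (LBINT x. f' x)"
    using integral_cong_AE[OF f m ae'] integral_completion[of f' lborel] f' by simp
  show "integrable lebesgue f \<longleftrightarrow> integrable lborel f'"
    using integrable_cong_AE[OF f m ae'] integrable_completion[of f' lborel] f' by simp
qed

lemma L1_bound_integral:
  fixes f :: "real \<Rightarrow> complex"
  assumes f: "integrable lborel f" and [measurable]: "g \<in> borel_measurable borel" and "\<And>x. cmod (g x) \<le> cmod (f x)"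
  shows "integrable lborel g" "cmod (LBINT x. g x) \<le> (LBINT x. cmod (f x))"
proof -
  show g: "integrable lborel g"
    by (rule Bochner_Integration.integrable_bound[OF f]) (use assms in auto)
  have "cmod (LBINT x. g x) \<le> (LBINT x. cmod (g x))" by (rule integral_norm_bound)
  also have "\<dots> \<le> (LBINT x. cmod (f x))"
    by (intro integral_mono integrable_norm f g assms)
  finally show "cmod (LBINT x. g x) \<le> (LBINT x. cmod (f x))" .
qed

lemma integrable_prod_pair:
  fixes f g :: "real \<Rightarrow> complex"
  assumes f: "integrable lborel f" and g: "integrable lborel g"
  shows "integrable (lborel \<Otimes>\<^sub>M lborel) (\<lambda>(x, y). f x * g y)"
proof (rule lborel_pair.Fubini_integrable)
  note [measurable] = borel_measurable_integrable[OF f] borel_measurable_integrable[OF g]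
  show "(\<lambda>(x, y). f x * g y) \<in> borel_measurable (lborel \<Otimes>\<^sub>M lborel)" by measurable
  show "integrable lborel (\<lambda>x. LBINT y. norm (case (x, y) of (x, y) \<Rightarrow> f x * g y))"
    using f by (simp add: norm_mult)
  show "AE x in lborel. integrable lborel (\<lambda>y. case (x, y) of (x, y) \<Rightarrow> f x * g y)"
    using g by simp
qed

lemma measurable_primitive:
  fixes f :: "real \<Rightarrow> complex"
  assumes [measurable]: "f \<in> borel_measurable borel"
  shows "(\<lambda>x. LBINT u. indicator {0..x} u * f u) \<in> borel_measurable borel"
  by (simp add: indicator_Icc_eq)

lemma bounded_integrable:
  fixes f :: "real \<Rightarrow> complex"
  assumes "f \<in> borel_measurable borel" "\<And>x. x \<notin> {a..c} \<Longrightarrow> f x = 0" "\<And>x. cmod (f x) \<le> B"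
  shows "integrable lborel f"
  using square_integrable_imp_integrable[OF square_integrable_bounded[OF assms] assms(2)] by simp

lemma indicator_integrable:
  fixes f :: "real \<Rightarrow> complex"
  assumes "integrable lborel f" shows "integrable lborel (\<lambda>x. indicator {a..c} x * f x)"
proof (rule Bochner_Integration.integrable_bound[OF assms])
  note [measurable] = borel_measurable_integrable[OF assms]
  show "(\<lambda>x. indicator {a..c} x * f x) \<in> borel_measurable lborel" by measurable
qed (auto simp: indicator_def)

lemma exp_measurable [measurable (raw)]:
  assumes "f \<in> borel_measurable M"
  shows "(\<lambda>x. exp (w * complex_of_real (f x))) \<in> borel_measurable M"
proof -
  have "(\<lambda>s. exp (w * complex_of_real s)) \<in> borel_measurable borel"
    by (intro borel_measurable_continuous_onI continuous_intros)
  from measurable_compose[OF assms this] show ?thesis .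
qed

lemma bounded_indicator_integrable:
  fixes f :: "real \<Rightarrow> complex"
  assumes [measurable]: "f \<in> borel_measurable borel" and f: "\<And>x. x \<in> {0..r} \<Longrightarrow> cmod (f x) \<le> B" "0 \<le> B"
  shows "integrable lborel (\<lambda>x. indicator {0..r} x * f x)"
  by (rule square_integrable_imp_integrable[OF square_integrable_bounded[of _ 0 r B]])
     (use f in \<open>auto simp: indicator_def\<close>)

lemma primitive_bound:
  fixes f :: "real \<Rightarrow> complex"
  assumes "integrable lborel f"
  shows "cmod (c + (LBINT u. indicator {0..x} u * f u)) \<le> cmod c + (LBINT u. cmod (f u))"
proof -
  have "cmod (LBINT u. indicator {0..x} u * f u) \<le> (LBINT u. cmod (f u))"
    by (rule L1_bound_integral(2)[OF assms]) (use indicator_integrable[OF assms] in \<open>auto simp: indicator_def\<close>)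
  then show ?thesis using norm_triangle_ineq order_trans by (metis add_left_mono)
qed

text \<open>Only integral representations are available, so the product rule is obtained from
  Fubini: the product of the increments of \<open>F\<close> and \<open>G\<close> is the integral of
  \<open>f x * g u\<close> over a square, which is split into the triangles \<open>u \<le> x\<close>
  and \<open>x \<le> u\<close>. Their common diagonal is null.\<close>

lemma AC_integral_by_parts:
  fixes f g F G :: "real \<Rightarrow> complex"
  assumes f: "integrable lborel (\<lambda>u. indicator {0..r} u * f u)"
    and g: "integrable lborel (\<lambda>u. indicator {0..r} u * g u)"
    and F: "\<And>x. x \<in> {0..r} \<Longrightarrow> F x = F 0 + (LBINT u. indicator {0..x} u * f u)"
    and G: "\<And>x. x \<in> {0..r} \<Longrightarrow> G x = G 0 + (LBINT u. indicator {0..x} u * g u)"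
    and "0 \<le> r"
  shows "integrable lborel (\<lambda>x. indicator {0..r} x * (f x * G x))"
    and "integrable lborel (\<lambda>x. indicator {0..r} x * (F x * g x))"
    and "(LBINT x. indicator {0..r} x * (f x * G x)) + (LBINT x. indicator {0..r} x * (F x * g x))
      = F r * G r - F 0 * G 0"
proof -
  define f' where "f' u = indicator {0..r} u * f u" for u
  define g' where "g' u = indicator {0..r} u * g u" for u
  have f': "integrable lborel f'" and g': "integrable lborel g'"
    using f g by (simp_all add: f'_def[abs_def] g'_def[abs_def])
  note [measurable] = borel_measurable_integrable[OF f', simplified] borel_measurable_integrable[OF g', simplified]
  have pair: "integrable (lborel \<Otimes>\<^sub>M lborel) (\<lambda>(x, u). if u \<le> x then p x * q u else 0)"
    if p: "integrable lborel p" and q: "integrable lborel q" for p q :: "real \<Rightarrow> complex"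
  proof (rule Bochner_Integration.integrable_bound[OF integrable_prod_pair[OF p q]])
    note [measurable] = borel_measurable_integrable[OF p, simplified] borel_measurable_integrable[OF q, simplified]
    show "(\<lambda>(x, u). if u \<le> x then p x * q u else 0) \<in> borel_measurable (lborel \<Otimes>\<^sub>M lborel)" by measurable
  qed auto
  have eqF: "indicator {0..r} x * (F x * g x) = F 0 * g' x + (LBINT u. (if u \<le> x then g' x * f' u else 0))" for x
  proof (cases "x \<in> {0..r}")
    case True
    have "(LBINT u. (if u \<le> x then g' x * f' u else 0)) = (LBINT u. g' x * (indicator {0..x} u * f u))"
      by (rule Bochner_Integration.integral_cong) (use True in \<open>auto simp: f'_def indicator_def\<close>)
    also have "\<dots> = g' x * (LBINT u. indicator {0..x} u * f u)" by (rule integral_mult_right_zero)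
    also have "\<dots> = g' x * (F x - F 0)" using True F[of x] by simp
    finally show ?thesis using True by (simp add: g'_def algebra_simps)
  qed (auto simp: g'_def cong: if_cong)
  have eqG: "indicator {0..r} x * (f x * G x) = G 0 * f' x + (LBINT u. (if u \<le> x then f' x * g' u else 0))" for x
  proof (cases "x \<in> {0..r}")
    case True
    have "(LBINT u. (if u \<le> x then f' x * g' u else 0)) = (LBINT u. f' x * (indicator {0..x} u * g u))"
      by (rule Bochner_Integration.integral_cong) (use True in \<open>auto simp: g'_def indicator_def\<close>)
    also have "\<dots> = f' x * (LBINT u. indicator {0..x} u * g u)" by (rule integral_mult_right_zero)
    also have "\<dots> = f' x * (G x - G 0)" using True G[of x] by simp
    finally show ?thesis using True by (simp add: f'_def algebra_simps)
  qed (auto simp: f'_def cong: if_cong)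
  note i1 = lborel_pair.integrable_fst[OF pair[OF g' f']] and i2 = lborel_pair.integrable_fst[OF pair[OF f' g']]
  show "integrable lborel (\<lambda>x. indicator {0..r} x * (f x * G x))"
    unfolding eqG by (intro Bochner_Integration.integrable_add integrable_mult_right f' i2)
  show "integrable lborel (\<lambda>x. indicator {0..r} x * (F x * g x))"
    unfolding eqF by (intro Bochner_Integration.integrable_add integrable_mult_right g' i1)
  have inner: "(LBINT u. (if u \<le> x then f' x * g' u else 0)) + (LBINT u. (if x \<le> u then g' u * f' x else 0))
       = f' x * (LBINT u. g' u)" for x
  proof -
    have 1: "integrable lborel (\<lambda>u. if u \<le> x then f' x * g' u else 0)"
      by (rule Bochner_Integration.integrable_bound[OF integrable_mult_right[OF g', of "f' x"]]) auto
    have 2: "integrable lborel (\<lambda>u. if x \<le> u then g' u * f' x else 0)"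
      by (rule Bochner_Integration.integrable_bound[OF integrable_mult_right[OF g', of "f' x"]]) (auto simp: mult.commute)
    have "(LBINT u. (if u \<le> x then f' x * g' u else 0)) + (LBINT u. (if x \<le> u then g' u * f' x else 0))
      = (LBINT u. (if u \<le> x then f' x * g' u else 0) + (if x \<le> u then g' u * f' x else 0))"
      by (rule Bochner_Integration.integral_add[OF 1 2, symmetric])
    also have "\<dots> = (LBINT u. f' x * g' u)"
    proof (rule integral_cong_AE)
      show "AE u in lborel. (if u \<le> x then f' x * g' u else 0) + (if x \<le> u then g' u * f' x else 0) = f' x * g' u"
        using AE_lborel_singleton[of x] by eventually_elim auto
    qed measurable
    finally show ?thesis by simp
  qed
  have swap: "(LBINT x. LBINT u. (if u \<le> x then g' x * f' u else 0))
      = (LBINT x. LBINT u. (if x \<le> u then g' u * f' x else 0))"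
    using lborel_pair.Fubini_integral[OF pair[OF g' f']] by simp
  have i1': "integrable lborel (\<lambda>x. LBINT u. (if x \<le> u then g' u * f' x else 0))"
    using lborel_pair.integrable_snd[OF pair[OF g' f']] by simp
  have ends: "F r = F 0 + (LBINT u. f' u)" "G r = G 0 + (LBINT u. g' u)"
    using F[of r] G[of r] \<open>0 \<le> r\<close> by (simp_all add: f'_def g'_def)
  have "(LBINT x. indicator {0..r} x * (f x * G x)) + (LBINT x. indicator {0..r} x * (F x * g x))
     = G 0 * (LBINT x. f' x) + F 0 * (LBINT x. g' x)
       + ((LBINT x. LBINT u. (if u \<le> x then f' x * g' u else 0))
       + (LBINT x. LBINT u. (if u \<le> x then g' x * f' u else 0)))"
    unfolding eqF eqG using f' g' i1 i2 by simp
  also have "(LBINT x. LBINT u. (if u \<le> x then f' x * g' u else 0))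
       + (LBINT x. LBINT u. (if u \<le> x then g' x * f' u else 0)) = (LBINT x. f' x * (LBINT u. g' u))"
    unfolding swap inner[symmetric] by (rule Bochner_Integration.integral_add[OF i2 i1', symmetric])
  also have "\<dots> = (LBINT x. f' x) * (LBINT u. g' u)" by simp
  finally show "(LBINT x. indicator {0..r} x * (f x * G x)) + (LBINT x. indicator {0..r} x * (F x * g x))
      = F r * G r - F 0 * G 0"
    by (simp add: ends algebra_simps)
qed

lemma exp_primitive:
  fixes w :: complex
  assumes "0 \<le> x"
  shows "integrable lborel (\<lambda>u. indicator {0..x} u * (w * exp (w * of_real u)))"
    and "exp (w * of_real x) = 1 + (LBINT u. indicator {0..x} u * (w * exp (w * of_real u)))"
proof -
  have "has_bochner_integral lborel (\<lambda>u. indicator {0..x} u *\<^sub>R (w * exp (w * of_real u)))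
     (exp (w * of_real x) - exp (w * of_real 0))"
  proof (rule has_bochner_integral_FTC_Icc[OF assms])
    show "((\<lambda>u. exp (w * complex_of_real u)) has_vector_derivative w * exp (w * of_real u)) (at u within {0..x})" for u
    proof -
      have "((\<lambda>z. exp (w * z)) has_field_derivative w * exp (w * of_real u)) (at (of_real u))"
        by (auto intro!: derivative_eq_intros)
      from has_vector_derivative_real_field[OF this] show ?thesis
        by (rule has_vector_derivative_at_within)
    qed
  qed (auto intro!: continuous_intros)
  moreover have "indicator {0..x} u *\<^sub>R c = indicator {0..x} u * c" for u :: real and c :: complex
    by (simp add: indicator_def)
  ultimately have *: "has_bochner_integral lborel (\<lambda>u. indicator {0..x} u * (w * exp (w * of_real u))) (exp (w * of_real x) - 1)"
    by simp
  show "integrable lborel (\<lambda>u. indicator {0..x} u * (w * exp (w * of_real u)))"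
    using * by (rule integrable.intros)
  show "exp (w * of_real x) = 1 + (LBINT u. indicator {0..x} u * (w * exp (w * of_real u)))"
    using has_bochner_integral_integral_eq[OF *] by simp
qed

text \<open>Iterating the inequality improves the bound \<open>M\<close> to
  \<open>M * (1/2) ^ k * exp (\<kappa> * x)\<close>. Integrating the weight gains
  \<open>1 / \<kappa>\<close>, and \<open>\<kappa> = 2 * K + 1\<close> makes
  \<open>K / \<kappa>\<close> at most 1/2. Boundedness and measurability take the place of
  continuity, which is not established for the norm of the residual to which this is
  applied.\<close>

lemma Gronwall_zero:
  fixes n :: "real \<Rightarrow> real"
  assumes [measurable]: "n \<in> borel_measurable borel"
    and n0: "\<And>x. x \<in> {0..R} \<Longrightarrow> 0 \<le> n x" and bd: "\<And>x. x \<in> {0..R} \<Longrightarrow> n x \<le> M" and "K \<ge> 0"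
    and gr: "\<And>x. x \<in> {0..R} \<Longrightarrow> n x \<le> K * (LBINT u. indicator {0..x} u * n u)"
    and x: "x \<in> {0..R}"
  shows "n x = 0"
proof -
  define \<kappa> where "\<kappa> = 2 * K + 1"
  have "\<kappa> > 0" using \<open>K \<ge> 0\<close> by (simp add: \<kappa>_def)
  have "M \<ge> 0" using n0[OF x] bd[OF x] by linarith
  have *: "n x \<le> M * (1/2) ^ k * exp (\<kappa> * x)" if "x \<in> {0..R}" for k x
    using that
  proof (induction k arbitrary: x)
    case 0
    have "1 \<le> exp (\<kappa> * x)" using 0 \<open>\<kappa> > 0\<close> by simp
    then show ?case using bd[OF 0] mult_left_mono[of 1 "exp (\<kappa> * x)" M] \<open>M \<ge> 0\<close> by simp
  next
    case (Suc k)
    have "x \<ge> 0" using Suc by auto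
    have hb: "has_bochner_integral lborel (\<lambda>u. exp (\<kappa> * u) * indicator {0..x} u) (exp (\<kappa> * x) / \<kappa> - exp (\<kappa> * 0) / \<kappa>)"
    proof (rule has_bochner_integral_FTC_Icc_real)
      show "((\<lambda>u. exp (\<kappa> * u) / \<kappa>) has_real_derivative exp (\<kappa> * u)) (at u)" for u
        using \<open>\<kappa> > 0\<close> by (auto intro!: derivative_eq_intros)
    qed (use \<open>x \<ge> 0\<close> in \<open>auto intro!: continuous_intros\<close>)
    have int: "integrable lborel (\<lambda>u. M * (1/2) ^ k * (exp (\<kappa> * u) * indicator {0..x} u))"
      using hb integrable.intros by (intro integrable_mult_right) blast
    have le: "indicator {0..x} u * n u \<le> M * (1/2) ^ k * (exp (\<kappa> * u) * indicator {0..x} u)" for u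
      using Suc.IH[of u] Suc.prems by (auto simp: indicator_def)
    have ge0: "0 \<le> indicator {0..x} u * n u" for u
      using n0[of u] Suc.prems by (auto simp: indicator_def)
    have "integrable lborel (\<lambda>u. indicator {0..x} u * n u)"
      by (rule Bochner_Integration.integrable_bound[OF int])
        (use le ge0 in \<open>auto intro: order_trans[OF _ abs_ge_self]\<close>)
    then have "(LBINT u. indicator {0..x} u * n u) \<le> (LBINT u. M * (1/2) ^ k * (exp (\<kappa> * u) * indicator {0..x} u))"
      by (rule integral_mono[OF _ int]) (rule le)
    also have "\<dots> = M * (1/2) ^ k * (exp (\<kappa> * x) / \<kappa> - 1 / \<kappa>)"
      using has_bochner_integral_integral_eq[OF hb] by simp
    also have "\<dots> \<le> M * (1/2) ^ k * (exp (\<kappa> * x) / \<kappa>)"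
      using \<open>M \<ge> 0\<close> \<open>\<kappa> > 0\<close> by (intro mult_left_mono) auto
    finally have "n x \<le> K * (M * (1/2) ^ k * (exp (\<kappa> * x) / \<kappa>))"
      using gr[OF Suc.prems] \<open>K \<ge> 0\<close> mult_left_mono order_trans by blast
    also have "\<dots> = (K / \<kappa>) * (M * (1/2) ^ k * exp (\<kappa> * x))" by simp
    also have "\<dots> \<le> (1/2) * (M * (1/2) ^ k * exp (\<kappa> * x))"
      using \<open>M \<ge> 0\<close> \<open>\<kappa> > 0\<close> by (intro mult_right_mono) (auto simp: \<kappa>_def field_simps)
    finally show ?case by simp
  qed
  have "(\<lambda>k. M * (1/2) ^ k * exp (\<kappa> * x)) \<longlonglongrightarrow> M * 0 * exp (\<kappa> * x)"
    by (intro tendsto_intros LIMSEQ_power_zero) auto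
  then have "n x \<le> M * 0 * exp (\<kappa> * x)"
    by (rule LIMSEQ_le_const) (use *[OF x] in auto)
  with n0[OF x] show ?thesis by simp
qed

section \<open>Solution of the Krein system through the Volterra kernel\<close>

text \<open>\<open>b\<close> stands for the conjugate of the coefficient \<open>A\<close>, cut off
  to \<open>[0, R]\<close>, and \<open>G r s\<close> will turn out to be \<Gamma>_r(s,0).\<close>

locale volterra_kernel =
  fixes b :: "real \<Rightarrow> complex" and R :: real and G :: "real \<Rightarrow> real \<Rightarrow> complex" and C :: real
  assumes b: "square_integrable b" and b_supp: "\<And>x. x \<notin> {0..R} \<Longrightarrow> b x = 0" and R: "0 < R"
    and G_measurable: "(\<lambda>(r, s). G r s) \<in> borel_measurable (borel \<Otimes>\<^sub>M borel)"
    and G_supp: "\<And>r s. s \<notin> {0..r} \<Longrightarrow> G r s = 0"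
    and G_eq: "\<And>r s. s \<in> {0..r} \<Longrightarrow>
      G r s = b s - (LBINT \<rho>. indicator {..r} \<rho> * b \<rho> * cnj (G \<rho> (\<rho> - s)))"
    and G_bound: "\<And>r s. s \<in> {0..r} \<Longrightarrow> r \<le> R \<Longrightarrow> cmod (G r s - b s) \<le> C"
begin

lemma b_measurable [measurable]: "b \<in> borel_measurable borel"
  using b by (rule square_integrable_measurable)

lemma b_integrable: "integrable lborel b"
  using square_integrable_imp_integrable[OF b b_supp] by simp

lemma G_measurable' [measurable (raw)]:
  assumes [measurable]: "f \<in> borel_measurable M" "g \<in> borel_measurable M"
  shows "(\<lambda>x. G (f x) (g x)) \<in> borel_measurable M"
  using measurable_compose[OF measurable_Pair[OF assms] G_measurable] by simp

lemma C_nonneg: "0 \<le> C"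
proof -
  have "0 \<le> cmod (G 0 0 - b 0)" by simp
  also have "\<dots> \<le> C" using G_bound[of 0 0] R by simp
  finally show ?thesis .
qed

lemma G_le:
  assumes "r \<le> R" shows "cmod (G r s) \<le> cmod (b s) + C * indicator {0..R} s"
proof (cases "s \<in> {0..r}")
  case True
  have "cmod (G r s) \<le> cmod (G r s - b s) + cmod (b s)" by (metis diff_add_cancel norm_triangle_ineq)
  moreover have "s \<in> {0..R}" using True assms by auto
  ultimately show ?thesis using G_bound[OF True \<open>r \<le> R\<close>] by simp
next
  case False
  then show ?thesis using C_nonneg by (simp add: G_supp indicator_def)
qed

text \<open>A single majorant for all lengths up to \<open>R\<close>, square integrable in
  \<open>s\<close>. It dominates every double integral in which the length of \<open>G\<close> is
  itself a variable of integration.\<close>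

lemma G_majorant:
  assumes "r \<le> R" shows "cmod (G r s) \<le> 1 * cmod (of_real (cmod (b s) + C * indicator {0..R} s))"
proof -
  have "0 \<le> cmod (b s) + C * indicator {0..R} s" using C_nonneg by (simp add: indicator_def)
  then have "\<bar>cmod (b s) + C * indicator {0..R} s\<bar> = cmod (b s) + C * indicator {0..R} s" by (rule abs_of_nonneg)
  then show ?thesis unfolding norm_of_real using G_le[OF assms, of s] by simp
qed

lemma majorant: "square_integrable (\<lambda>s. complex_of_real (cmod (b s) + C * indicator {0..R} s))"
proof -
  have 1: "square_integrable (\<lambda>s. complex_of_real (cmod (b s)))"
    by (rule square_integrable_bound[OF b, of _ 1]) auto
  have 2: "square_integrable (\<lambda>s. complex_of_real (C * indicator {0..R} s))"
    by (rule square_integrable_bounded[of _ 0 R "\<bar>C\<bar>"]) (auto simp: indicator_def)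
  show ?thesis using square_integrable_add(1)[OF 1 2] by simp
qed

lemma G_square_integrable: "r \<le> R \<Longrightarrow> square_integrable (G r)"
  by (rule square_integrable_bound[OF majorant _ G_majorant]) measurable

lemma G_sq_norm: "r \<le> R \<Longrightarrow> sq_norm (G r) \<le> sq_norm (\<lambda>s. complex_of_real (cmod (b s) + C * indicator {0..R} s))"
  unfolding sq_norm_def using G_square_integrable[of r] majorant
  by (intro integral_mono) (auto simp: square_integrable_def intro!: power_mono order_trans[OF G_majorant])

lemma G_integrable: "r \<le> R \<Longrightarrow> integrable lborel (G r)"
  by (rule square_integrable_imp_integrable[OF G_square_integrable G_supp])

text \<open>Comparison with the convolution integrand of two integrable functions. The majorant of
  \<open>G \<rho>\<close> is valid only for \<open>\<rho> \<le> R\<close>, but beyond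
  \<open>R\<close> the factor \<open>b \<rho>\<close> vanishes.\<close>

lemma bG_pair_integrable:
  "integrable (lborel \<Otimes>\<^sub>M lborel) (\<lambda>(\<rho>, s). b \<rho> * cnj (G \<rho> (\<rho> - s)))"
proof (rule Bochner_Integration.integrable_bound)
  have m: "integrable lborel (\<lambda>s. complex_of_real (cmod (b s) + C * indicator {0..R} s))"
    by (rule square_integrable_imp_integrable[OF majorant, of 0 R]) (use b_supp in auto)
  show "integrable (lborel \<Otimes>\<^sub>M lborel) (\<lambda>(\<rho>, s). b \<rho> * complex_of_real (cmod (b (\<rho> - s)) + C * indicator {0..R} (\<rho> - s)))"
    using integrable_conv_pair[OF b_integrable m] by simp
  have "cmod (b \<rho>) * cmod (G \<rho> (\<rho> - s)) \<le> cmod (b \<rho>) * cmod (complex_of_real (cmod (b (\<rho> - s)) + C * indicator {0..R} (\<rho> - s)))" for \<rho> s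
    using G_majorant[of \<rho> "\<rho> - s"] b_supp[of \<rho>]
    by (cases "\<rho> \<le> R") (auto simp del: of_real_add of_real_mult intro: mult_left_mono)
  then show "AE x in lborel \<Otimes>\<^sub>M lborel. norm (case x of (\<rho>, s) \<Rightarrow> b \<rho> * cnj (G \<rho> (\<rho> - s)))
      \<le> norm (case x of (\<rho>, s) \<Rightarrow> b \<rho> * complex_of_real (cmod (b (\<rho> - s)) + C * indicator {0..R} (\<rho> - s)))"
    by (auto simp: norm_mult simp del: of_real_add of_real_mult)
qed measurable

text \<open>Fubini applied to \<open>G_eq\<close>. In the inner integral the substitution
  \<open>u = \<rho> - s\<close> splits \<open>exp (w * s)\<close> into
  \<open>exp (w * \<rho>) * exp (- w * u)\<close>, so a transform of \<open>G\<close> with exponent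
  \<open>w\<close> is expressed through the conjugated kernel with exponent \<open>- w\<close>. This
  exchange is the origin of the coupling between \<open>P\<close> and \<open>Ps\<close>.\<close>

lemma kernel_transform:
  assumes "0 \<le> r" "r \<le> R"
  shows "(LBINT s. G r s * exp (w * of_real s)) = (LBINT \<rho>. indicator {0..r} \<rho> * (b \<rho> * exp (w * of_real \<rho>) *
      (1 - (LBINT u. cnj (G \<rho> u) * exp (- w * of_real u)))))"
proof -
  define e where "e s = exp (w * complex_of_real s)" for s
  have [measurable]: "e \<in> borel_measurable borel"
    unfolding e_def by (intro borel_measurable_continuous_onI continuous_intros)
  have e_le: "cmod (e s) \<le> exp (cmod w * R)" if "s \<in> {0..r}" for s
  proof -
    have "Re (w * of_real s) \<le> cmod (w * of_real s)" by (rule complex_Re_le_cmod)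
    also have "\<dots> \<le> cmod w * R" using that assms by (simp add: norm_mult mult_left_mono)
    finally show ?thesis by (simp add: e_def)
  qed
  define k where "k \<rho> s = indicator {..r} \<rho> * indicator {0..r} s * e s * (b \<rho> * cnj (G \<rho> (\<rho> - s)))" for \<rho> s
  have pair: "integrable (lborel \<Otimes>\<^sub>M lborel) (\<lambda>(\<rho>, s). k \<rho> s)"
  proof (rule Bochner_Integration.integrable_bound)
    show "integrable (lborel \<Otimes>\<^sub>M lborel) (\<lambda>(\<rho>, s). of_real (exp (cmod w * R)) * (b \<rho> * cnj (G \<rho> (\<rho> - s))))"
      using integrable_mult_right[OF bG_pair_integrable, of "of_real (exp (cmod w * R))"] by (simp add: case_prod_beta')
    show "(\<lambda>(\<rho>, s). k \<rho> s) \<in> borel_measurable (lborel \<Otimes>\<^sub>M lborel)" unfolding k_def by measurable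
    have "cmod (k \<rho> s) \<le> exp (cmod w * R) * cmod (b \<rho> * cnj (G \<rho> (\<rho> - s)))" for \<rho> s
      using e_le[of s] by (auto simp: k_def norm_mult indicator_def intro!: mult_right_mono)
    then show "AE x in lborel \<Otimes>\<^sub>M lborel. norm (case x of (\<rho>, s) \<Rightarrow> k \<rho> s)
      \<le> norm (case x of (\<rho>, s) \<Rightarrow> of_real (exp (cmod w * R)) * (b \<rho> * cnj (G \<rho> (\<rho> - s))))"
      by (auto simp: norm_mult)
  qed
  have be: "integrable lborel (\<lambda>s. indicator {0..r} s * (b s * e s))"
  proof (rule Bochner_Integration.integrable_bound)
    show "integrable lborel (\<lambda>s. of_real (exp (cmod w * R)) * b s)" using b_integrable by simp
    have "cmod (indicator {0..r} s * (b s * e s)) \<le> cmod (of_real (exp (cmod w * R)) * b s)" for s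
      using e_le[of s] by (auto simp: norm_mult indicator_def mult.commute intro!: mult_right_mono mult_left_mono)
    then show "AE s in lborel. norm (indicator {0..r} s * (b s * e s)) \<le> norm (of_real (exp (cmod w * R)) * b s)" by simp
  qed measurable
  have inner: "(LBINT s. k \<rho> s) = indicator {0..r} \<rho> * (b \<rho> * e \<rho> * (LBINT u. cnj (G \<rho> u) * exp (- w * of_real u)))" for \<rho>
  proof (cases "\<rho> \<in> {0..r}")
    case True
    have "(LBINT s. k \<rho> s) = (LBINT s. b \<rho> * e \<rho> * (cnj (G \<rho> (\<rho> - s)) * exp (- w * of_real (\<rho> - s))))"
    proof (rule Bochner_Integration.integral_cong)
      fix s show "k \<rho> s = b \<rho> * e \<rho> * (cnj (G \<rho> (\<rho> - s)) * exp (- w * of_real (\<rho> - s)))"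
      proof (cases "s \<in> {0..\<rho>}")
        case True
        have "e s = e \<rho> * exp (- w * of_real (\<rho> - s))"
          unfolding e_def exp_add[symmetric] by (simp add: algebra_simps)
        then show ?thesis using True \<open>\<rho> \<in> {0..r}\<close> by (simp add: k_def)
      next
        case False
        then have "G \<rho> (\<rho> - s) = 0" by (intro G_supp) auto
        then show ?thesis by (simp add: k_def)
      qed
    qed simp
    also have "\<dots> = b \<rho> * e \<rho> * (LBINT s. cnj (G \<rho> (\<rho> - s)) * exp (- w * of_real (\<rho> - s)))"
      by (rule integral_mult_right_zero)
    also have "(LBINT s. cnj (G \<rho> (\<rho> - s)) * exp (- w * of_real (\<rho> - s))) = (LBINT u. cnj (G \<rho> u) * exp (- w * of_real u))"
      by (rule integral_reflect(1)[of "\<lambda>u. cnj (G \<rho> u) * exp (- w * of_real u)"])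
    finally show ?thesis using True by simp
  next
    case False
    have "k \<rho> s = 0" for s using False b_supp[of \<rho>] by (cases "\<rho> < 0") (auto simp: k_def)
    then show ?thesis using False by simp
  qed
  have "(LBINT s. G r s * e s) = (LBINT s. indicator {0..r} s * (b s * e s) - (LBINT \<rho>. k \<rho> s))"
  proof (rule Bochner_Integration.integral_cong)
    fix s show "G r s * e s = indicator {0..r} s * (b s * e s) - (LBINT \<rho>. k \<rho> s)"
    proof (cases "s \<in> {0..r}")
      case True
      have "(LBINT \<rho>. k \<rho> s) = (LBINT \<rho>. e s * (indicator {..r} \<rho> * b \<rho> * cnj (G \<rho> (\<rho> - s))))"
        by (rule Bochner_Integration.integral_cong) (use True in \<open>auto simp: k_def\<close>)
      also have "\<dots> = e s * (LBINT \<rho>. indicator {..r} \<rho> * b \<rho> * cnj (G \<rho> (\<rho> - s)))"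
        by (rule integral_mult_right_zero)
      also have "\<dots> = e s * (b s - G r s)" using G_eq[OF True] by simp
      finally show ?thesis using True by (simp add: algebra_simps)
    qed (simp add: G_supp k_def)
  qed simp
  also have "\<dots> = (LBINT s. indicator {0..r} s * (b s * e s)) - (LBINT s. LBINT \<rho>. k \<rho> s)"
    by (rule Bochner_Integration.integral_diff[OF be lborel_pair.integrable_snd[OF pair]])
  also have "(LBINT s. LBINT \<rho>. k \<rho> s) = (LBINT \<rho>. LBINT s. k \<rho> s)"
    by (rule lborel_pair.Fubini_integral[OF pair])
  also have "(LBINT s. indicator {0..r} s * (b s * e s)) - (LBINT \<rho>. LBINT s. k \<rho> s)
      = (LBINT s. indicator {0..r} s * (b s * e s) - (LINT s'|lborel. k s s'))"
    by (rule Bochner_Integration.integral_diff[OF be lborel_pair.integrable_fst[OF pair], symmetric])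
  also have "\<dots> = (LBINT \<rho>. indicator {0..r} \<rho> * (b \<rho> * exp (w * of_real \<rho>) *
      (1 - (LBINT u. cnj (G \<rho> u) * exp (- w * of_real u)))))"
    unfolding inner by (rule Bochner_Integration.integral_cong) (auto simp: e_def algebra_simps)
  finally show ?thesis by (simp add: e_def)
qed

text \<open>The integral amounts to \<open>G r s\<close> against
  \<open>exp (\<i> * z * (r - s))\<close>. The exponential is factored out because the remaining
  factor has an integral equation of its own, \<open>kernel_Q_eq\<close>; the term
  \<open>\<i> * z * P\<close> of the system then arises from the exponential by the product
  rule.\<close>

definition kernel_P :: "real \<Rightarrow> complex \<Rightarrow> complex" where
  "kernel_P r z = exp (\<i> * z * of_real r) * (1 - (LBINT s. G r s * exp (- (\<i> * z) * of_real s)))"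

definition kernel_Ps :: "real \<Rightarrow> complex \<Rightarrow> complex" where
  "kernel_Ps r z = 1 - (LBINT s. cnj (G r s) * exp (\<i> * z * of_real s))"

lemma G_exp_integrable:
  assumes "r \<le> R" shows "integrable lborel (\<lambda>s. G r s * exp (w * of_real s))"
proof (rule Bochner_Integration.integrable_bound)
  show "integrable lborel (\<lambda>s. of_real (exp (cmod w * R)) * G r s)" using G_integrable[OF assms] by simp
  have [measurable]: "(\<lambda>s. exp (w * of_real s)) \<in> borel_measurable borel"
    by (intro borel_measurable_continuous_onI continuous_intros)
  show "(\<lambda>s. G r s * exp (w * of_real s)) \<in> borel_measurable lborel" by measurable
  have "cmod (G r s * exp (w * of_real s)) \<le> cmod (of_real (exp (cmod w * R)) * G r s)" for s
  proof (cases "s \<in> {0..r}")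
    case True
    have "Re (w * of_real s) \<le> cmod (w * of_real s)" by (rule complex_Re_le_cmod)
    also have "\<dots> \<le> cmod w * R" using True assms by (simp add: norm_mult mult_left_mono)
    finally show ?thesis by (simp add: norm_mult mult.commute mult_left_mono)
  qed (simp add: G_supp)
  then show "AE s in lborel. norm (G r s * exp (w * of_real s)) \<le> norm (of_real (exp (cmod w * R)) * G r s)" by simp
qed

lemma kernel_transform_bound:
  assumes "r \<le> R"
  shows "cmod (LBINT s. G r s * exp (w * of_real s)) \<le> exp (cmod w * R) * (LBINT s. cmod (b s) + C * indicator {0..R} s)"
proof -
  have "cmod (LBINT s. G r s * exp (w * of_real s)) \<le> (LBINT s. cmod (G r s * exp (w * of_real s)))"
    by (rule integral_norm_bound)
  also have "\<dots> \<le> (LBINT s. exp (cmod w * R) * (cmod (b s) + C * indicator {0..R} s))"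
  proof (rule integral_mono)
    show "integrable lborel (\<lambda>s. exp (cmod w * R) * (cmod (b s) + C * indicator {0..R} s))"
      using b_integrable integrable_real_indicator[of "{0..R}" lborel] by (auto simp: emeasure_lborel_Icc_eq)
    fix s
    show "cmod (G r s * exp (w * of_real s)) \<le> exp (cmod w * R) * (cmod (b s) + C * indicator {0..R} s)"
    proof (cases "s \<in> {0..r}")
      case True
      have "Re (w * of_real s) \<le> cmod (w * of_real s)" by (rule complex_Re_le_cmod)
      also have "\<dots> \<le> cmod w * R" using True assms by (simp add: norm_mult mult_left_mono)
      finally have "cmod (exp (w * of_real s)) \<le> exp (cmod w * R)" by simp
      then show ?thesis using G_le[OF assms, of s] C_nonneg
        unfolding norm_mult mult.commute[of "cmod (G r s)"] by (intro mult_mono) auto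
    qed (use C_nonneg in \<open>simp add: G_supp\<close>)
  qed (use G_exp_integrable[OF assms] in auto)
  finally show ?thesis by simp
qed

lemma kernel_P_measurable [measurable]: "(\<lambda>r. kernel_P r z) \<in> borel_measurable borel"
  and kernel_Ps_measurable [measurable]: "(\<lambda>r. kernel_Ps r z) \<in> borel_measurable borel"
proof -
  have [measurable]: "(\<lambda>s. exp (w * complex_of_real s)) \<in> borel_measurable borel" for w
    by (intro borel_measurable_continuous_onI continuous_intros)
  have [measurable]: "(\<lambda>x. exp (w * complex_of_real (f x))) \<in> borel_measurable M" if "f \<in> borel_measurable M" for w f and M :: "'x measure"
    using measurable_compose[OF that, of "\<lambda>s. exp (w * complex_of_real s)" borel] by simp
  show "(\<lambda>r. kernel_P r z) \<in> borel_measurable borel" unfolding kernel_P_def by measurable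
  show "(\<lambda>r. kernel_Ps r z) \<in> borel_measurable borel" unfolding kernel_Ps_def by measurable
qed

text \<open>This is \<open>kernel_transform\<close> at the exponent \<open>cnj (\<i> * z)\<close>,
  conjugated. The companion \<open>kernel_Q_eq\<close> is the same identity at the exponent
  \<open>- (\<i> * z)\<close>.\<close>

lemma kernel_Ps_eq:
  assumes "0 \<le> r" "r \<le> R"
  shows "kernel_Ps r z = 1 - (LBINT \<rho>. indicator {0..r} \<rho> * (cnj (b \<rho>) * kernel_P \<rho> z))"
proof -
  let ?w = "cnj (\<i> * z)"
  have "(LBINT s. cnj (G r s) * exp (\<i> * z * of_real s)) = (LBINT s. cnj (G r s * exp (?w * of_real s)))"
    by (rule Bochner_Integration.integral_cong) (simp_all add: exp_cnj)
  then have "cnj (LBINT s. G r s * exp (?w * of_real s)) = (LBINT s. cnj (G r s) * exp (\<i> * z * of_real s))"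
    by (simp only: Bochner_Integration.integral_cnj)
  moreover have "cnj (LBINT \<rho>. indicator {0..r} \<rho> * (b \<rho> * exp (?w * of_real \<rho>) *
      (1 - (LBINT u. cnj (G \<rho> u) * exp (- ?w * of_real u)))))
    = (LBINT \<rho>. indicator {0..r} \<rho> * (cnj (b \<rho>) * kernel_P \<rho> z))"
    unfolding Bochner_Integration.integral_cnj[symmetric] kernel_P_def
    by (rule Bochner_Integration.integral_cong) (auto simp: exp_cnj indicator_def Bochner_Integration.integral_cnj[symmetric] simp del: Bochner_Integration.integral_cnj)
  ultimately show ?thesis unfolding kernel_Ps_def kernel_transform[OF assms, of ?w] by simp
qed

lemma kernel_Q_eq:
  assumes "0 \<le> r" "r \<le> R"
  shows "1 - (LBINT s. G r s * exp (- (\<i> * z) * of_real s)) =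
    1 + (LBINT \<rho>. indicator {0..r} \<rho> * (- (b \<rho> * exp (- (\<i> * z) * of_real \<rho>) * kernel_Ps \<rho> z)))"
  unfolding kernel_transform[OF assms] kernel_Ps_def by simp

end

text \<open>A weight \<open>K\<close> that is merely square integrable suffices: Cauchy-Schwarz
  turns the hypothesis into an inequality for the square of \<open>u\<close> with the integral of
  the square of \<open>K\<close> as constant, and \<open>Gronwall_zero\<close> applies.\<close>

lemma Gronwall_L2_zero:
  fixes u K :: "real \<Rightarrow> real"
  assumes [measurable]: "u \<in> borel_measurable borel" "K \<in> borel_measurable borel"
    and K2: "integrable lborel (\<lambda>x. (K x)\<^sup>2)"
    and u0: "\<And>x. x \<in> {0..R} \<Longrightarrow> 0 \<le> u x" and bd: "\<And>x. x \<in> {0..R} \<Longrightarrow> u x \<le> M"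
    and gr: "\<And>x. x \<in> {0..R} \<Longrightarrow> u x \<le> (LBINT y. \<bar>K y * (indicator {0..x} y * u y)\<bar>)"
    and x: "x \<in> {0..R}"
  shows "u x = 0"
proof -
  have "(u x)\<^sup>2 = 0"
  proof (rule Gronwall_zero[where n = "\<lambda>x. (u x)\<^sup>2" and M = "M\<^sup>2" and R = R and K = "LBINT y. (K y)\<^sup>2"])
    fix x assume x: "x \<in> {0..R}"
    show "(u x)\<^sup>2 \<le> M\<^sup>2" using u0[OF x] bd[OF x] by (rule power_mono[rotated])
    have sq: "square_integrable (\<lambda>y. of_real (indicator {0..x} y * u y))"
    proof (rule square_integrable_bounded[of _ 0 R M])
      have "0 \<le> M" using u0[OF x] bd[OF x] by simp
      then show "cmod (of_real (indicator {0..x} y * u y)) \<le> M" for y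
        using u0[of y] bd[of y] x by (auto simp: indicator_def)
    qed (use x in \<open>auto simp: indicator_def\<close>)
    have i2: "(indicator {0..x} y * u y)\<^sup>2 = indicator {0..x} y * (u y)\<^sup>2" for y
      by (simp add: indicator_def)
    have f2: "integrable lborel (\<lambda>y. (indicator {0..x} y * u y)\<^sup>2)"
      using sq by (simp add: square_integrable_def power_mult_distrib norm_mult)
    have "(u x)\<^sup>2 \<le> (LBINT y. \<bar>K y * (indicator {0..x} y * u y)\<bar>)\<^sup>2"
      using u0[OF x] gr[OF x] by (rule power_mono[rotated])
    also have "\<dots> \<le> (LBINT y. (K y)\<^sup>2) * (LBINT y. (indicator {0..x} y * u y)\<^sup>2)"
      by (rule Cauchy_Schwarz_real(2)[OF _ _ K2 f2]) measurable
    finally show "(u x)\<^sup>2 \<le> (LBINT y. (K y)\<^sup>2) * (LBINT y. indicator {0..x} y * (u y)\<^sup>2)"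
      unfolding i2 .
  qed (use x in auto)
  then show ?thesis by simp
qed

context volterra_kernel
begin

lemma kernel_Ps_bound:
  obtains B where "\<And>r. r \<le> R \<Longrightarrow> cmod (kernel_Ps r z) \<le> B"
proof
  fix r assume r: "r \<le> R"
  let ?w = "cnj (\<i> * z)"
  have "(LBINT s. cnj (G r s) * exp (\<i> * z * of_real s)) = (LBINT s. cnj (G r s * exp (?w * of_real s)))"
    by (rule Bochner_Integration.integral_cong) (simp_all add: exp_cnj)
  then have "cmod (LBINT s. cnj (G r s) * exp (\<i> * z * of_real s)) = cmod (LBINT s. G r s * exp (?w * of_real s))"
    by (simp only: Bochner_Integration.integral_cnj complex_mod_cnj)
  then show "cmod (kernel_Ps r z) \<le> 1 + exp (cmod ?w * R) * (LBINT s. cmod (b s) + C * indicator {0..R} s)"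
    unfolding kernel_Ps_def using kernel_transform_bound[OF r, of ?w] norm_triangle_ineq4[of 1] by (smt (verit) norm_one)
qed

lemma kernel_P_bound:
  obtains B where "\<And>r. 0 \<le> r \<Longrightarrow> r \<le> R \<Longrightarrow> cmod (kernel_P r z) \<le> B"
proof
  fix r assume r: "0 \<le> r" "r \<le> R"
  let ?w = "- (\<i> * z)"
  have 1: "cmod (1 - (LBINT s. G r s * exp (?w * of_real s))) \<le> 1 + exp (cmod ?w * R) * (LBINT s. cmod (b s) + C * indicator {0..R} s)"
    using kernel_transform_bound[OF r(2), of ?w] norm_triangle_ineq4[of 1] by (smt (verit) norm_one)
  have "Re (\<i> * z * of_real r) \<le> cmod (\<i> * z * of_real r)" by (rule complex_Re_le_cmod)
  also have "\<dots> \<le> cmod z * R" using r by (simp add: norm_mult mult_left_mono)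
  finally have 2: "cmod (exp (\<i> * z * of_real r)) \<le> exp (cmod z * R)" by simp
  show "cmod (kernel_P r z) \<le> exp (cmod z * R) * (1 + exp (cmod ?w * R) * (LBINT s. cmod (b s) + C * indicator {0..R} s))"
    unfolding kernel_P_def norm_mult by (intro mult_mono 1 2[unfolded norm_mult]) auto
qed

lemma b_mult_integrable:
  assumes [measurable]: "f \<in> borel_measurable borel" and f: "\<And>x. x \<in> {0..R} \<Longrightarrow> cmod (f x) \<le> B"
  shows "integrable lborel (\<lambda>x. b x * f x)"
proof (rule Bochner_Integration.integrable_bound[OF integrable_mult_right[OF b_integrable, of "of_real B"]])
  have "cmod (b x * f x) \<le> cmod (of_real B * b x)" for x
  proof (cases "x \<in> {0..R}")
    case True
    then show ?thesis using f[OF True] mult_left_mono[of "cmod (f x)" "\<bar>B\<bar>" "cmod (b x)"] by (simp add: norm_mult mult.commute)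
  qed (simp add: b_supp)
  then show "AE x in lborel. norm (b x * f x) \<le> norm (of_real B * b x)" by simp
qed measurable

text \<open>Product rule for \<open>E\<close> and \<open>Q\<close>: the derivative of
  \<open>Q\<close> carries the factor \<open>exp (- (\<i> * z) * \<rho>)\<close>, which
  \<open>E\<close> cancels, and the derivative of \<open>E\<close> contributes
  \<open>\<i> * z * P\<close>.\<close>

lemma kernel_P_eq:
  assumes r: "0 \<le> r" "r \<le> R"
  shows "kernel_P r z = 1 + (LBINT \<rho>. indicator {0..r} \<rho> * (\<i> * z * kernel_P \<rho> z - b \<rho> * kernel_Ps \<rho> z))"
proof -
  define E where "E \<rho> = exp (\<i> * z * of_real \<rho>)" for \<rho> :: real
  define Q where "Q \<rho> = 1 - (LBINT s. G \<rho> s * exp (- (\<i> * z) * of_real s))" for \<rho>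
  define f where "f \<rho> = - (b \<rho> * (exp (- (\<i> * z) * of_real \<rho>) * kernel_Ps \<rho> z))" for \<rho>
  obtain B where B: "\<And>r. r \<le> R \<Longrightarrow> cmod (kernel_Ps r z) \<le> B" by (rule kernel_Ps_bound[of z]) blast
  have f_int: "integrable lborel f"
    unfolding f_def
  proof (intro integrable_minus b_mult_integrable[where B = "exp (cmod z * R) * B"])
    fix x assume x: "x \<in> {0..R}"
    have "Re (- (\<i> * z) * of_real x) \<le> cmod (- (\<i> * z) * of_real x)" by (rule complex_Re_le_cmod)
    also have "\<dots> \<le> cmod z * R" using x by (simp add: norm_mult mult_left_mono)
    finally show "cmod (exp (- (\<i> * z) * of_real x) * kernel_Ps x z) \<le> exp (cmod z * R) * B"
      unfolding norm_mult using B[of x] x by (intro mult_mono) (auto simp: norm_mult)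
  qed measurable
  have Q: "Q x = 1 + (LBINT u. indicator {0..x} u * f u)" if "x \<in> {0..R}" for x
    using kernel_Q_eq[of x z] that by (simp add: Q_def f_def mult.assoc)
  have Q0: "Q 0 = 1"
  proof -
    have "AE u in lborel. indicator {0..0} u * f u = 0"
      using AE_lborel_singleton[of 0] by eventually_elim (auto simp: indicator_def)
    then have "(LBINT u. indicator {0..0} u * f u) = 0" by (rule integral_eq_zero_AE)
    then show ?thesis using Q[of 0] R by simp
  qed
  have E0: "E 0 = 1" by (simp add: E_def)
  note parts = AC_integral_by_parts[of r f "\<lambda>u. \<i> * z * E u" Q E]
  have *: "integrable lborel (\<lambda>u. indicator {0..r} u * f u)"
    "integrable lborel (\<lambda>u. indicator {0..r} u * (\<i> * z * E u))"
    "\<And>x. x \<in> {0..r} \<Longrightarrow> Q x = Q 0 + (LBINT u. indicator {0..x} u * f u)"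
    "\<And>x. x \<in> {0..r} \<Longrightarrow> E x = E 0 + (LBINT u. indicator {0..x} u * (\<i> * z * E u))"
    using indicator_integrable[OF f_int] exp_primitive[of _ "\<i> * z"] r Q Q0 E0 by (auto simp: E_def)
  note parts = parts[OF * r(1)]
  have "kernel_P r z = Q r * E r" by (simp add: kernel_P_def Q_def E_def)
  also have "\<dots> = 1 + ((LBINT x. indicator {0..r} x * (f x * E x)) + (LBINT x. indicator {0..r} x * (Q x * (\<i> * z * E x))))"
    using parts(3) unfolding Q0 E0 by simp
  also have "(LBINT x. indicator {0..r} x * (f x * E x)) + (LBINT x. indicator {0..r} x * (Q x * (\<i> * z * E x)))
     = (LBINT x. indicator {0..r} x * (f x * E x) + indicator {0..r} x * (Q x * (\<i> * z * E x)))"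
    by (rule Bochner_Integration.integral_add[OF parts(1,2), symmetric])
  also have "\<dots> = (LBINT \<rho>. indicator {0..r} \<rho> * (\<i> * z * kernel_P \<rho> z - b \<rho> * kernel_Ps \<rho> z))"
  proof (rule Bochner_Integration.integral_cong)
    fix x
    have "exp (- (\<i> * z) * of_real x) * E x = 1" unfolding E_def exp_add[symmetric] by simp
    then have "f x * E x = - (b x * kernel_Ps x z)" by (simp add: f_def mult_ac)
    moreover have "Q x * (\<i> * z * E x) = \<i> * z * kernel_P x z" by (simp add: kernel_P_def Q_def E_def mult_ac)
    ultimately show "indicator {0..r} x * (f x * E x) + indicator {0..r} x * (Q x * (\<i> * z * E x))
      = indicator {0..r} x * (\<i> * z * kernel_P x z - b x * kernel_Ps x z)"
      by (simp add: indicator_def)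
  qed simp
  finally show ?thesis .
qed

lemma AC_borel_version:
  assumes "locally_AC_with_deriv \<phi> g"
  obtains g' where "integrable lborel g'" "AE x in lborel. x \<in> {0..R} \<longrightarrow> g' x = g x"
    "\<And>r. r \<in> {0..R} \<Longrightarrow> \<phi> r = \<phi> 0 + (LBINT u. indicator {0..r} u * g' u)"
proof -
  have int: "integrable lebesgue (\<lambda>x. indicator {0..R} x *\<^sub>R g x)"
    using assms R by (auto simp: locally_AC_with_deriv_def set_integrable_def)
  then obtain g' where g'[measurable]: "g' \<in> borel_measurable borel" and ae: "AE x in lborel. indicator {0..R} x *\<^sub>R g x = g' x"
    using borel_version[OF borel_measurable_integrable[OF int]] by blast
  show thesis
  proof
    show "integrable lborel g'"
      using int lebesgue_integral_borel_version(2)[OF _ g' ae] by auto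
    show "AE x in lborel. x \<in> {0..R} \<longrightarrow> g' x = g x"
      using ae by eventually_elim auto
    fix r assume r: "r \<in> {0..R}"
    then have r0: "r \<ge> 0" by simp
    have int_r: "integrable lebesgue (\<lambda>x. indicator {0..r} x *\<^sub>R g x)"
      using assms r by (auto simp: locally_AC_with_deriv_def set_integrable_def)
    have "(LINT s:{0..r}|lebesgue. g s) = (LBINT u. indicator {0..r} u * g' u)"
      unfolding set_lebesgue_integral_def
    proof (rule lebesgue_integral_borel_version(1))
      show "AE x in lborel. indicator {0..r} x *\<^sub>R g x = indicator {0..r} x * g' x"
        using ae by eventually_elim (use r in \<open>auto simp: indicator_def split: if_splits\<close>)
    qed (use int_r in auto)
    moreover have "\<phi> r = \<phi> 0 + (LINT s:{0..r}|lebesgue. g s)"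
      using assms r0 unfolding locally_AC_with_deriv_def by blast
    ultimately show "\<phi> r = \<phi> 0 + (LBINT u. indicator {0..r} u * g' u)" by simp
  qed
qed

text \<open>The difference between the given solution and the one built from the kernel satisfies
  the homogeneous integral system. Its coefficients are only square integrable, hence the appeal to
  \<open>Gronwall_L2_zero\<close>.\<close>

lemma krein_solution_unique:
  assumes kr: "krein_system A P Ps"
    and bA: "AE x in lborel. x \<in> {0..R} \<longrightarrow> b x = cnj (A x)"
    and r: "r \<in> {0..R}"
  shows "P r z = kernel_P r z"
proof -
  have AC: "locally_AC_with_deriv (\<lambda>r. P r z) (\<lambda>r. \<i> * z * P r z - cnj (A r) * Ps r z)"
    "locally_AC_with_deriv (\<lambda>r. Ps r z) (\<lambda>r. - A r * P r z)" and init: "P 0 z = 1" "Ps 0 z = 1"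
    using kr by (auto simp: krein_system_def)
  then obtain f g where f: "integrable lborel f" "AE x in lborel. x \<in> {0..R} \<longrightarrow> f x = \<i> * z * P x z - cnj (A x) * Ps x z"
      "\<And>r. r \<in> {0..R} \<Longrightarrow> P r z = 1 + (LBINT u. indicator {0..r} u * f u)"
    and g: "integrable lborel g" "AE x in lborel. x \<in> {0..R} \<longrightarrow> g x = - A x * P x z"
      "\<And>r. r \<in> {0..R} \<Longrightarrow> Ps r z = 1 + (LBINT u. indicator {0..r} u * g u)"
  proof -
    obtain f where "integrable lborel f" "AE x in lborel. x \<in> {0..R} \<longrightarrow> f x = \<i> * z * P x z - cnj (A x) * Ps x z"
      "\<And>r. r \<in> {0..R} \<Longrightarrow> P r z = P 0 z + (LBINT u. indicator {0..r} u * f u)"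
      by (rule AC_borel_version[OF AC(1)]) blast
    moreover obtain g where "integrable lborel g" "AE x in lborel. x \<in> {0..R} \<longrightarrow> g x = - A x * P x z"
      "\<And>r. r \<in> {0..R} \<Longrightarrow> Ps r z = Ps 0 z + (LBINT u. indicator {0..r} u * g u)"
      by (rule AC_borel_version[OF AC(2)]) blast
    ultimately show thesis unfolding init by (intro that)
  qed
  have [measurable]: "f \<in> borel_measurable borel" "g \<in> borel_measurable borel"
    using borel_measurable_integrable[OF f(1)] borel_measurable_integrable[OF g(1)] by simp_all
  \<comment> \<open>Nothing is assumed about the measurability of \<open>P\<close> and
    \<open>Ps\<close> in the length. The primitives \<open>p\<close> and \<open>q\<close> are Borel
    on the whole line and agree with them on \<open>{0..R}\<close>.\<close>
  define p where "p r = 1 + (LBINT u. indicator {0..r} u * f u)" for r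
  define q where "q r = 1 + (LBINT u. indicator {0..r} u * g u)" for r
  have [measurable]: "p \<in> borel_measurable borel" "q \<in> borel_measurable borel"
    unfolding p_def q_def using measurable_primitive[of f] measurable_primitive[of g] by auto
  obtain B1 where B1: "\<And>r. r \<le> R \<Longrightarrow> cmod (kernel_Ps r z) \<le> B1" by (rule kernel_Ps_bound[of z]) blast
  obtain B2 where B2: "\<And>r. 0 \<le> r \<Longrightarrow> r \<le> R \<Longrightarrow> cmod (kernel_P r z) \<le> B2" by (rule kernel_P_bound[of z]) blast
  define d where "d r = p r - kernel_P r z" for r
  define e where "e r = q r - kernel_Ps r z" for r
  have [measurable]: "d \<in> borel_measurable borel" "e \<in> borel_measurable borel"
    unfolding d_def e_def by measurable
  define M where "M = 1 + (LBINT u. cmod (f u)) + B2 + (1 + (LBINT u. cmod (g u)) + B1)"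
  have de_bd: "cmod (d x) + cmod (e x) \<le> M" if "x \<in> {0..R}" for x
  proof -
    have "cmod (d x) \<le> cmod (p x) + cmod (kernel_P x z)" unfolding d_def by (rule norm_triangle_ineq4)
    moreover have "cmod (e x) \<le> cmod (q x) + cmod (kernel_Ps x z)" unfolding e_def by (rule norm_triangle_ineq4)
    moreover have "cmod (p x) \<le> 1 + (LBINT u. cmod (f u))" "cmod (q x) \<le> 1 + (LBINT u. cmod (g u))"
      unfolding p_def q_def using primitive_bound[OF f(1), of 1 x] primitive_bound[OF g(1), of 1 x] by auto
    moreover have "cmod (kernel_Ps x z) \<le> B1" "cmod (kernel_P x z) \<le> B2" using B1[of x] B2[of x] that by auto
    ultimately show ?thesis unfolding M_def by linarith
  qed
  have de_bd': "cmod (d x) \<le> M" "cmod (e x) \<le> M" if "x \<in> {0..R}" for x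
    using de_bd[OF that] norm_ge_zero[of "d x"] norm_ge_zero[of "e x"] by linarith+
  have "M \<ge> 0" using order_trans[OF add_nonneg_nonneg[OF norm_ge_zero norm_ge_zero] de_bd[of 0]] R by simp
  \<comment> \<open>This dominates the coefficients of the difference system, whose two integrands
    add up to at most \<open>(cmod z + cmod (b u)) * (cmod (d u) + cmod (e u))\<close>. The cutoff
    makes the constant part square integrable.\<close>
  define K where "K x = (cmod z + 2 * cmod (b x)) * indicator {0..R} x" for x
  have K2: "integrable lborel (\<lambda>x. (K x)\<^sup>2)"
  proof -
    have 1: "square_integrable (\<lambda>x. complex_of_real (cmod z * indicator {0..R} x))"
      by (rule square_integrable_bounded[of _ 0 R "cmod z"]) (auto simp: indicator_def)
    have 2: "square_integrable (\<lambda>x. complex_of_real (2 * cmod (b x)))"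
      by (rule square_integrable_bound[OF b, of _ 2]) auto
    have "complex_of_real (cmod z * indicator {0..R} x) + complex_of_real (2 * cmod (b x)) = of_real (K x)" for x
      using b_supp[of x] by (simp add: K_def indicator_def)
    then show ?thesis using square_integrable_add(1)[OF 1 2] by (simp add: square_integrable_def)
  qed
  have K_measurable [measurable]: "K \<in> borel_measurable borel" unfolding K_def by measurable
  have "cmod (d r) + cmod (e r) = 0"
  proof (rule Gronwall_L2_zero[where u = "\<lambda>x. cmod (d x) + cmod (e x)", OF _ K_measurable K2 _ de_bd _ r])
    fix x assume x: "x \<in> {0..R}"
    then have x': "0 \<le> x" "x \<le> R" by auto
    define k1 where "k1 u = indicator {0..x} u * (\<i> * z * d u - b u * e u)" for u
    define k2 where "k2 u = indicator {0..x} u * (cnj (b u) * d u)" for u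
    have bd: "integrable lborel (\<lambda>u. b u * d u)" "integrable lborel (\<lambda>u. b u * e u)" "integrable lborel (\<lambda>u. b u * cnj (d u))"
      by (rule b_mult_integrable[where B = M]; use de_bd' in simp)+
    have cbd: "integrable lborel (\<lambda>u. cnj (b u) * d u)" using integrable_cnj[OF bd(3)] by simp
    have id: "integrable lborel (\<lambda>x'. indicator {0..x} x' * d x')"
      by (rule bounded_indicator_integrable[where B = M]) (use de_bd' x \<open>M \<ge> 0\<close> in auto)
    have k1: "integrable lborel k1"
    proof -
      have "k1 = (\<lambda>u. \<i> * z * (indicator {0..x} u * d u) - indicator {0..x} u * (b u * e u))"
        by (auto simp: k1_def indicator_def)
      then show ?thesis using id indicator_integrable[OF bd(2)] by simp
    qed
    have k2: "integrable lborel k2" unfolding k2_def[abs_def] by (rule indicator_integrable[OF cbd])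
    have pP: "p u = P u z" "q u = Ps u z" if "u \<in> {0..R}" for u
      using f(3)[OF that] g(3)[OF that] by (simp_all add: p_def q_def)
    have if1: "integrable lborel (\<lambda>u. indicator {0..x} u * f u)" by (rule indicator_integrable[OF f(1)])
    have ig1: "integrable lborel (\<lambda>u. indicator {0..x} u * g u)" by (rule indicator_integrable[OF g(1)])
    define l1 where "l1 u = indicator {0..x} u * (\<i> * z * kernel_P u z - b u * kernel_Ps u z)" for u
    define l2 where "l2 u = indicator {0..x} u * (cnj (b u) * kernel_P u z)" for u
    have [measurable]: "l1 \<in> borel_measurable borel" "l2 \<in> borel_measurable borel" unfolding l1_def l2_def by measurable
    have ae1: "AE u in lborel. indicator {0..x} u * f u = k1 u + l1 u"
      using f(2) bA by eventually_elim (use x pP in \<open>auto simp: k1_def l1_def d_def e_def indicator_def algebra_simps\<close>)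
    have ae2: "AE u in lborel. indicator {0..x} u * g u = - k2 u - l2 u"
      using g(2) bA by eventually_elim (use x pP in \<open>auto simp: k2_def l2_def d_def e_def indicator_def algebra_simps\<close>)
    have l1: "integrable lborel l1"
    proof -
      have "integrable lborel (\<lambda>u. indicator {0..x} u * f u - k1 u)" using if1 k1 by simp
      moreover have "AE u in lborel. indicator {0..x} u * f u - k1 u = l1 u" using ae1 by eventually_elim simp
      ultimately show ?thesis using k1 by (subst integrable_cong_AE[symmetric, of "\<lambda>u. indicator {0..x} u * f u - k1 u"]) auto
    qed
    have l2: "integrable lborel l2"
    proof -
      have "integrable lborel (\<lambda>u. - (indicator {0..x} u * g u) - k2 u)" using ig1 k2 by simp
      moreover have "AE u in lborel. - (indicator {0..x} u * g u) - k2 u = l2 u" using ae2 by eventually_elim simp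
      ultimately show ?thesis using k2 by (subst integrable_cong_AE[symmetric, of "\<lambda>u. - (indicator {0..x} u * g u) - k2 u"]) auto
    qed
    have "(LBINT u. indicator {0..x} u * f u) = (LBINT u. k1 u + l1 u)"
      by (rule integral_cong_AE[OF _ _ ae1]) (use k1 in measurable)
    also have "\<dots> = (LBINT u. k1 u) + (LBINT u. l1 u)" using k1 l1 by simp
    finally have d_eq: "d x = (LBINT u. k1 u)"
      unfolding d_def p_def kernel_P_eq[OF x'] l1_def by simp
    have "(LBINT u. indicator {0..x} u * g u) = (LBINT u. - k2 u - l2 u)"
      by (rule integral_cong_AE[OF _ _ ae2]) (use k2 in measurable)
    also have "\<dots> = - (LBINT u. k2 u) - (LBINT u. l2 u)" using k2 l2 by simp
    finally have e_eq: "e x = - (LBINT u. k2 u)"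
      unfolding e_def q_def kernel_Ps_eq[OF x'] l2_def by simp
    have Ku: "integrable lborel (\<lambda>y. K y * (indicator {0..x} y * (cmod (d y) + cmod (e y))))"
    proof -
      have "square_integrable (\<lambda>y. of_real (indicator {0..x} y * (cmod (d y) + cmod (e y))))"
        by (rule square_integrable_bounded[of _ 0 R M]) (use x de_bd \<open>M \<ge> 0\<close> in \<open>auto simp: indicator_def simp del: of_real_add\<close>)
      then have "integrable lborel (\<lambda>y. (indicator {0..x} y * (cmod (d y) + cmod (e y)))\<^sup>2)"
        by (simp add: square_integrable_def power_mult_distrib norm_mult del: of_real_add)
      from Cauchy_Schwarz_real(1)[OF _ _ K2 this] show ?thesis by simp
    qed
    have pt: "cmod (k1 u) + cmod (k2 u) \<le> K u * (indicator {0..x} u * (cmod (d u) + cmod (e u)))" for u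
    proof (cases "u \<in> {0..x}")
      case True
      have "cmod (k1 u) \<le> cmod z * cmod (d u) + cmod (b u) * cmod (e u)"
        using True norm_triangle_ineq4[of "\<i> * z * d u" "b u * e u"] by (simp add: k1_def norm_mult)
      moreover have "cmod (k2 u) = cmod (b u) * cmod (d u)" using True by (simp add: k2_def norm_mult)
      moreover have "0 \<le> cmod z * cmod (e u)" "0 \<le> cmod (b u) * cmod (d u)" "0 \<le> cmod (b u) * cmod (e u)" by auto
      moreover have "K u * (indicator {0..x} u * (cmod (d u) + cmod (e u)))
          = cmod z * cmod (d u) + cmod z * cmod (e u) + 2 * (cmod (b u) * cmod (d u)) + 2 * (cmod (b u) * cmod (e u))"
        using True x by (simp add: K_def algebra_simps)
      ultimately show ?thesis by linarith
    qed (simp add: k1_def k2_def)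
    have "cmod (d x) + cmod (e x) \<le> (LBINT u. cmod (k1 u)) + (LBINT u. cmod (k2 u))"
      unfolding d_eq e_eq norm_minus_cancel by (intro add_mono integral_norm_bound)
    also have "\<dots> = (LBINT u. cmod (k1 u) + cmod (k2 u))" using k1 k2 by simp
    also have "\<dots> \<le> (LBINT y. \<bar>K y * (indicator {0..x} y * (cmod (d y) + cmod (e y)))\<bar>)"
      by (intro integral_mono integrable_abs Ku order_trans[OF pt abs_ge_self]) (use k1 k2 in auto)
    finally show "cmod (d x) + cmod (e x) \<le> (LBINT y. \<bar>K y * (indicator {0..x} y * (cmod (d y) + cmod (e y)))\<bar>)" .
  qed auto
  then have "d r = 0" by (metis add_nonneg_eq_0_iff norm_eq_zero norm_ge_zero)
  then show ?thesis using f(3)[OF r] by (simp add: d_def p_def)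
qed

end

section \<open>The Volterra kernel solves the resolvent equation\<close>

lemma square_integrable_conv_bound:
  assumes "square_integrable K" "square_integrable D"
  shows "integrable lborel (\<lambda>y. K (x - y) * D y)"
    and "(LBINT y. cmod (K (x - y) * D y)) \<le> sqrt (sq_norm K * sq_norm D)"
    and "cmod (LBINT y. K (x - y) * D y) \<le> sqrt (sq_norm K * sq_norm D)"
proof -
  note K = square_integrable_reflect[OF assms(1), of x]
  show "integrable lborel (\<lambda>y. K (x - y) * D y)" by (rule square_integrable_mult(1)[OF K(1) assms(2)])
  show "(LBINT y. cmod (K (x - y) * D y)) \<le> sqrt (sq_norm K * sq_norm D)"
    using square_integrable_mult(2)[OF K(1) assms(2)] unfolding K(2) norm_mult by (rule real_le_rsqrt)
  show "cmod (LBINT y. K (x - y) * D y) \<le> sqrt (sq_norm K * sq_norm D)"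
    using square_integrable_mult(3)[OF K(1) assms(2)] unfolding K(2) by (rule real_le_rsqrt)
qed

text \<open>Cauchy-Schwarz bounds the inner integral over \<open>y\<close> by a constant independent
  of \<open>x\<close>, and \<open>f\<close> is integrable. This justifies most interchanges of
  integrals that involve the accelerant.\<close>

lemma integrable_triple:
  assumes f: "integrable lborel f" and K: "square_integrable K" and D: "square_integrable D"
  shows "integrable (lborel \<Otimes>\<^sub>M lborel) (\<lambda>(x, y). f x * (K (x - y) * D y))"
proof (rule lborel_pair.Fubini_integrable)
  note [measurable] = borel_measurable_integrable[OF f, simplified] square_integrable_measurable[OF K] square_integrable_measurable[OF D]
  show "(\<lambda>(x, y). f x * (K (x - y) * D y)) \<in> borel_measurable (lborel \<Otimes>\<^sub>M lborel)" by measurable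
  show "AE x in lborel. integrable lborel (\<lambda>y. case (x, y) of (x, y) \<Rightarrow> f x * (K (x - y) * D y))"
    using square_integrable_conv_bound(1)[OF K D] by simp
  show "integrable lborel (\<lambda>x. LBINT y. norm (case (x, y) of (x, y) \<Rightarrow> f x * (K (x - y) * D y)))"
  proof (rule Bochner_Integration.integrable_bound)
    show "integrable lborel (\<lambda>x. sqrt (sq_norm K * sq_norm D) * cmod (f x))" using f by simp
    have "(LBINT y. cmod (f x * (K (x - y) * D y))) \<le> sqrt (sq_norm K * sq_norm D) * cmod (f x)" for x
    proof -
      have "(LBINT y. cmod (f x * (K (x - y) * D y))) = cmod (f x) * (LBINT y. cmod (K (x - y) * D y))"
        unfolding norm_mult[of "f x"] by (rule integral_mult_right_zero)
      also have "\<dots> \<le> cmod (f x) * sqrt (sq_norm K * sq_norm D)"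
        by (intro mult_left_mono square_integrable_conv_bound K D) simp
      finally show ?thesis by (simp add: mult.commute)
    qed
    then show "AE x in lborel. norm (LBINT y. norm (case (x, y) of (x, y) \<Rightarrow> f x * (K (x - y) * D y)))
        \<le> norm (sqrt (sq_norm K * sq_norm D) * cmod (f x))"
      by (auto intro!: AE_I2 order_trans[OF _ abs_ge_self])
  qed measurable
qed

text \<open>\<open>g t\<close> is a Borel version of \<Gamma>_t(\<cdot>,0) for each \<open>t\<close>
  on its own. As no measurability in \<open>t\<close> is assumed, \<open>g\<close> is used only at
  fixed \<open>t\<close> and never under an integral over \<open>t\<close>; the uniform bound
  \<open>Cg\<close> is all that passes from one length to another. Hermitian symmetry is required at
  every point because \<open>H\<close> occurs at reflected arguments in identities that hold
  everywhere.\<close>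

locale resolvent_family = volterra_kernel +
  fixes H :: "real \<Rightarrow> complex" and g :: "real \<Rightarrow> real \<Rightarrow> complex" and Cg :: real
  assumes H: "square_integrable H" and H_herm: "\<And>x. H (- x) = cnj (H x)"
    and g: "\<And>t. t \<in> {0<..R} \<Longrightarrow> square_integrable (g t)"
    and g_supp: "\<And>t s. t \<in> {0<..R} \<Longrightarrow> s \<notin> {0..t} \<Longrightarrow> g t s = 0"
    and g_eq: "\<And>t. t \<in> {0<..R} \<Longrightarrow>
      AE s in lborel. s \<in> {0..t} \<longrightarrow> g t s + (LBINT u. H (s - u) * g t u) = H s"
    and g_norm: "\<And>t. t \<in> {0<..R} \<Longrightarrow> sq_norm (g t) \<le> Cg"
    and b_eq: "AE t in lborel. t \<in> {0<..R} \<longrightarrow> b t = H t - (LBINT u. H (t - u) * g t u)"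
begin

lemma H_measurable [measurable]: "H \<in> borel_measurable borel"
  using H by (rule square_integrable_measurable)

definition conv :: "real \<Rightarrow> real \<Rightarrow> complex" where
  "conv r t = (LBINT u. H (t - u) * G r u)"

definition res :: "real \<Rightarrow> real \<Rightarrow> complex" where
  "res r t = G r t + conv r t - H t"

lemma conv_measurable [measurable (raw)]:
  assumes [measurable]: "f \<in> borel_measurable M" "h \<in> borel_measurable M"
  shows "(\<lambda>x. conv (f x) (h x)) \<in> borel_measurable M"
  unfolding conv_def by measurable

lemma res_measurable [measurable (raw)]:
  assumes [measurable]: "f \<in> borel_measurable M" "h \<in> borel_measurable M"
  shows "(\<lambda>x. res (f x) (h x)) \<in> borel_measurable M"
  unfolding res_def by measurable

abbreviation "maj \<equiv> \<lambda>s. complex_of_real (cmod (b s) + C * indicator {0..R} s)"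

definition cbd :: real where "cbd = sqrt (sq_norm H * sq_norm maj)"

lemma conv_bound: "r \<le> R \<Longrightarrow> cmod (conv r t) \<le> cbd"
proof -
  assume r: "r \<le> R"
  have "cmod (conv r t) \<le> sqrt (sq_norm H * sq_norm (G r))"
    unfolding conv_def by (rule square_integrable_conv_bound(3)[OF H G_square_integrable[OF r]])
  also have "\<dots> \<le> cbd" unfolding cbd_def
    by (intro real_sqrt_le_mono mult_left_mono G_sq_norm r) simp
  finally show ?thesis .
qed

definition rbd :: "real \<Rightarrow> real" where
  "rbd s = indicator {0..R} s * (cmod (b s) + C + cbd + cmod (H s))"

lemma res_bound: "s \<in> {0..r} \<Longrightarrow> r \<le> R \<Longrightarrow> cmod (res r s) \<le> rbd s"
proof -
  assume s: "s \<in> {0..r}" and r: "r \<le> R"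
  have "cmod (res r s) \<le> cmod (G r s + conv r s) + cmod (H s)" unfolding res_def by (rule norm_triangle_ineq4)
  moreover have "cmod (G r s + conv r s) \<le> cmod (G r s) + cmod (conv r s)" by (rule norm_triangle_ineq)
  moreover have "s \<in> {0..R}" using s r by auto
  ultimately show ?thesis using conv_bound[OF r, of s] G_le[OF r, of s] by (simp add: rbd_def)
qed

lemma rbd_measurable [measurable]: "rbd \<in> borel_measurable borel"
  unfolding rbd_def by measurable

lemma rbd_square_integrable: "square_integrable (\<lambda>s. complex_of_real (rbd s))"
proof -
  have 1: "square_integrable (\<lambda>s. complex_of_real (indicator {0..R} s * cmod (b s)))"
    by (rule square_integrable_bound[OF b, of _ 1]) (auto simp: indicator_def)
  have 2: "square_integrable (\<lambda>s. complex_of_real (indicator {0..R} s * cmod (H s)))"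
    by (rule square_integrable_bound[OF H, of _ 1]) (auto simp: indicator_def)
  have 3: "square_integrable (\<lambda>s. complex_of_real (indicator {0..R} s * (C + cbd)))"
    by (rule square_integrable_bounded[of _ 0 R "\<bar>C + cbd\<bar>"]) (auto simp: indicator_def simp del: of_real_add)
  have "complex_of_real (indicator {0..R} s * (C + cbd)) + (complex_of_real (indicator {0..R} s * cmod (b s)) + complex_of_real (indicator {0..R} s * cmod (H s))) = of_real (rbd s)" for s
    by (simp add: rbd_def algebra_simps)
  then show ?thesis using square_integrable_add(1)[OF 3 square_integrable_add(1)[OF 1 2]] by simp
qed

text \<open>Insert the Volterra equation for \<open>G r u\<close> and interchange the integrals.
  Since \<open>H (t - u) = cnj (H ((\<rho> - t) - (\<rho> - u)))\<close>, the inner integral is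
  again a convolution with \<open>G \<rho>\<close>, conjugated and taken at the mirrored point
  \<open>\<rho> - t\<close>. So \<open>conv\<close> obeys the same recursion as \<open>G\<close>,
  with another inhomogeneity.\<close>

lemma conv_eq:
  assumes "0 \<le> t" "t \<le> r" "r \<le> R"
  shows "conv r t = (LBINT \<rho>. indicator {0..r} \<rho> * (b \<rho> * cnj (H (\<rho> - t) - conv \<rho> (\<rho> - t))))"
    and "integrable lborel (\<lambda>\<rho>. indicator {0..r} \<rho> * (b \<rho> * cnj (H (\<rho> - t) - conv \<rho> (\<rho> - t))))"
proof -
  define f where "f u = indicator {0..r} u * H (t - u)" for u
  have [measurable]: "f \<in> borel_measurable borel" unfolding f_def by measurable
  have f: "integrable lborel f"
    by (rule square_integrable_imp_integrable[OF square_integrable_bound[OF square_integrable_reflect(1)[OF H, of t], of _ 1], of _ 0 r])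
      (auto simp: f_def indicator_def)
  define k where "k u \<rho> = f u * (indicator {..r} \<rho> * b \<rho> * cnj (G \<rho> (\<rho> - u)))" for u \<rho>
  have pair: "integrable (lborel \<Otimes>\<^sub>M lborel) (\<lambda>(u, \<rho>). k u \<rho>)"
  proof (rule Bochner_Integration.integrable_bound)
    show "integrable (lborel \<Otimes>\<^sub>M lborel) (\<lambda>(u, \<rho>). f u * (maj (0 - (u - \<rho>)) * b \<rho>))"
      by (rule integrable_triple[OF f square_integrable_reflect(1)[OF majorant, of 0] b])
    show "(\<lambda>(u, \<rho>). k u \<rho>) \<in> borel_measurable (lborel \<Otimes>\<^sub>M lborel)" unfolding k_def by measurable
    have "cmod (k u \<rho>) \<le> cmod (f u * (maj (0 - (u - \<rho>)) * b \<rho>))" for u \<rho>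
    proof (cases "\<rho> \<le> r")
      case True
      then have "cmod (G \<rho> (\<rho> - u)) \<le> cmod (maj (\<rho> - u))" using G_majorant[of \<rho> "\<rho> - u"] assms by simp
      then have "cmod (f u) * (cmod (b \<rho>) * cmod (G \<rho> (\<rho> - u))) \<le> cmod (f u) * (cmod (b \<rho>) * cmod (maj (\<rho> - u)))"
        by (intro mult_left_mono) auto
      then show ?thesis using True by (simp add: k_def norm_mult mult_ac del: of_real_add of_real_mult)
    qed (simp add: k_def)
    then show "AE x in lborel \<Otimes>\<^sub>M lborel. norm (case x of (u, \<rho>) \<Rightarrow> k u \<rho>)
        \<le> norm (case x of (u, \<rho>) \<Rightarrow> f u * (maj (0 - (u - \<rho>)) * b \<rho>))"
      by (auto simp del: of_real_add of_real_mult)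
  qed
  have fb: "integrable lborel (\<lambda>u. f u * b u)"
  proof (rule square_integrable_mult(1)[OF _ b])
    show "square_integrable f"
      by (rule square_integrable_bound[OF square_integrable_reflect(1)[OF H, of t], of _ 1]) (auto simp: f_def indicator_def)
  qed
  have inner: "(LBINT u. k u \<rho>) = indicator {0..r} \<rho> * (b \<rho> * cnj (conv \<rho> (\<rho> - t)))" for \<rho>
  proof (cases "\<rho> \<in> {0..r}")
    case True
    have "(LBINT u. k u \<rho>) = (LBINT u. b \<rho> * cnj (H (\<rho> - t - (\<rho> - u)) * G \<rho> (\<rho> - u)))"
    proof (rule Bochner_Integration.integral_cong)
      fix u show "k u \<rho> = b \<rho> * cnj (H (\<rho> - t - (\<rho> - u)) * G \<rho> (\<rho> - u))"
      proof (cases "u \<in> {0..\<rho>}")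
        case True
        have "cnj (H (u - t)) = H (t - u)" using H_herm[of "u - t"] by simp
        then show ?thesis using True \<open>\<rho> \<in> {0..r}\<close> by (simp add: k_def f_def)
      next
        case False
        then have "G \<rho> (\<rho> - u) = 0" by (intro G_supp) auto
        then show ?thesis by (simp add: k_def)
      qed
    qed simp
    also have "\<dots> = b \<rho> * cnj (LBINT u. H (\<rho> - t - (\<rho> - u)) * G \<rho> (\<rho> - u))"
      unfolding integral_mult_right_zero Bochner_Integration.integral_cnj ..
    also have "(LBINT u. H (\<rho> - t - (\<rho> - u)) * G \<rho> (\<rho> - u)) = conv \<rho> (\<rho> - t)"
      unfolding conv_def by (rule integral_reflect(1)[of "\<lambda>u. H (\<rho> - t - u) * G \<rho> u"])
    finally show ?thesis using True by simp
  next
    case False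
    have "k u \<rho> = 0" for u using False b_supp[of \<rho>] by (cases "\<rho> < 0") (auto simp: k_def)
    then show ?thesis using False by simp
  qed
  have i1: "integrable lborel (\<lambda>\<rho>. LBINT u. k u \<rho>)" by (rule lborel_pair.integrable_snd[OF pair])
  have eq: "indicator {0..r} \<rho> * (b \<rho> * cnj (H (\<rho> - t) - conv \<rho> (\<rho> - t))) = f \<rho> * b \<rho> - (LBINT u. k u \<rho>)" for \<rho>
    unfolding inner using H_herm[of "\<rho> - t"] by (simp add: f_def algebra_simps)
  show "integrable lborel (\<lambda>\<rho>. indicator {0..r} \<rho> * (b \<rho> * cnj (H (\<rho> - t) - conv \<rho> (\<rho> - t))))"
    unfolding eq by (intro Bochner_Integration.integrable_diff fb i1)
  have "conv r t = (LBINT u. f u * b u - (LBINT \<rho>. k u \<rho>))"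
    unfolding conv_def
  proof (rule Bochner_Integration.integral_cong)
    fix u show "H (t - u) * G r u = f u * b u - (LBINT \<rho>. k u \<rho>)"
    proof (cases "u \<in> {0..r}")
      case True
      have "(LBINT \<rho>. k u \<rho>) = f u * (LBINT \<rho>. indicator {..r} \<rho> * b \<rho> * cnj (G \<rho> (\<rho> - u)))"
        unfolding k_def by (rule integral_mult_right_zero)
      also have "\<dots> = f u * (b u - G r u)" using G_eq[OF True] by simp
      finally show ?thesis using True by (simp add: f_def algebra_simps)
    qed (simp add: f_def k_def G_supp)
  qed simp
  also have "\<dots> = (LBINT u. f u * b u) - (LBINT u. LBINT \<rho>. k u \<rho>)"
    by (rule Bochner_Integration.integral_diff[OF fb lborel_pair.integrable_fst[OF pair]])
  also have "(LBINT u. LBINT \<rho>. k u \<rho>) = (LBINT \<rho>. LBINT u. k u \<rho>)"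
    by (rule lborel_pair.Fubini_integral[OF pair, symmetric])
  also have "(LBINT u. f u * b u) - \<dots> = (LBINT \<rho>. f \<rho> * b \<rho> - (LBINT u. k u \<rho>))"
    by (rule Bochner_Integration.integral_diff[OF fb i1, symmetric])
  finally show "conv r t = (LBINT \<rho>. indicator {0..r} \<rho> * (b \<rho> * cnj (H (\<rho> - t) - conv \<rho> (\<rho> - t))))"
    unfolding eq .
qed

text \<open>Adding the recursions of \<open>G\<close> and \<open>conv\<close> merges all terms under
  the integral into the residual and leaves an inhomogeneity that does not depend on
  \<open>r\<close>. For \<open>\<rho> < t\<close> the residual is evaluated at a negative argument,
  where it need not vanish; that part of the integral does not depend on \<open>r\<close>
  either.\<close>

lemma res_eq:
  assumes "0 \<le> t" "t \<le> r" "r \<le> R"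
  shows "res r t = b t - H t - (LBINT \<rho>. indicator {0..r} \<rho> * (b \<rho> * cnj (res \<rho> (\<rho> - t))))"
    and "integrable lborel (\<lambda>\<rho>. indicator {0..r} \<rho> * (b \<rho> * cnj (res \<rho> (\<rho> - t))))"
proof -
  note c = conv_eq[OF assms]
  have G_eq': "indicator {..r} \<rho> * b \<rho> * cnj (G \<rho> (\<rho> - t)) = indicator {0..r} \<rho> * (b \<rho> * cnj (G \<rho> (\<rho> - t)))" for \<rho>
    using b_supp[of \<rho>] by (cases "0 \<le> \<rho>") (auto simp: indicator_def)
  have gi: "integrable lborel (\<lambda>\<rho>. indicator {0..r} \<rho> * (b \<rho> * cnj (G \<rho> (\<rho> - t))))"
  proof (rule Bochner_Integration.integrable_bound)
    show "integrable lborel (\<lambda>\<rho>. b \<rho> * maj (\<rho> - t))"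
      by (rule square_integrable_mult(1)[OF b square_integrable_translate(1)[OF majorant]])
    have "cmod (indicator {0..r} \<rho> * (b \<rho> * cnj (G \<rho> (\<rho> - t)))) \<le> cmod (b \<rho> * maj (\<rho> - t))" for \<rho>
      using G_majorant[of \<rho> "\<rho> - t"] assms by (cases "\<rho> \<in> {0..r}") (auto simp: norm_mult simp del: of_real_add of_real_mult intro!: mult_left_mono)
    then show "AE \<rho> in lborel. norm (indicator {0..r} \<rho> * (b \<rho> * cnj (G \<rho> (\<rho> - t)))) \<le> norm (b \<rho> * maj (\<rho> - t))" by simp
  qed measurable
  have eq: "indicator {0..r} \<rho> * (b \<rho> * cnj (res \<rho> (\<rho> - t))) = indicator {0..r} \<rho> * (b \<rho> * cnj (G \<rho> (\<rho> - t)))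
     - indicator {0..r} \<rho> * (b \<rho> * cnj (H (\<rho> - t) - conv \<rho> (\<rho> - t)))" for \<rho>
    by (simp add: res_def algebra_simps)
  show "integrable lborel (\<lambda>\<rho>. indicator {0..r} \<rho> * (b \<rho> * cnj (res \<rho> (\<rho> - t))))"
    unfolding eq by (intro Bochner_Integration.integrable_diff gi c)
  have "(LBINT \<rho>. indicator {0..r} \<rho> * (b \<rho> * cnj (res \<rho> (\<rho> - t)))) = (b t - G r t) - conv r t"
    unfolding eq Bochner_Integration.integral_diff[OF gi c(2)] c(1)[symmetric]
    using G_eq[of t r] assms by (simp add: G_eq'[symmetric])
  then show "res r t = b t - H t - (LBINT \<rho>. indicator {0..r} \<rho> * (b \<rho> * cnj (res \<rho> (\<rho> - t))))"
    by (simp add: res_def)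
qed

text \<open>Below \<open>t\<close> the kernel vanishes at the negative argument
  \<open>\<rho> - t\<close>, above \<open>t\<close> the indicator vanishes, so the integrand lives
  on a single point.\<close>

lemma G_diag: assumes "0 \<le> t" shows "G t t = b t"
proof -
  have "AE \<rho> in lborel. indicator {..t} \<rho> * b \<rho> * cnj (G \<rho> (\<rho> - t)) = 0"
    using AE_lborel_singleton[of t] by eventually_elim (auto simp: indicator_def intro!: disjI2 G_supp)
  then have "(LBINT \<rho>. indicator {..t} \<rho> * b \<rho> * cnj (G \<rho> (\<rho> - t))) = 0" by (rule integral_eq_zero_AE)
  then show ?thesis using G_eq[of t t] assms by simp
qed

definition N :: "real \<Rightarrow> real" where
  "N r = (LBINT t. indicator {0..r} t * (cmod (res r t))\<^sup>2)"

lemma res_square_integrable: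
  assumes "r \<le> R" shows "square_integrable (\<lambda>t. indicator {0..r} t * res r t)"
proof (rule square_integrable_bound[OF rbd_square_integrable, of _ 1])
  show "cmod (indicator {0..r} t * res r t) \<le> 1 * cmod (complex_of_real (rbd t))" for t
    using res_bound[of t r] assms by (cases "t \<in> {0..r}") (auto intro: order_trans[OF _ abs_ge_self])
qed measurable

lemma N_eq: "N r = sq_norm (\<lambda>t. indicator {0..r} t * res r t)"
  unfolding N_def sq_norm_def by (rule Bochner_Integration.integral_cong) (auto simp: indicator_def)

lemma N_bound: assumes "r \<le> R" shows "N r \<le> sq_norm (\<lambda>s. complex_of_real (rbd s))"
  unfolding N_eq sq_norm_def
proof (rule integral_mono)
  fix t
  have "cmod (indicator {0..r} t * res r t) \<le> cmod (complex_of_real (rbd t))"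
    using res_bound[of t r] assms by (cases "t \<in> {0..r}") (auto intro: order_trans[OF _ abs_ge_self])
  then show "(cmod (indicator {0..r} t * res r t))\<^sup>2 \<le> (cmod (complex_of_real (rbd t)))\<^sup>2"
    by (rule power_mono) simp
qed (use res_square_integrable[OF assms] rbd_square_integrable in \<open>auto simp: square_integrable_def\<close>)

text \<open>Since \<open>D = G t - g t\<close> satisfies \<open>(I + \<H>\<^sub>t) D = res t\<close> and the reflection of \<open>g t\<close> solves the resolvent equation with
  right-hand side \<open>H (t - \<cdot>)\<close>, the diagonal value is a pairing of \<open>res t\<close> with that reflection: no bound on
  \<open>(I + \<H>\<^sub>t)\<inverse>\<close> is needed.\<close>
lemma res_diag_bound:
  "AE t in lborel. t \<in> {0<..R} \<longrightarrow> (cmod (res t t))\<^sup>2 \<le> N t * Cg"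
  using b_eq
proof eventually_elim
  fix t assume bt: "t \<in> {0<..R} \<longrightarrow> b t = H t - (LBINT u. H (t - u) * g t u)"
  show "t \<in> {0<..R} \<longrightarrow> (cmod (res t t))\<^sup>2 \<le> N t * Cg"
  proof
    assume t: "t \<in> {0<..R}"
    then have t': "0 \<le> t" "t \<le> R" by auto
    note gt = g[OF t]
    note [measurable] = square_integrable_measurable[OF gt]
    define D where "D u = G t u - g t u" for u
    have D: "square_integrable D" unfolding D_def using square_integrable_diff[OF G_square_integrable[OF t'(2)] gt] .
    have D_supp: "D u = 0" if "u \<notin> {0..t}" for u using that by (simp add: D_def G_supp g_supp[OF t])
    have D_int: "integrable lborel D" by (rule square_integrable_imp_integrable[OF D D_supp])
    note [measurable] = square_integrable_measurable[OF D]
    define h where "h w = g t (t - w)" for w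
    have h: "square_integrable h" unfolding h_def by (rule square_integrable_reflect(1)[OF gt])
    have h_supp: "h u = 0" if "u \<notin> {0..t}" for u using that unfolding h_def by (intro g_supp[OF t]) auto
    have h_int: "integrable lborel h" by (rule square_integrable_imp_integrable[OF h h_supp])
    note [measurable] = square_integrable_measurable[OF h]
    have HD: "(LBINT u. H (x - u) * D u) = conv t x - (LBINT u. H (x - u) * g t u)" for x
      unfolding D_def conv_def right_diff_distrib
      by (intro Bochner_Integration.integral_diff square_integrable_conv_bound(1)[OF H] gt G_square_integrable t')
    \<comment> \<open>This is the only use of \<open>b_eq\<close>, the relation between coefficient
      and accelerant: on the diagonal \<open>G t t = b t\<close>, and replacing \<open>b t\<close>
      cancels \<open>H t\<close> and leaves the difference of two convolutions.\<close>
    have "res t t = (LBINT u. H (t - u) * D u)"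
      unfolding res_def G_diag[OF t'(1)] HD using bt t by simp
    also have "\<dots> = (LBINT u. D u * h u + (LBINT w. h w * (H (w - u) * D u)))"
    proof (rule integral_cong_AE)
      have "AE u in lborel. t - u \<in> {0..t} \<longrightarrow> g t (t - u) + (LBINT v. H (t - u - v) * g t v) = H (t - u)"
        using AE_borel_affine[of "-1" "\<lambda>s. s \<in> {0..t} \<longrightarrow> g t s + (LBINT u. H (s - u) * g t u) = H s" t]  g_eq[OF t]
        by simp
      then show "AE u in lborel. H (t - u) * D u = D u * h u + (LBINT w. h w * (H (w - u) * D u))"
      proof eventually_elim
        fix u assume u: "t - u \<in> {0..t} \<longrightarrow> g t (t - u) + (LBINT v. H (t - u - v) * g t v) = H (t - u)"
        show "H (t - u) * D u = D u * h u + (LBINT w. h w * (H (w - u) * D u))"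
        proof (cases "u \<in> {0..t}")
          case True
          have "(LBINT w. h w * (H (w - u) * D u)) = (LBINT w. D u * (H (t - u - (t - w)) * g t (t - w)))"
            by (rule Bochner_Integration.integral_cong) (auto simp: h_def)
          also have "\<dots> = D u * (LBINT w. H (t - u - (t - w)) * g t (t - w))"
            by (rule integral_mult_right_zero)
          also have "(LBINT w. H (t - u - (t - w)) * g t (t - w)) = (LBINT v. H (t - u - v) * g t v)"
            by (rule integral_reflect(1)[of "\<lambda>v. H (t - u - v) * g t v"])
          also have "\<dots> = H (t - u) - h u" using u True by (simp add: h_def eq_diff_eq add.commute)
          finally show ?thesis by (simp add: algebra_simps)
        qed (simp add: D_supp)
      qed
    qed measurable
    also have "\<dots> = (LBINT u. D u * h u) + (LBINT u. LBINT w. h w * (H (w - u) * D u))"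
      by (intro Bochner_Integration.integral_add square_integrable_mult(1) D h
          lborel_pair.integrable_snd integrable_triple h_int H)
    also have "(LBINT u. LBINT w. h w * (H (w - u) * D u)) = (LBINT w. LBINT u. h w * (H (w - u) * D u))"
      by (intro lborel_pair.Fubini_integral integrable_triple h_int H D)
    also have "(LBINT u. D u * h u) + \<dots> = (LBINT w. D w * h w + (LBINT u. h w * (H (w - u) * D u)))"
      by (intro Bochner_Integration.integral_add[symmetric] square_integrable_mult(1) D h
          lborel_pair.integrable_fst integrable_triple h_int H)
    also have "\<dots> = (LBINT w. (indicator {0..t} w * res t w) * h w)"
    proof (rule integral_cong_AE)
      show "AE w in lborel. D w * h w + (LBINT u. h w * (H (w - u) * D u)) = (indicator {0..t} w * res t w) * h w"
        using g_eq[OF t]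
      proof eventually_elim
        fix w assume w: "w \<in> {0..t} \<longrightarrow> g t w + (LBINT u. H (w - u) * g t u) = H w"
        show "D w * h w + (LBINT u. h w * (H (w - u) * D u)) = (indicator {0..t} w * res t w) * h w"
        proof (cases "w \<in> {0..t}")
          case True
          have "(LBINT u. h w * (H (w - u) * D u)) = h w * (conv t w - (LBINT u. H (w - u) * g t u))"
            unfolding HD[symmetric] by (rule integral_mult_right_zero)
          also have "(LBINT u. H (w - u) * g t u) = H w - g t w" using w True by (simp add: eq_diff_eq add.commute)
          finally show ?thesis using True by (simp add: D_def res_def algebra_simps)
        qed (simp add: h_supp)
      qed
    qed measurable
    finally have "(cmod (res t t))\<^sup>2 \<le> sq_norm (\<lambda>w. indicator {0..t} w * res t w) * sq_norm h"
      using square_integrable_mult(3)[OF res_square_integrable[OF t'(2)] h] by simp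
    also have "\<dots> \<le> N t * Cg"
      unfolding N_eq h_def square_integrable_reflect(2)[OF gt]
      by (intro mult_left_mono g_norm t) simp
    finally show "(cmod (res t t))\<^sup>2 \<le> N t * Cg" .
  qed
qed

end

context resolvent_family
begin

text \<open>Subtract \<open>res_eq\<close> at length \<open>t\<close> from \<open>res_eq\<close> at
  length \<open>r\<close>. The inhomogeneity and the part with \<open>\<rho> < t\<close> cancel,
  leaving \<open>\<rho>\<close> in \<open>[t, r]\<close>, where \<open>\<rho> - t\<close> lies in
  \<open>[0, \<rho>]\<close> and \<open>res_bound\<close> is available. Cauchy-Schwarz against
  \<open>b\<close> gives the second term.\<close>

lemma res_sq_bound:
  assumes "0 \<le> t" "t \<le> r" "r \<le> R"
  shows "(cmod (res r t))\<^sup>2 \<le> 2 * (cmod (res t t))\<^sup>2 +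
     2 * sq_norm b * (LBINT \<rho>. indicator {t..r} \<rho> * (cmod (res \<rho> (\<rho> - t)))\<^sup>2)"
    and "integrable lborel (\<lambda>\<rho>. indicator {t..r} \<rho> * (cmod (res \<rho> (\<rho> - t)))\<^sup>2)"
proof -
  have tt: "t \<le> t" by simp
  have tR: "t \<le> R" using assms by simp
  define h where "h \<rho> = indicator {t..r} \<rho> * cnj (res \<rho> (\<rho> - t))" for \<rho>
  have [measurable]: "h \<in> borel_measurable borel" unfolding h_def by measurable
  have h: "square_integrable h"
  proof (rule square_integrable_bound[OF square_integrable_translate(1)[OF rbd_square_integrable, of t], of _ 1])
    show "cmod (h \<rho>) \<le> 1 * cmod (complex_of_real (rbd (\<rho> - t)))" for \<rho>
      using res_bound[of "\<rho> - t" \<rho>] assms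
      by (cases "\<rho> \<in> {t..r}") (auto simp: h_def intro: order_trans[OF _ abs_ge_self])
  qed measurable
  have h2: "(cmod (h \<rho>))\<^sup>2 = indicator {t..r} \<rho> * (cmod (res \<rho> (\<rho> - t)))\<^sup>2" for \<rho>
    by (simp add: h_def indicator_def)
  show "integrable lborel (\<lambda>\<rho>. indicator {t..r} \<rho> * (cmod (res \<rho> (\<rho> - t)))\<^sup>2)"
    using h unfolding square_integrable_def h2 by simp
  note r1 = res_eq[OF assms] and r2 = res_eq[OF assms(1) tt tR]
  have "res r t - res t t = (LBINT \<rho>. indicator {0..t} \<rho> * (b \<rho> * cnj (res \<rho> (\<rho> - t))) - indicator {0..r} \<rho> * (b \<rho> * cnj (res \<rho> (\<rho> - t))))"
    unfolding Bochner_Integration.integral_diff[OF r2(2) r1(2)] using r1(1) r2(1) by simp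
  also have "\<dots> = (LBINT \<rho>. - (b \<rho> * h \<rho>))"
  proof (rule integral_cong_AE)
    show "AE \<rho> in lborel. indicator {0..t} \<rho> * (b \<rho> * cnj (res \<rho> (\<rho> - t))) - indicator {0..r} \<rho> * (b \<rho> * cnj (res \<rho> (\<rho> - t))) = - (b \<rho> * h \<rho>)"
      using AE_lborel_singleton[of t] by eventually_elim (use assms in \<open>auto simp: h_def indicator_def\<close>)
  qed measurable
  finally have "res r t = res t t + - (LBINT \<rho>. b \<rho> * h \<rho>)" by (simp add: algebra_simps)
  then have "(cmod (res r t))\<^sup>2 \<le> 2 * (cmod (res t t))\<^sup>2 + 2 * (cmod (LBINT \<rho>. b \<rho> * h \<rho>))\<^sup>2"
    using cmod_add_sq[of "res t t" "- (LBINT \<rho>. b \<rho> * h \<rho>)"] by simp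
  also have "\<dots> \<le> 2 * (cmod (res t t))\<^sup>2 + 2 * (sq_norm b * sq_norm h)"
    using square_integrable_mult(3)[OF b h] by simp
  finally show "(cmod (res r t))\<^sup>2 \<le> 2 * (cmod (res t t))\<^sup>2 +
     2 * sq_norm b * (LBINT \<rho>. indicator {t..r} \<rho> * (cmod (res \<rho> (\<rho> - t)))\<^sup>2)"
    unfolding sq_norm_def[of h] h2 by (simp add: mult.assoc)
qed

lemma N_measurable [measurable]: "N \<in> borel_measurable borel"
  unfolding N_def indicator_def[abs_def] atLeastAtMost_iff by measurable

lemma N_nonneg: "0 \<le> N r" unfolding N_eq by simp

lemma N_integrable:
  assumes "r \<le> R" shows "integrable lborel (\<lambda>t. indicator {0..r} t * (cmod (res r t))\<^sup>2)"
proof -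
  have "(cmod (indicator {0..r} t * res r t))\<^sup>2 = indicator {0..r} t * (cmod (res r t))\<^sup>2" for t
    by (auto simp: indicator_def)
  then show ?thesis using res_square_integrable[OF assms] by (simp add: square_integrable_def)
qed

text \<open>Integrate \<open>res_sq_bound\<close> over \<open>t\<close>. The diagonal values are
  controlled by \<open>res_diag_bound\<close>, which contributes \<open>Cg\<close>. In the double
  integral over \<open>t \<le> \<rho> \<le> r\<close>, exchanging the order and reflecting
  \<open>t\<close> into \<open>\<rho> - t\<close> turns the inner integral into
  \<open>N \<rho>\<close>, which contributes \<open>sq_norm b\<close>.\<close>

lemma N_gronwall:
  assumes r: "r \<in> {0..R}"
  shows "N r \<le> (2 * Cg + 2 * sq_norm b) * (LBINT u. indicator {0..r} u * N u)"
proof -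
  define k where "k \<rho> t = indicator {0..r} \<rho> * (indicator {0..\<rho>} (\<rho> - t) * (cmod (res \<rho> (\<rho> - t)))\<^sup>2)" for \<rho> t
  have k_measurable: "(\<lambda>(\<rho>, t). k \<rho> t) \<in> borel_measurable (lborel \<Otimes>\<^sub>M lborel)"
    unfolding k_def indicator_def[abs_def] atLeastAtMost_iff by measurable
  have pair: "integrable (lborel \<Otimes>\<^sub>M lborel) (\<lambda>(\<rho>, t). k \<rho> t)"
  proof (rule Bochner_Integration.integrable_bound)
    have rb: "integrable lborel (\<lambda>s. complex_of_real ((rbd s)\<^sup>2))"
      using rbd_square_integrable by (simp add: square_integrable_def del: of_real_power)
    have ib: "integrable lborel (\<lambda>s. indicator {0..r} s :: complex)"
      using bounded_indicator_integrable[of "\<lambda>_. 1" r 1] by simp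
    show "integrable (lborel \<Otimes>\<^sub>M lborel) (\<lambda>(\<rho>, t). indicator {0..r} \<rho> * complex_of_real ((rbd (\<rho> - t))\<^sup>2))"
      by (rule integrable_conv_pair[OF ib rb])
    have "\<bar>k \<rho> t\<bar> \<le> cmod (indicator {0..r} \<rho> * complex_of_real ((rbd (\<rho> - t))\<^sup>2))" for \<rho> t
    proof (cases "\<rho> \<in> {0..r} \<and> \<rho> - t \<in> {0..\<rho>}")
      case True
      then have "cmod (res \<rho> (\<rho> - t)) \<le> rbd (\<rho> - t)" using r by (intro res_bound) auto
      then have "(cmod (res \<rho> (\<rho> - t)))\<^sup>2 \<le> (rbd (\<rho> - t))\<^sup>2" by (rule power_mono) simp
      then show ?thesis using True by (simp add: k_def norm_mult norm_power)
    next
      case False then have "k \<rho> t = 0" by (auto simp: k_def)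
      then show ?thesis by simp
    qed
    then show "AE x in lborel \<Otimes>\<^sub>M lborel. norm (case x of (\<rho>, t) \<Rightarrow> k \<rho> t)
      \<le> norm (case x of (\<rho>, t) \<Rightarrow> indicator {0..r} \<rho> * complex_of_real ((rbd (\<rho> - t))\<^sup>2))" by auto
  qed (fact k_measurable)
  have inner: "(LBINT t. k \<rho> t) = indicator {0..r} \<rho> * N \<rho>" for \<rho>
  proof -
    have "(LBINT t. k \<rho> t) = indicator {0..r} \<rho> * (LBINT t. indicator {0..\<rho>} (\<rho> - t) * (cmod (res \<rho> (\<rho> - t)))\<^sup>2)"
      unfolding k_def by (rule integral_mult_right_zero)
    also have "(LBINT t. indicator {0..\<rho>} (\<rho> - t) * (cmod (res \<rho> (\<rho> - t)))\<^sup>2) = N \<rho>"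
      unfolding N_def by (rule integral_reflect(1)[of "\<lambda>s. indicator {0..\<rho>} s * (cmod (res \<rho> s))\<^sup>2"])
    finally show ?thesis .
  qed
  have iN: "integrable lborel (\<lambda>u. indicator {0..r} u * N u)"
    using lborel_pair.integrable_fst[OF pair] unfolding inner .
  have ik: "integrable lborel (\<lambda>t. LBINT \<rho>. k \<rho> t)" by (rule lborel_pair.integrable_snd[OF pair])
  have k_eq: "k \<rho> t = indicator {t..r} \<rho> * (cmod (res \<rho> (\<rho> - t)))\<^sup>2" if "t \<in> {0..r}" for \<rho> t
    using that by (auto simp: k_def indicator_def)
  have k_nonneg: "0 \<le> (LBINT \<rho>. k \<rho> t)" for t by (rule Bochner_Integration.integral_nonneg) (simp add: k_def)
  have "N r \<le> (LBINT t. 2 * Cg * (indicator {0..r} t * N t) + 2 * sq_norm b * (LBINT \<rho>. k \<rho> t))"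
    unfolding N_def[of r]
  proof (rule integral_mono_AE)
    show "integrable lborel (\<lambda>t. indicator {0..r} t * (cmod (res r t))\<^sup>2)"
      using N_integrable r by simp
    show "integrable lborel (\<lambda>t. 2 * Cg * (indicator {0..r} t * N t) + 2 * sq_norm b * (LBINT \<rho>. k \<rho> t))"
      using iN ik by simp
    show "AE t in lborel. indicator {0..r} t * (cmod (res r t))\<^sup>2 \<le> 2 * Cg * (indicator {0..r} t * N t) + 2 * sq_norm b * (LBINT \<rho>. k \<rho> t)"
      \<comment> \<open>The point \<open>t = 0\<close> is set aside because the resolvents, and with
        them the diagonal bound, exist for positive lengths only.\<close>
      using res_diag_bound AE_lborel_singleton[of 0]
    proof eventually_elim
      fix t assume *: "t \<in> {0<..R} \<longrightarrow> (cmod (res t t))\<^sup>2 \<le> N t * Cg" "t \<noteq> 0"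
      show "indicator {0..r} t * (cmod (res r t))\<^sup>2 \<le> 2 * Cg * (indicator {0..r} t * N t) + 2 * sq_norm b * (LBINT \<rho>. k \<rho> t)"
      proof (cases "t \<in> {0..r}")
        case True
        then have t: "0 \<le> t" "t \<le> r" "r \<le> R" "t \<in> {0<..R}" using r *(2) by auto
        have "(cmod (res r t))\<^sup>2 \<le> 2 * (cmod (res t t))\<^sup>2 + 2 * sq_norm b * (LBINT \<rho>. k \<rho> t)"
          using res_sq_bound(1)[OF t(1-3)] unfolding k_eq[OF True] .
        also have "\<dots> \<le> 2 * (N t * Cg) + 2 * sq_norm b * (LBINT \<rho>. k \<rho> t)" using *(1) t(4) by simp
        finally show ?thesis using True by (simp add: mult_ac)
      qed (use k_nonneg[of t] in simp)
    qed
  qed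
  also have "\<dots> = 2 * Cg * (LBINT u. indicator {0..r} u * N u) + 2 * sq_norm b * (LBINT t. LBINT \<rho>. k \<rho> t)"
    using iN ik by simp
  also have "(LBINT t. LBINT \<rho>. k \<rho> t) = (LBINT u. indicator {0..r} u * N u)"
    unfolding lborel_pair.Fubini_integral[OF pair] inner ..
  finally show ?thesis by (simp add: algebra_simps)
qed

lemma resolvent_equation:
  assumes r: "r \<in> {0..R}"
  shows "AE t in lborel. t \<in> {0..r} \<longrightarrow> G r t + (LBINT u. H (t - u) * G r u) = H t"
proof -
  have "0 \<le> Cg" using g_norm[of R] R order_trans[OF sq_norm_nonneg] by auto
  have "N r = 0"
    by (rule Gronwall_zero[OF N_measurable N_nonneg N_bound _ N_gronwall r]) (use \<open>0 \<le> Cg\<close> in auto)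
  then have "AE t in lborel. indicator {0..r} t * (cmod (res r t))\<^sup>2 = 0"
    unfolding N_def
    by (subst (asm) integral_nonneg_eq_0_iff_AE) (use N_integrable[of r] r in auto)
  then show ?thesis
    by eventually_elim (auto simp: res_def conv_def indicator_def split: if_splits)
qed

end

section \<open>Boundedness of the resolvents\<close>

lemma L2_truncation:
  assumes f: "square_integrable f" and "e > 0"
  obtains M :: nat where "M > 0" "sq_norm (\<lambda>x. f x - (if cmod (f x) \<le> M then f x else 0)) < e"
proof -
  note [measurable] = square_integrable_measurable[OF f]
  define t where "t n x = f x - (if cmod (f x) \<le> real n then f x else 0)" for n :: nat and x
  have "(\<lambda>n. LBINT x. (cmod (t n x))\<^sup>2) \<longlonglongrightarrow> (LBINT x::real. 0)"
  proof (rule integral_dominated_convergence)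
    show "integrable lborel (\<lambda>x. (cmod (f x))\<^sup>2)" using f by (simp add: square_integrable_def)
    show "(\<lambda>x. (cmod (t n x))\<^sup>2) \<in> borel_measurable lborel" for n unfolding t_def by measurable
    show "AE x in lborel. norm ((cmod (t n x))\<^sup>2) \<le> (cmod (f x))\<^sup>2" for n by (auto simp: t_def)
    show "AE x in lborel. (\<lambda>n. (cmod (t n x))\<^sup>2) \<longlonglongrightarrow> 0"
    proof (rule AE_I2)
      fix x
      obtain n0 :: nat where "cmod (f x) \<le> n0" using real_arch_simple by blast
      then have "(cmod (t n x))\<^sup>2 = 0" if "n \<ge> n0" for n using that by (auto simp: t_def)
      then show "(\<lambda>n. (cmod (t n x))\<^sup>2) \<longlonglongrightarrow> 0"
        by (intro tendsto_eventually eventually_sequentiallyI)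
    qed
  qed simp
  then have "\<forall>\<^sub>F n in sequentially. (LBINT x. (cmod (t n x))\<^sup>2) < e"
    using order_tendstoD(2)[of _ "0::real" sequentially e] \<open>e > 0\<close> by simp
  then have "\<forall>\<^sub>F n in sequentially. (LBINT x. (cmod (t n x))\<^sup>2) < e \<and> n > 0"
    using eventually_gt_at_top[of "0::nat"] by eventually_elim simp
  then obtain n where "(LBINT x. (cmod (t n x))\<^sup>2) < e" "n > 0"
    using eventually_happens'[OF sequentially_bot] by blast
  then show thesis using that[of n] by (simp add: sq_norm_def t_def)
qed

text \<open>After truncation the function is bounded. It is then an almost everywhere limit of
  continuous functions, and cutting these down in size and support supplies a majorant, so that
  dominated convergence gives approximation in norm. Both errors are below \<open>e / 4\<close>
  because \<open>square_integrable_add\<close> doubles each of them.\<close>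

lemma L2_approx_continuous:
  assumes f: "square_integrable f" and supp: "\<And>x. x \<notin> {-a..a} \<Longrightarrow> f x = 0" and "e > 0"
  obtains k where "continuous_on UNIV k" "\<And>x. x \<notin> {-(a+1)..a+1} \<Longrightarrow> k x = 0" "square_integrable k"
    "sq_norm (\<lambda>x. f x - k x) < e"
proof -
  note [measurable] = square_integrable_measurable[OF f]
  obtain M :: nat where M: "M > 0" "sq_norm (\<lambda>x. f x - (if cmod (f x) \<le> M then f x else 0)) < e / 4"
    using L2_truncation[OF f, of "e / 4"] \<open>e > 0\<close> by auto
  define h where "h x = (if cmod (f x) \<le> M then f x else 0)" for x
  have [measurable]: "h \<in> borel_measurable borel" unfolding h_def by measurable
  have h_le: "cmod (h x) \<le> M" and h_supp: "x \<notin> {-a..a} \<Longrightarrow> h x = 0" for x using supp by (auto simp: h_def)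
  have "h \<in> borel_measurable lebesgue" using measurable_completion[of h lborel borel] by simp
  then have "h measurable_on UNIV" by (rule lebesgue_measurable_imp_measurable_on) auto
  then obtain Z c where Z: "negligible Z" and c: "\<And>n. continuous_on UNIV (c n)"
    "\<And>x. x \<notin> Z \<Longrightarrow> (\<lambda>n. c n x) \<longlonglongrightarrow> h x"
    unfolding measurable_on_def by auto
  \<comment> \<open>\<open>cut\<close> equals 1 on \<open>[-a, a]\<close> and falls linearly to 0
    over distance 1; \<open>k n\<close> also rescales the values of \<open>c n\<close> radially to
    modulus at most \<open>M\<close>. Both operations fix \<open>h\<close>, so the pointwise limit
    is unchanged.\<close>
  define cut where "cut x = max 0 (min 1 (a + 1 - \<bar>x\<bar>))" for x :: real
  define k where "k n x = of_real (cut x) * (c n x * of_real (M / max M (cmod (c n x))))" for n x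
  have max_pos: "0 < max (real M) y" for y using M(1) by (simp add: less_max_iff_disj)
  have k_cont: "continuous_on UNIV (k n)" for n
    unfolding k_def cut_def using max_pos
    by (intro continuous_intros c) (auto simp: less_imp_neq[THEN not_sym])
  have cut: "0 \<le> cut x" "cut x \<le> 1" for x by (auto simp: cut_def)
  have clip: "cmod (w * of_real (M / max M (cmod w))) \<le> M" for w
  proof -
    have "cmod w * (M / max M (cmod w)) \<le> M"
      using max_pos[of "cmod w"] M(1) by (simp add: divide_le_eq)
    then show ?thesis using max_pos[of "cmod w"] by (simp add: norm_mult norm_divide)
  qed
  have k_le: "cmod (k n x) \<le> M" for n x
  proof -
    have "cmod (k n x) \<le> 1 * real M"
      unfolding k_def norm_mult[of "of_real _"] using cut[of x]
      by (intro mult_mono clip) auto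
    then show ?thesis by simp
  qed
  have k_supp: "k n x = 0" if "x \<notin> {-(a+1)..a+1}" for n x using that by (auto simp: k_def cut_def)
  have [measurable]: "k n \<in> borel_measurable borel" for n
    using k_cont[of n] by (rule borel_measurable_continuous_onI)
  have k_sq: "square_integrable (k n)" for n
    by (rule square_integrable_bounded[OF _ k_supp k_le]) auto
  have k_lim: "(\<lambda>n. k n x) \<longlonglongrightarrow> h x" if "x \<notin> Z" for x
  proof -
    have "(\<lambda>n. k n x) \<longlonglongrightarrow> of_real (cut x) * (h x * of_real (M / max M (cmod (h x))))"
      unfolding k_def using max_pos by (intro tendsto_intros c that) (auto simp: less_imp_neq[THEN not_sym])
    also have "of_real (cut x) * (h x * of_real (M / max M (cmod (h x)))) = h x"
      using h_le[of x] M(1) h_supp[of x] by (cases "x \<in> {-a..a}") (auto simp: cut_def max_def)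
    finally show ?thesis .
  qed
  have "(\<lambda>n. LBINT x. (cmod (h x - k n x))\<^sup>2) \<longlonglongrightarrow> (LBINT x::real. 0)"
  proof (rule integral_dominated_convergence)
    show "integrable lborel (\<lambda>x. (2 * real M)\<^sup>2 * indicator {-(a+1)..a+1} x)"
      by (intro integrable_mult_right integrable_real_indicator) (auto simp: emeasure_lborel_Icc_eq)
    show "AE x in lborel. norm ((cmod (h x - k n x))\<^sup>2) \<le> (2 * real M)\<^sup>2 * indicator {-(a+1)..a+1} x" for n
    proof (rule AE_I2)
      fix x
      show "norm ((cmod (h x - k n x))\<^sup>2) \<le> (2 * real M)\<^sup>2 * indicator {-(a+1)..a+1} x"
      proof (cases "x \<in> {-(a+1)..a+1}")
        case True
        have "cmod (h x - k n x) \<le> 2 * real M"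
          using norm_triangle_ineq4[of "h x" "k n x"] h_le[of x] k_le[of n x] by linarith
        then have "(cmod (h x - k n x))\<^sup>2 \<le> (2 * real M)\<^sup>2" by (rule power_mono) simp
        then show ?thesis using True by simp
      next
        case False
        then have "h x = 0" by (intro h_supp) auto
        then show ?thesis using k_supp[OF False] False by simp
      qed
    qed
    have "Z \<in> null_sets lebesgue" using Z by (simp add: negligible_iff_null_sets)
    then have "AE x in lebesgue. x \<notin> Z" by (rule AE_not_in)
    then have "AE x in lborel. x \<notin> Z" by (simp add: AE_completion_iff)
    then show "AE x in lborel. (\<lambda>n. (cmod (h x - k n x))\<^sup>2) \<longlonglongrightarrow> 0"
    proof eventually_elim
      case (elim x)
      have "(\<lambda>n. (cmod (h x - k n x))\<^sup>2) \<longlonglongrightarrow> (cmod (h x - h x))\<^sup>2"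
        by (intro tendsto_intros k_lim elim)
      then show ?case by simp
    qed
  qed measurable
  then have "\<forall>\<^sub>F n in sequentially. (LBINT x. (cmod (h x - k n x))\<^sup>2) < e / 4"
    using order_tendstoD(2)[of _ "0::real" sequentially "e / 4"] \<open>e > 0\<close> by simp
  then obtain n where n: "sq_norm (\<lambda>x. h x - k n x) < e / 4"
    unfolding sq_norm_def using eventually_happens'[OF sequentially_bot] by blast
  show thesis
  proof (rule that[OF k_cont[of n] k_supp k_sq])
    have hs: "square_integrable h" by (rule square_integrable_bounded[OF _ h_supp h_le]) auto
    have "sq_norm (\<lambda>x. f x - k n x) \<le> 2 * sq_norm (\<lambda>x. f x - h x) + 2 * sq_norm (\<lambda>x. h x - k n x)"
      using square_integrable_add(2)[OF square_integrable_diff[OF f hs] square_integrable_diff[OF hs k_sq[of n]]] by simp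
    then show "sq_norm (\<lambda>x. f x - k n x) < e" using n M(2)[folded h_def] by linarith
  qed
qed

text \<open>Split the increment of \<open>f\<close> into the translated error \<open>f - k\<close>,
  the increment of a continuous \<open>k\<close>, and the error \<open>k - f\<close>. Doubling at
  each of the two additions gives weights 4, 4 and 2, so the tolerances \<open>e / 12\<close> for
  the error and \<open>e / 16\<close> for the increment of \<open>k\<close> add up to less than
  \<open>e\<close>.\<close>

lemma L2_translation_continuous:
  assumes f: "square_integrable f" and supp: "\<And>x. x \<notin> {-a..a} \<Longrightarrow> f x = 0" and "a > 0" "e > 0"
  obtains d where "d > 0" "\<And>h. \<bar>h\<bar> < d \<Longrightarrow> sq_norm (\<lambda>x. f (x - h) - f x) < e"
proof -
  obtain k where k_cont: "continuous_on UNIV k" and k_supp: "\<And>x. x \<notin> {-(a+1)..a+1} \<Longrightarrow> k x = 0"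
    and k_sq: "square_integrable k" and k_appr: "sq_norm (\<lambda>x. f x - k x) < e / 12"
    by (rule L2_approx_continuous[where f = f and a = a and e = "e / 12"]) (use f supp \<open>e > 0\<close> in auto)
  \<comment> \<open>\<open>L\<close> is the length of \<open>[-(a+2), a+2]\<close>, which carries
    \<open>k\<close> and all its translates by less than 1; \<open>\<eta>\<close> is then chosen so
    that \<open>\<eta>\<^sup>2 * L = e / 16\<close>.\<close>
  define L where "L = 2 * a + 4"
  have "L > 0" using \<open>a > 0\<close> by (simp add: L_def)
  define \<eta> where "\<eta> = sqrt (e / (16 * L))"
  have "\<eta> > 0" using \<open>e > 0\<close> \<open>L > 0\<close> by (simp add: \<eta>_def)
  have "uniformly_continuous_on {-(a+3)..a+3} k"
    by (intro compact_uniformly_continuous continuous_on_subset[OF k_cont]) auto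
  then obtain d where d: "d > 0" "\<And>x y. x \<in> {-(a+3)..a+3} \<Longrightarrow> y \<in> {-(a+3)..a+3} \<Longrightarrow> dist y x < d \<Longrightarrow> dist (k y) (k x) < \<eta>"
    unfolding uniformly_continuous_on_def using \<open>\<eta> > 0\<close> by metis
  show thesis
  proof
    show "min d 1 > 0" using d by simp
    fix h :: real assume h: "\<bar>h\<bar> < min d 1"
    have fk: "square_integrable (\<lambda>x. f x - k x)" by (rule square_integrable_diff[OF f k_sq])
    have kh: "square_integrable (\<lambda>x. k (x - h) - k x)"
      by (rule square_integrable_diff[OF square_integrable_translate(1)[OF k_sq] k_sq])
    have pt: "(cmod (k (x - h) - k x))\<^sup>2 \<le> \<eta>\<^sup>2 * indicator {-(a+2)..a+2} x" for x
    proof (cases "x \<in> {-(a+2)..a+2}")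
      case True
      have "dist (k (x - h)) (k x) < \<eta>" using True h by (intro d) (auto simp: dist_real_def)
      then have "(cmod (k (x - h) - k x))\<^sup>2 \<le> \<eta>\<^sup>2" unfolding dist_norm by (intro power_mono) auto
      then show ?thesis using True by simp
    next
      case False
      have "k (x - h) = 0" "k x = 0" using False h by (auto intro!: k_supp)
      then show ?thesis by simp
    qed
    have "sq_norm (\<lambda>x. k (x - h) - k x) \<le> (LBINT x. \<eta>\<^sup>2 * indicator {-(a+2)..a+2} x)"
      unfolding sq_norm_def
      by (rule integral_mono[OF _ _ pt])
        (use kh in \<open>auto simp: square_integrable_def emeasure_lborel_Icc_eq intro!: integrable_mult_right integrable_real_indicator\<close>)
    also have "\<dots> = \<eta>\<^sup>2 * L" using \<open>a > 0\<close> by (simp add: L_def)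
    also have "\<dots> = e / 16" using \<open>L > 0\<close> \<open>e > 0\<close> by (simp add: \<eta>_def)
    finally have k1: "sq_norm (\<lambda>x. k (x - h) - k x) \<le> e / 16" .
    note A = square_integrable_translate[OF fk, of h]
    note B = square_integrable_add[OF A(1) kh]
    have kf: "square_integrable (\<lambda>x. k x - f x)" by (rule square_integrable_diff[OF k_sq f])
    have kf_norm: "sq_norm (\<lambda>x. k x - f x) = sq_norm (\<lambda>x. f x - k x)"
      by (simp add: sq_norm_def norm_minus_commute)
    note D = square_integrable_add(2)[OF B(1) kf]
    have "sq_norm (\<lambda>x. f (x - h) - f x) \<le> 2 * (2 * sq_norm (\<lambda>x. f x - k x) + 2 * sq_norm (\<lambda>x. k (x - h) - k x)) + 2 * sq_norm (\<lambda>x. f x - k x)"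
      using D B(2) unfolding A(2) kf_norm by simp
    moreover have "X < e" if "X \<le> 2 * (2 * A + 2 * K) + 2 * A" "K \<le> e / 16" "A < e / 12" for X A K :: real
    proof -
      have "X \<le> 6 * A + 4 * K" using that(1) by simp
      moreover have "4 * K \<le> e / 4" using that(2) by simp
      moreover have "6 * A < e / 2" using that(3) by simp
      moreover have "e / 2 + e / 4 < e" using \<open>e > 0\<close> by simp
      ultimately show ?thesis by (smt (verit))
    qed
    ultimately show "sq_norm (\<lambda>x. f (x - h) - f x) < e" using k1 k_appr by blast
  qed
qed

text \<open>Otherwise normalised solutions \<open>f\<^sub>n\<close> have \<open>f\<^sub>n + H * f\<^sub>n \<longlonglongrightarrow> 0\<close>. Arzela-Ascoli, applied to \<open>H * f\<^sub>n\<close>, yields a limit of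
  norm 1 in the kernel of \<open>I + \<H>\<^sub>T\<close>.\<close>
lemma solutions_bounded:
  fixes H :: "real \<Rightarrow> complex" and g :: "real \<Rightarrow> real \<Rightarrow> complex"
  assumes "0 < R" and H: "square_integrable H" and H_supp: "\<And>x. x \<notin> {-R..R} \<Longrightarrow> H x = 0"
    and g: "\<And>t. t \<in> {0<..R} \<Longrightarrow> square_integrable (g t)"
    and g_supp: "\<And>t s. t \<in> {0<..R} \<Longrightarrow> s \<notin> {0..t} \<Longrightarrow> g t s = 0"
    and g_eq: "\<And>t. t \<in> {0<..R} \<Longrightarrow>
      AE s in lborel. s \<in> {0..t} \<longrightarrow> g t s + (LBINT u. H (s - u) * g t u) = H s"
    and inj: "\<And>t f. t \<in> {0<..R} \<Longrightarrow> square_integrable f \<Longrightarrow> (\<And>s. s \<notin> {0..t} \<Longrightarrow> f s = 0) \<Longrightarrow>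
      (\<And>s. s \<in> {0..t} \<Longrightarrow> f s + (LBINT u. H (s - u) * f u) = 0) \<Longrightarrow> sq_norm f = 0"
  obtains B where "\<And>t. t \<in> {0<..R} \<Longrightarrow> sq_norm (g t) \<le> B"
proof (rule ccontr)
  assume "\<not> thesis"
  then have "\<forall>B. \<exists>t. t \<in> {0<..R} \<and> sq_norm (g t) > B" using that by (metis not_le)
  \<comment> \<open>Squares are used so that the norms \<open>\<nu> n\<close> exceed
    \<open>n + 1\<close>. After division by \<open>\<nu> n\<close> the right-hand side
    \<open>H\<close> of the equation then tends to 0 pointwise.\<close>
  then have "\<forall>n. \<exists>t. t \<in> {0<..R} \<and> sq_norm (g t) > (real n + 1)\<^sup>2" by blast
  from choice[OF this] obtain \<tau> where \<tau>: "\<And>n. \<tau> n \<in> {0<..R}" "\<And>n. sq_norm (g (\<tau> n)) > (real n + 1)\<^sup>2"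
    by blast
  note [measurable] = square_integrable_measurable[OF H]
  define \<nu> where "\<nu> n = sqrt (sq_norm (g (\<tau> n)))" for n
  have \<nu>: "\<nu> n > real n + 1" for n unfolding \<nu>_def using \<tau>(2)[of n] by (rule real_less_rsqrt)
  have \<nu>_pos: "\<nu> n > 0" for n using \<nu>[of n] by linarith
  define f where "f n u = g (\<tau> n) u / of_real (\<nu> n)" for n u
  have f: "square_integrable (f n)" for n
    by (rule square_integrable_bound[OF g[OF \<tau>(1)[of n]], of _ "1 / \<nu> n"])
      (use \<nu>_pos[of n] g[OF \<tau>(1)[of n]] in \<open>auto simp: f_def[abs_def] norm_divide square_integrable_def\<close>)
  note [measurable] = square_integrable_measurable[OF f]
  have f_norm: "sq_norm (f n) = 1" for n
  proof -
    have "sq_norm (f n) = sq_norm (g (\<tau> n)) / (\<nu> n)\<^sup>2"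
      by (simp add: sq_norm_def f_def norm_divide power_divide)
    also have "(\<nu> n)\<^sup>2 = sq_norm (g (\<tau> n))" by (simp add: \<nu>_def)
    finally show ?thesis using \<nu>_pos[of n] by (simp add: \<nu>_def)
  qed
  have f_supp: "f n s = 0" if "s \<notin> {0..\<tau> n}" for n s using g_supp[OF \<tau>(1) that] by (simp add: f_def)
  define \<psi> where "\<psi> n x = (LBINT u. H (x - u) * f n u)" for n x
  define c where "c = sqrt (sq_norm H)"
  have \<psi>_le: "cmod (\<psi> n x) \<le> c" for n x
    unfolding \<psi>_def c_def using square_integrable_conv_bound(3)[OF H f[of n]] f_norm[of n] by simp
  \<comment> \<open>One null set serves all \<open>n\<close>, so that limits along a subsequence can
    be taken at each point outside it.\<close>
  have f_eq: "AE s in lborel. \<forall>n. s \<in> {0..\<tau> n} \<longrightarrow> f n s = H s / of_real (\<nu> n) - \<psi> n s"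
    unfolding AE_all_countable
  proof
    fix n
    show "AE s in lborel. s \<in> {0..\<tau> n} \<longrightarrow> f n s = H s / of_real (\<nu> n) - \<psi> n s"
      using g_eq[OF \<tau>(1)[of n]]
    proof eventually_elim
      case (elim s)
      have "\<psi> n s = (LBINT u. H (s - u) * g (\<tau> n) u) / of_real (\<nu> n)"
        unfolding \<psi>_def f_def by simp
      then show ?case using elim by (auto simp: f_def diff_divide_distrib[symmetric] eq_diff_eq)
    qed
  qed
  have equi: "\<exists>d>0. \<forall>n y. y \<in> {0..R} \<and> norm (x - y) < d \<longrightarrow> norm (\<psi> n x - \<psi> n y) < e"
    if "x \<in> {0..R}" "0 < e" for x e
  proof -
    obtain d where d: "d > 0" "\<And>h. \<bar>h\<bar> < d \<Longrightarrow> sq_norm (\<lambda>x. H (x - h) - H x) < e\<^sup>2"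
      by (rule L2_translation_continuous[where f = H and a = R and e = "e\<^sup>2"]) (use H H_supp \<open>0 < R\<close> \<open>0 < e\<close> in auto)
    have "norm (\<psi> n x - \<psi> n y) < e" if "norm (x - y) < d" for n y
    proof -
      have diff: "square_integrable (\<lambda>v. H (v - (x - y)) - H v)"
        by (rule square_integrable_diff[OF square_integrable_translate(1)[OF H] H])
      have "\<psi> n x - \<psi> n y = (LBINT u. H (x - u) * f n u - H (y - u) * f n u)"
        unfolding \<psi>_def by (intro Bochner_Integration.integral_diff[symmetric] square_integrable_conv_bound(1) H f)
      also have "\<dots> = (LBINT u. - ((H (x - u - (x - y)) - H (x - u)) * f n u))"
        by (rule Bochner_Integration.integral_cong) (simp_all add: algebra_simps)
      also have "cmod \<dots> \<le> sqrt (sq_norm (\<lambda>v. H (v - (x - y)) - H v) * sq_norm (f n))"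
        using square_integrable_conv_bound(3)[OF diff f[of n], of x] by simp
      also have "\<dots> < sqrt (e\<^sup>2)"
        unfolding f_norm mult_1_right using that by (intro real_sqrt_less_mono d(2)) simp
      finally show ?thesis using \<open>0 < e\<close> by simp
    qed
    then show ?thesis using d(1) by blast
  qed
  have cpt: "compact {0..R}" by simp
  obtain \<psi>' k where \<psi>': "continuous_on {0..R} \<psi>'" "strict_mono (k :: nat \<Rightarrow> nat)"
    "\<And>e. 0 < e \<Longrightarrow> \<exists>N. \<forall>n x. n \<ge> N \<and> x \<in> {0..R} \<longrightarrow> norm (\<psi> (k n) x - \<psi>' x) < e"
    using Arzela_Ascoli[OF cpt, of \<psi> c] \<psi>_le equi by blast
  have "\<forall>n. \<tau> (k n) \<in> {0..R}" using \<tau>(1) by (simp add: less_imp_le)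
  then obtain T l where T: "T \<in> {0..R}" "strict_mono (l :: nat \<Rightarrow> nat)" "((\<lambda>n. \<tau> (k n)) \<circ> l) \<longlonglongrightarrow> T"
    using cpt unfolding compact_def by metis
  define m where "m n = k (l n)" for n
  have m: "strict_mono m" using strict_mono_o[OF \<psi>'(2) T(2)] by (simp add: m_def[abs_def] o_def)
  have \<tau>_lim: "(\<lambda>n. \<tau> (m n)) \<longlonglongrightarrow> T" using T(3) by (simp add: m_def o_def)
  have \<psi>_lim: "(\<lambda>n. \<psi> (m n) x) \<longlonglongrightarrow> \<psi>' x" if "x \<in> {0..R}" for x
  proof -
    have "(\<lambda>n. \<psi> (k n) x) \<longlonglongrightarrow> \<psi>' x" using \<psi>'(3) that by (auto simp: LIMSEQ_iff) metis
    from LIMSEQ_subseq_LIMSEQ[OF this T(2)] show ?thesis by (simp add: m_def o_def)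
  qed
  have \<nu>_lim: "(\<lambda>n. H s / of_real (\<nu> (m n))) \<longlonglongrightarrow> 0" for s
  proof (rule Lim_null_comparison)
    show "\<forall>\<^sub>F n in sequentially. cmod (H s / of_real (\<nu> (m n))) \<le> cmod (H s) * inverse (real (Suc n))"
    proof (rule always_eventually, rule allI)
      fix n
      have "real (Suc n) \<le> \<nu> (m n)" using \<nu>[of "m n"] seq_suble[OF m, of n] by simp
      then have "inverse (\<nu> (m n)) \<le> inverse (real (Suc n))" by (intro le_imp_inverse_le) auto
      then show "cmod (H s / of_real (\<nu> (m n))) \<le> cmod (H s) * inverse (real (Suc n))"
        using \<nu>_pos[of "m n"] by (simp add: divide_inverse norm_mult norm_inverse mult_left_mono)
    qed
    show "(\<lambda>n. cmod (H s) * inverse (real (Suc n))) \<longlonglongrightarrow> 0"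
      using tendsto_mult_left[OF LIMSEQ_inverse_real_of_nat, of "cmod (H s)"] by simp
  qed
  \<comment> \<open>The limit is defined through the limit \<open>\<psi>'\<close> of the
    convolutions. Hence it is Borel, and the homogeneous equation holds at every point of
    \<open>[0, T]\<close>, as \<open>inj\<close> demands.\<close>
  define F where "F s = indicator {0..T} s *\<^sub>R (- \<psi>' s)" for s
  have F_meas [measurable]: "F \<in> borel_measurable borel"
    unfolding F_def using T(1)
    by (intro borel_measurable_continuous_on_indicator continuous_on_minus continuous_on_subset[OF \<psi>'(1)]) auto
  have F_supp: "F s = 0" if "s \<notin> {0..T}" for s using that by (simp add: F_def)
  \<comment> \<open>A common square integrable majorant of all \<open>f n\<close>. It upgrades
    pointwise convergence to convergence of the norms, so the limit keeps norm 1 and weak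
    compactness is avoided.\<close>
  define w where "w s = indicator {0..R} s * (cmod (H s) + c)" for s
  have w: "square_integrable (\<lambda>s. complex_of_real (w s))"
  proof -
    have 1: "square_integrable (\<lambda>s. complex_of_real (indicator {0..R} s * cmod (H s)))"
      by (rule square_integrable_bound[OF H, of _ 1]) (auto simp: indicator_def)
    have 2: "square_integrable (\<lambda>s. complex_of_real (indicator {0..R} s * c))"
      by (rule square_integrable_bounded[of _ 0 R "\<bar>c\<bar>"]) (auto simp: indicator_def)
    have "complex_of_real (indicator {0..R} s * cmod (H s)) + complex_of_real (indicator {0..R} s * c) = of_real (w s)" for s
      by (simp add: w_def algebra_simps)
    then show ?thesis using square_integrable_add(1)[OF 1 2] by simp
  qed
  have [measurable]: "w \<in> borel_measurable borel" unfolding w_def by measurable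
  have f_le: "AE s in lborel. \<forall>n. cmod (f n s) \<le> w s"
    using f_eq
  proof eventually_elim
    case (elim s)
    show ?case
    proof
      fix n
      show "cmod (f n s) \<le> w s"
      proof (cases "s \<in> {0..\<tau> n}")
        case True
        have "1 \<le> \<nu> n" using \<nu>[of n] by simp
        then have "cmod (H s / of_real (\<nu> n)) \<le> cmod (H s)"
          by (simp add: norm_divide divide_le_eq mult_le_cancel_left1)
        moreover have "cmod (f n s) \<le> cmod (H s / of_real (\<nu> n)) + cmod (\<psi> n s)"
          using elim True norm_triangle_ineq4 by metis
        moreover have "s \<in> {0..R}" using True \<tau>(1)[of n] by auto
        ultimately show ?thesis using \<psi>_le[of n s] by (simp add: w_def)
      next
        case False
        then show ?thesis by (simp add: f_supp w_def c_def)
      qed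
    qed
  qed
  have f_lim: "AE s in lborel. (\<lambda>n. f (m n) s) \<longlonglongrightarrow> F s"
    using f_eq AE_lborel_singleton[of T]
  proof eventually_elim
    case (elim s)
    \<comment> \<open>Away from \<open>T\<close> it is eventually decided whether \<open>s\<close>
      lies below \<open>\<tau> (m n)\<close>; at \<open>T\<close> itself this may change infinitely
      often, hence the exclusion of that point.\<close>
    consider "s < 0" | "0 \<le> s" "s < T" | "T < s" using elim(2) by linarith
    then show ?case
    proof cases
      case 1
      then show ?thesis by (simp add: F_def f_supp)
    next
      case 2
      have "\<forall>\<^sub>F n in sequentially. s < \<tau> (m n)" using order_tendstoD(1)[OF \<tau>_lim 2(2)] .
      then have "\<forall>\<^sub>F n in sequentially. f (m n) s = H s / of_real (\<nu> (m n)) - \<psi> (m n) s"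
        by eventually_elim (use elim(1) 2 in auto)
      moreover have "(\<lambda>n. H s / of_real (\<nu> (m n)) - \<psi> (m n) s) \<longlonglongrightarrow> 0 - \<psi>' s"
        using 2 T(1) by (intro tendsto_diff \<nu>_lim \<psi>_lim) auto
      ultimately show ?thesis using 2 by (simp add: F_def tendsto_cong)
    next
      case 3
      have "\<forall>\<^sub>F n in sequentially. \<tau> (m n) < s" using order_tendstoD(2)[OF \<tau>_lim 3] .
      then have "\<forall>\<^sub>F n in sequentially. f (m n) s = 0"
        by eventually_elim (auto intro: f_supp)
      then show ?thesis using 3 by (simp add: F_def tendsto_eventually)
    qed
  qed
  have F_le: "AE s in lborel. cmod (F s) \<le> w s"
    using f_lim f_le
  proof eventually_elim
    case (elim s)
    show ?case by (rule LIMSEQ_le_const2[OF tendsto_norm[OF elim(1)]]) (use elim(2) in auto)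
  qed
  have w2: "integrable lborel (\<lambda>s. (w s)\<^sup>2)" using w by (simp add: square_integrable_def)
  have F: "square_integrable F"
    unfolding square_integrable_def
  proof (intro conjI F_meas, rule Bochner_Integration.integrable_bound[OF w2])
    show "AE s in lborel. norm ((cmod (F s))\<^sup>2) \<le> norm ((w s)\<^sup>2)"
      using F_le by eventually_elim (auto intro: power_mono)
  qed measurable
  have "(\<lambda>n. sq_norm (f (m n))) \<longlonglongrightarrow> sq_norm F"
    unfolding sq_norm_def
  proof (rule integral_dominated_convergence[OF _ _ w2])
    show "AE s in lborel. (\<lambda>n. (cmod (f (m n) s))\<^sup>2) \<longlonglongrightarrow> (cmod (F s))\<^sup>2"
      using f_lim by eventually_elim (intro tendsto_intros)
    show "AE s in lborel. norm ((cmod (f (m n) s))\<^sup>2) \<le> (w s)\<^sup>2" for n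
      using f_le by eventually_elim (auto intro: power_mono)
  qed measurable
  then have F1: "sq_norm F = 1" by (simp add: f_norm LIMSEQ_const_iff)
  have \<psi>'_eq: "\<psi>' x = (LBINT u. H (x - u) * F u)" if "x \<in> {0..R}" for x
  proof (rule LIMSEQ_unique[OF \<psi>_lim[OF that]])
    have "integrable lborel (\<lambda>u. cmod (H (x - u) * complex_of_real (w u)))"
      by (rule integrable_norm[OF square_integrable_conv_bound(1)[OF H w]])
    then show "(\<lambda>n. \<psi> (m n) x) \<longlonglongrightarrow> (LBINT u. H (x - u) * F u)"
      unfolding \<psi>_def
    proof (rule integral_dominated_convergence[rotated 2])
      show "AE u in lborel. (\<lambda>n. H (x - u) * f (m n) u) \<longlonglongrightarrow> H (x - u) * F u"
        using f_lim by eventually_elim (intro tendsto_intros)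
      show "AE u in lborel. norm (H (x - u) * f (m n) u) \<le> cmod (H (x - u) * complex_of_real (w u))" for n
        using f_le by eventually_elim (auto simp: norm_mult intro!: mult_left_mono intro: order_trans[OF _ abs_ge_self])
    qed measurable
  qed
  show False
  \<comment> \<open>The lengths may shrink to 0, a case that \<open>inj\<close> does not cover. Then
    \<open>F\<close> lives on a single point and has norm 0, against the norm 1 just found.\<close>
  proof (cases "T = 0")
    case True
    have "AE s in lborel. (cmod (F s))\<^sup>2 = 0"
      using AE_lborel_singleton[of 0] by eventually_elim (auto simp: F_def True indicator_def)
    then have "sq_norm F = 0" unfolding sq_norm_def by (rule integral_eq_zero_AE)
    then show False using F1 by simp
  next
    case False
    then have "T \<in> {0<..R}" using T(1) by auto
    then have "sq_norm F = 0"
    proof (rule inj[OF _ F F_supp])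
      fix s assume s: "s \<in> {0..T}"
      then have "s \<in> {0..R}" using T(1) by auto
      then show "F s + (LBINT u. H (s - u) * F u) = 0" using s \<psi>'_eq[of s] by (simp add: F_def)
    qed
    then show False using F1 by simp
  qed
qed

section \<open>The measure and the Hermitian form\<close>

lemma primitive_swap:
  fixes p k :: "real \<Rightarrow> complex"
  assumes p: "integrable lborel p" and k: "integrable lborel k"
  shows "(LBINT v. indicator {0..r} v * ((LBINT s. indicator {0..v} s * p s) * k v))
     = (LBINT s. indicator {0..r} s * (p s * (LBINT v. indicator {s..r} v * k v)))"
proof -
  note [measurable] = borel_measurable_integrable[OF p, simplified] borel_measurable_integrable[OF k, simplified]
  define f where "f s v = (if 0 \<le> s \<and> s \<le> v \<and> v \<le> r then p s * k v else 0)" for s v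
  have pair: "integrable (lborel \<Otimes>\<^sub>M lborel) (\<lambda>(s, v). f s v)"
    by (rule Bochner_Integration.integrable_bound[OF integrable_prod_pair[OF p k]]) (auto simp: f_def)
  have "(LBINT v. indicator {0..r} v * ((LBINT s. indicator {0..v} s * p s) * k v))
      = (LBINT v. LBINT s. f s v)"
  proof (rule Bochner_Integration.integral_cong[OF refl])
    fix v :: real
    have "indicator {0..r} v * ((LBINT s. indicator {0..v} s * p s) * k v)
       = (LBINT s. (indicator {0..r} v * k v) * (indicator {0..v} s * p s))"
      unfolding integral_mult_right_zero by (simp add: mult_ac)
    also have "\<dots> = (LBINT s. f s v)"
      by (rule Bochner_Integration.integral_cong) (auto simp: f_def indicator_def)
    finally show "indicator {0..r} v * ((LBINT s. indicator {0..v} s * p s) * k v) = (LBINT s. f s v)" .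
  qed
  also have "\<dots> = (LBINT s. LBINT v. f s v)" by (rule lborel_pair.Fubini_integral[OF pair])
  also have "\<dots> = (LBINT s. indicator {0..r} s * (p s * (LBINT v. indicator {s..r} v * k v)))"
  proof (rule Bochner_Integration.integral_cong[OF refl])
    fix s :: real
    have "(LBINT v. f s v) = (LBINT v. (indicator {0..r} s * p s) * (indicator {s..r} v * k v))"
      by (rule Bochner_Integration.integral_cong) (auto simp: f_def indicator_def)
    also have "\<dots> = indicator {0..r} s * (p s * (LBINT v. indicator {s..r} v * k v))"
      unfolding integral_mult_right_zero by (simp add: mult_ac)
    finally show "(LBINT v. f s v) = indicator {0..r} s * (p s * (LBINT v. indicator {s..r} v * k v))" .
  qed
  finally show ?thesis .
qed

section \<open>Fourier transforms of intervals and the Levy-Khintchine kernel\<close>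

lemma cis_measurable [measurable (raw)]:
  "f \<in> borel_measurable M \<Longrightarrow> (\<lambda>x. cis (f x)) \<in> borel_measurable M"
  by (rule borel_measurable_continuous_on[of cis], unfold cis_conv_exp) (intro continuous_intros)

text \<open>The Fourier transform of the indicator of \<open>[s, r]\<close>. The transform of a
  primitive of \<open>p\<close> on \<open>[0, r]\<close> is the integral of
  \<open>p s * cis_int r l s\<close> over \<open>s\<close>, which makes its decay in
  \<open>l\<close> explicit.\<close>

definition cis_int :: "real \<Rightarrow> real \<Rightarrow> real \<Rightarrow> complex" where
  "cis_int r l s = (LBINT v. indicator {s..r} v * cis (l * v))"

lemma cis_int_measurable [measurable (raw)]:
  assumes [measurable]: "f \<in> borel_measurable M" "g \<in> borel_measurable M"
  shows "(\<lambda>x. cis_int r (f x) (g x)) \<in> borel_measurable M"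
proof -
  have "indicator {a..r} v = (if a \<le> v \<and> v \<le> r then 1 else 0 :: complex)" for a v
    by (simp add: indicator_def)
  then show ?thesis unfolding cis_int_def by simp
qed

lemma cis_int_eq:
  assumes "s \<le> r"
  shows "l \<noteq> 0 \<Longrightarrow> cis_int r l s = (cis (l * r) - cis (l * s)) / (\<i> * of_real l)"
    and "cis_int r 0 s = of_real (r - s)"
proof -
  assume "l \<noteq> 0"
  have "has_bochner_integral lborel (\<lambda>v. indicator {s..r} v *\<^sub>R cis (l * v))
     (cis (l * r) / (\<i> * of_real l) - cis (l * s) / (\<i> * of_real l))"
  proof (rule has_bochner_integral_FTC_Icc[OF assms])
    fix v assume "s \<le> v" "v \<le> r"
    have "((\<lambda>z. exp (\<i> * of_real l * z) / (\<i> * of_real l)) has_field_derivative exp (\<i> * of_real l * of_real v)) (at (of_real v))"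
      using \<open>l \<noteq> 0\<close> by (auto intro!: derivative_eq_intros)
    from has_vector_derivative_real_field[OF this]
    show "((\<lambda>v. cis (l * v) / (\<i> * of_real l)) has_vector_derivative cis (l * v)) (at v within {s..r})"
      by (simp add: cis_conv_exp mult.assoc has_vector_derivative_at_within)
  qed (auto intro!: continuous_intros simp: cis_conv_exp)
  moreover have "indicator {s..r} v *\<^sub>R c = indicator {s..r} v * c" for v :: real and c :: complex
    by (simp add: indicator_def)
  ultimately have "has_bochner_integral lborel (\<lambda>v. indicator {s..r} v * cis (l * v))
     (cis (l * r) / (\<i> * of_real l) - cis (l * s) / (\<i> * of_real l))" by simp
  from has_bochner_integral_integral_eq[OF this]
  show "cis_int r l s = (cis (l * r) - cis (l * s)) / (\<i> * of_real l)"
    by (simp add: cis_int_def diff_divide_distrib)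
next
  have "(LBINT v. indicator {s..r} v :: complex) = (LBINT v. complex_of_real (indicator {s..r} v))"
    by (rule Bochner_Integration.integral_cong) (auto simp: indicator_def)
  also have "\<dots> = of_real (LBINT v. indicator {s..r} v)" by (rule integral_complex_of_real)
  also have "\<dots> = of_real (r - s)" using assms by simp
  finally show "cis_int r 0 s = of_real (r - s)" by (simp add: cis_int_def)
qed

text \<open>The product is the combination of exponentials with increments \<open>r - t\<close>,
  \<open>s - r\<close> and \<open>s - t\<close>, divided by \<open>l\<^sup>2\<close>. Since the
  first two increments add up to the third, the linear compensators of the kernel cancel and the
  constants leave a single 1. At \<open>l = 0\<close> the kernel is \<open>x\<^sup>2 / 2\<close> and
  the identity is polynomial.\<close>

lemma cis_int_mult:
  assumes "s \<le> r" "t \<le> r"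
  shows "cis_int r l s * cnj (cis_int r l t) = levy_kernel (r - t) l + levy_kernel (s - r) l - levy_kernel (s - t) l"
proof (cases "l = 0")
  case True
  have "(r - s) * (r - t) = (r - t)\<^sup>2 / 2 + (s - r)\<^sup>2 / 2 - (s - t)\<^sup>2 / 2"
    by (simp add: power2_eq_square field_simps)
  then have "complex_of_real (r - s) * of_real (r - t) = of_real ((r - t)\<^sup>2 / 2) + of_real ((s - r)\<^sup>2 / 2) - of_real ((s - t)\<^sup>2 / 2)"
    by (simp only: of_real_mult[symmetric] of_real_add[symmetric] of_real_diff[symmetric])
  then show ?thesis using cis_int_eq(2)[OF assms(1)] cis_int_eq(2)[OF assms(2)]
    by (simp add: levy_kernel_def True del: of_real_diff of_real_divide of_real_power)
next
  case False
  have L: "levy_kernel x l = (1 + \<i> * of_real (l * x / (1 + l\<^sup>2)) - cis (l * x)) / of_real (l\<^sup>2)" for x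
    using False by (simp add: levy_kernel_def cis_conv_exp)
  have lin: "of_real (l * (r - t) / (1 + l\<^sup>2)) + of_real (l * (s - r) / (1 + l\<^sup>2)) - of_real (l * (s - t) / (1 + l\<^sup>2)) = (0 :: complex)"
    unfolding of_real_add[symmetric] of_real_diff[symmetric] add_divide_distrib[symmetric] diff_divide_distrib[symmetric]
    by (simp add: algebra_simps)
  have "cis_int r l s * cnj (cis_int r l t) = (cis (l * r) - cis (l * s)) * (cis (- (l * r)) - cis (- (l * t))) / of_real (l\<^sup>2)"
    unfolding cis_int_eq(1)[OF assms(1) False] cis_int_eq(1)[OF assms(2) False]
    using False by (simp add: cis_cnj power2_eq_square divide_simps)
  also have "(cis (l * r) - cis (l * s)) * (cis (- (l * r)) - cis (- (l * t)))
     = 1 - cis (l * (r - t)) - cis (l * (s - r)) + cis (l * (s - t))"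
    unfolding left_diff_distrib right_diff_distrib cis_mult by (simp add: algebra_simps)
  also have "\<dots> / of_real (l\<^sup>2) = levy_kernel (r - t) l + levy_kernel (s - r) l - levy_kernel (s - t) l"
    unfolding L add_divide_distrib[symmetric] diff_divide_distrib[symmetric]
    using arg_cong[OF lin, of "\<lambda>x. \<i> * x"] by (simp add: algebra_simps)
  finally show ?thesis .
qed

text \<open>For \<open>\<bar>l\<bar> \<le> 1\<close> the length of the interval gives
  \<open>2 * r\<^sup>2\<close>; for larger \<open>l\<close> the explicit formula gives
  \<open>4 / l\<^sup>2\<close>, hence 8 after multiplication by \<open>1 + l\<^sup>2\<close>. The
  sum of both constants covers all \<open>l\<close>.\<close>

lemma cis_int_bound:
  assumes "0 \<le> s" "s \<le> r"
  shows "cmod (cis_int r l s) \<le> sqrt ((2 * r\<^sup>2 + 8) / (1 + l\<^sup>2))"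
proof (rule real_le_rsqrt)
  have b1: "cmod (cis_int r l s) \<le> r"
  proof -
    have "cmod (cis_int r l s) \<le> (LBINT v. cmod (indicator {s..r} v * cis (l * v)))"
      unfolding cis_int_def by (rule integral_norm_bound)
    also have "\<dots> = (LBINT v. indicator {s..r} v)"
      by (rule Bochner_Integration.integral_cong) (auto simp: norm_mult indicator_def)
    also have "\<dots> \<le> r" using assms by simp
    finally show ?thesis .
  qed
  show "(cmod (cis_int r l s))\<^sup>2 \<le> (2 * r\<^sup>2 + 8) / (1 + l\<^sup>2)"
  proof (cases "\<bar>l\<bar> \<le> 1")
    case True
    then have "l\<^sup>2 \<le> 1" by (simp add: abs_square_le_1)
    have "(cmod (cis_int r l s))\<^sup>2 * (1 + l\<^sup>2) \<le> r\<^sup>2 * 2"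
      using b1 \<open>l\<^sup>2 \<le> 1\<close> by (intro mult_mono power_mono) auto
    then show ?thesis by (simp add: pos_le_divide_eq add_pos_nonneg)
  next
    case False
    then have "l \<noteq> 0" "1 \<le> l\<^sup>2" using one_le_power[of "\<bar>l\<bar>" 2] by auto
    have "cmod (cis (l * r) - cis (l * s)) \<le> 2"
      using norm_triangle_ineq4[of "cis (l * r)" "cis (l * s)"] by simp
    then have "(cmod (cis (l * r) - cis (l * s)))\<^sup>2 \<le> 2\<^sup>2" by (rule power_mono) simp
    moreover have "(cmod (cis_int r l s))\<^sup>2 * l\<^sup>2 = (cmod (cis (l * r) - cis (l * s)))\<^sup>2"
      unfolding cis_int_eq(1)[OF assms(2) \<open>l \<noteq> 0\<close>] using \<open>l \<noteq> 0\<close>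
      by (simp add: norm_divide norm_mult power_divide)
    ultimately have "(cmod (cis_int r l s))\<^sup>2 * l\<^sup>2 \<le> 4" by simp
    moreover have "(cmod (cis_int r l s))\<^sup>2 * 1 \<le> (cmod (cis_int r l s))\<^sup>2 * l\<^sup>2"
      using \<open>1 \<le> l\<^sup>2\<close> by (rule mult_left_mono) simp
    moreover have "0 \<le> r\<^sup>2" by simp
    ultimately have "(cmod (cis_int r l s))\<^sup>2 * (1 + l\<^sup>2) \<le> 2 * r\<^sup>2 + 8"
      unfolding distrib_left mult_1_right by linarith
    then show ?thesis by (simp add: pos_le_divide_eq add_pos_nonneg)
  qed
qed

text \<open>For \<open>\<bar>l\<bar> \<le> 1\<close> the numerator splits into the second-order
  Taylor remainder of the exponential and the difference between \<open>l * x\<close> and its damped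
  version; both are of order \<open>l\<^sup>2\<close>, which compensates the denominator. For larger
  \<open>l\<close> the numerator is at most \<open>2 + \<bar>x\<bar>\<close>.\<close>

lemma levy_kernel_bound: "cmod (levy_kernel x l) \<le> (2 * x\<^sup>2 + 2 * \<bar>x\<bar> + 4) / (1 + l\<^sup>2)"
proof -
  have "cmod (levy_kernel x l) * (1 + l\<^sup>2) \<le> 2 * x\<^sup>2 + 2 * \<bar>x\<bar> + 4"
  proof (cases "l = 0")
    case True
    then show ?thesis by (simp add: levy_kernel_def norm_divide norm_power)
  next
    case False
    then have l2: "0 < l\<^sup>2" by simp
    define c where "c = cmod (1 + \<i> * of_real (l * x / (1 + l\<^sup>2)) - cis (l * x))"
    have lev: "cmod (levy_kernel x l) = c / l\<^sup>2"
      using False by (simp add: levy_kernel_def c_def cis_conv_exp norm_divide norm_power)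
    have frac: "\<bar>l * x / (1 + l\<^sup>2)\<bar> \<le> \<bar>x\<bar>"
    proof -
      have "0 \<le> (\<bar>l\<bar> - 1)\<^sup>2" by simp
      then have "2 * \<bar>l\<bar> \<le> 1 + l\<^sup>2" by (simp add: power2_diff)
      then have "\<bar>l\<bar> \<le> 1 + l\<^sup>2" using abs_ge_zero[of l] by linarith
      then have "\<bar>l\<bar> * \<bar>x\<bar> \<le> (1 + l\<^sup>2) * \<bar>x\<bar>" by (rule mult_right_mono) simp
      then show ?thesis by (simp add: abs_mult abs_divide pos_divide_le_eq add_pos_nonneg mult.commute)
    qed
    show ?thesis
    proof (cases "\<bar>l\<bar> \<le> 1")
      case True
      then have "l\<^sup>2 \<le> 1" by (simp add: abs_square_le_1)
      have "cmod (exp (\<i> * of_real (l * x)) - (\<Sum>i\<le>1. (\<i> * of_real (l * x)) ^ i / fact i))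
        \<le> exp \<bar>Re (\<i> * of_real (l * x))\<bar> * cmod (\<i> * of_real (l * x)) ^ Suc 1 / fact 1"
        by (rule Taylor_exp)
      then have t: "cmod (cis (l * x) - (1 + \<i> * of_real (l * x))) \<le> l\<^sup>2 * x\<^sup>2"
        by (simp add: cis_conv_exp norm_mult abs_mult power2_eq_square mult_ac flip: of_real_mult)
      \<comment> \<open>Replacing the linear Taylor term by the damped compensator costs only a
        further factor \<open>l\<^sup>2\<close>, which is why the compensator does not spoil the
        estimate near 0.\<close>
      have eq: "l * x - l * x / (1 + l\<^sup>2) = l\<^sup>2 * (l * x / (1 + l\<^sup>2))"
        using add_pos_nonneg[of 1 "l\<^sup>2"] by (simp add: field_simps)
      have "1 + \<i> * of_real (l * x / (1 + l\<^sup>2)) - cis (l * x)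
        = - (cis (l * x) - (1 + \<i> * of_real (l * x))) - \<i> * of_real (l * x - l * x / (1 + l\<^sup>2))"
        by (simp add: algebra_simps)
      then have "c \<le> cmod (- (cis (l * x) - (1 + \<i> * of_real (l * x)))) + cmod (\<i> * of_real (l * x - l * x / (1 + l\<^sup>2)))"
        unfolding c_def using norm_triangle_ineq4 by metis
      also have "cmod (\<i> * complex_of_real (l * x - l * x / (1 + l\<^sup>2))) = l\<^sup>2 * \<bar>l * x / (1 + l\<^sup>2)\<bar>"
        unfolding eq norm_mult norm_of_real abs_mult by simp
      also have "cmod (- (cis (l * x) - (1 + \<i> * of_real (l * x)))) + \<dots> \<le> l\<^sup>2 * x\<^sup>2 + l\<^sup>2 * \<bar>x\<bar>"
        using t frac l2 unfolding norm_minus_cancel by (intro add_mono mult_left_mono) auto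
      finally have "c / l\<^sup>2 \<le> x\<^sup>2 + \<bar>x\<bar>" using l2 by (simp add: pos_divide_le_eq algebra_simps)
      then have "c / l\<^sup>2 * (1 + l\<^sup>2) \<le> (x\<^sup>2 + \<bar>x\<bar>) * 2"
        using \<open>l\<^sup>2 \<le> 1\<close> by (intro mult_mono) auto
      then show ?thesis unfolding lev by (simp add: distrib_left mult.commute)
    next
      case False
      then have "1 \<le> l\<^sup>2" using one_le_power[of "\<bar>l\<bar>" 2] by simp
      have "c \<le> cmod (1 + \<i> * of_real (l * x / (1 + l\<^sup>2))) + 1"
        unfolding c_def using norm_triangle_ineq4[of "1 + \<i> * of_real (l * x / (1 + l\<^sup>2))" "cis (l * x)"] by simp
      also have "cmod (1 + \<i> * of_real (l * x / (1 + l\<^sup>2))) \<le> 1 + \<bar>l * x / (1 + l\<^sup>2)\<bar>"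
        using norm_triangle_ineq[of 1 "\<i> * of_real (l * x / (1 + l\<^sup>2))"] unfolding norm_mult norm_of_real by simp
      finally have "c \<le> 2 + \<bar>x\<bar>" using frac by linarith
      have "1 + l\<^sup>2 \<le> 2 * l\<^sup>2" using \<open>1 \<le> l\<^sup>2\<close> by simp
      then have "(1 + l\<^sup>2) / l\<^sup>2 \<le> 2" using l2 by (simp add: pos_divide_le_eq)
      then have "c * ((1 + l\<^sup>2) / l\<^sup>2) \<le> (2 + \<bar>x\<bar>) * 2"
        using \<open>c \<le> 2 + \<bar>x\<bar>\<close> l2 by (intro mult_mono) auto
      then have "c / l\<^sup>2 * (1 + l\<^sup>2) \<le> 2 * \<bar>x\<bar> + 4" by (simp add: algebra_simps)
      moreover have "0 \<le> 2 * x\<^sup>2" by simp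
      ultimately show ?thesis unfolding lev by linarith
    qed
  qed
  then show ?thesis by (simp add: pos_le_divide_eq add_pos_nonneg)
qed

lemma levy_kernel_measurable [measurable]: "levy_kernel x \<in> borel_measurable borel"
proof -
  have "levy_kernel x = (\<lambda>l. if l = 0 then of_real (x\<^sup>2 / 2)
      else (1 + \<i> * of_real (l * x / (1 + l\<^sup>2)) - cis (l * x)) / of_real (l\<^sup>2))"
    by (auto simp: levy_kernel_def cis_conv_exp)
  then show ?thesis by simp
qed

section \<open>Integrals against the spectral measure\<close>

locale Levy_Khintchine_measure =
  fixes \<sigma> :: "real measure"
  assumes sets_\<sigma> [measurable_cong]: "sets \<sigma> = sets borel"
    and int_\<sigma>: "integrable \<sigma> (\<lambda>l. 1 / (1 + l\<^sup>2))"
begin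

lemma space_\<sigma>: "space \<sigma> = UNIV" using sets_eq_imp_space_eq[OF sets_\<sigma>] by simp

lemma levy_kernel_integrable: "integrable \<sigma> (levy_kernel x)"
proof (rule Bochner_Integration.integrable_bound)
  show "integrable \<sigma> (\<lambda>l. (2 * x\<^sup>2 + 2 * \<bar>x\<bar> + 4) * (1 / (1 + l\<^sup>2)))" by (rule integrable_mult_right[OF int_\<sigma>])
  show "AE l in \<sigma>. norm (levy_kernel x l) \<le> norm ((2 * x\<^sup>2 + 2 * \<bar>x\<bar> + 4) * (1 / (1 + l\<^sup>2)))"
    using levy_kernel_bound by (intro AE_I2 order_trans[OF _ abs_ge_self[folded real_norm_def]]) simp
qed measurable

text \<open>Exhaustion by \<open>[-n, n]\<close>, on which \<open>1 / (1 + l\<^sup>2)\<close> is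
  bounded below. Sigma-finiteness is what Fubini between the spectral measure and
  \<open>lborel\<close> requires.\<close>

sublocale sigma_finite_measure \<sigma>
proof
  show "\<exists>A. countable A \<and> A \<subseteq> sets \<sigma> \<and> \<Union> A = space \<sigma> \<and> (\<forall>a\<in>A. emeasure \<sigma> a \<noteq> \<infinity>)"
  proof (intro exI[of _ "range (\<lambda>n::nat. {- real n..real n})"] conjI ballI)
    show "\<Union> (range (\<lambda>n::nat. {- real n..real n})) = space \<sigma>"
    proof -
      have "x \<in> \<Union> (range (\<lambda>n::nat. {- real n..real n}))" for x :: real
      proof -
        obtain n :: nat where "\<bar>x\<bar> \<le> n" using real_arch_simple by blast
        then show ?thesis by (intro UN_I[of n]) auto
      qed
      then show ?thesis by (auto simp: space_\<sigma>)
    qed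
    fix a assume "a \<in> range (\<lambda>n::nat. {- real n..real n})"
    then obtain n :: nat where a: "a = {- real n..real n}" by auto
    have "integrable \<sigma> (indicator a :: real \<Rightarrow> real)"
    proof (rule Bochner_Integration.integrable_bound)
      show "integrable \<sigma> (\<lambda>l. (1 + (real n)\<^sup>2) * (1 / (1 + l\<^sup>2)))" by (rule integrable_mult_right[OF int_\<sigma>])
      have "norm (indicator a l :: real) \<le> (1 + (real n)\<^sup>2) * (1 / (1 + l\<^sup>2))" for l :: real
      proof (cases "l \<in> a")
        case True
        then have "l\<^sup>2 \<le> (real n)\<^sup>2" unfolding a by (intro abs_le_square_iff[THEN iffD1]) auto
        then show ?thesis using True by (simp add: pos_le_divide_eq add_pos_nonneg)
      qed (simp add: add_nonneg_nonneg)
      then show "AE l in \<sigma>. norm (indicator a l :: real) \<le> norm ((1 + (real n)\<^sup>2) * (1 / (1 + l\<^sup>2)))"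
        by (intro AE_I2) (metis abs_ge_self order_trans real_norm_def)
      show "(indicator a :: real \<Rightarrow> real) \<in> borel_measurable \<sigma>" unfolding a by measurable
    qed
    then show "emeasure \<sigma> a \<noteq> \<infinity>"
      using integrable_indicator_iff[of \<sigma> a] by (simp add: space_\<sigma> less_top)
  qed (auto simp: sets_\<sigma>)
qed

sublocale pair: pair_sigma_finite \<sigma> lborel ..

end

context Levy_Khintchine_measure
begin

definition levy_potential :: "real \<Rightarrow> complex" where
  "levy_potential x = (LINT l|\<sigma>. levy_kernel x l)"

lemma integrable_pair_prod:
  fixes u :: "real \<Rightarrow> real" and p :: "real \<Rightarrow> complex"
  assumes u: "integrable \<sigma> u" and p: "integrable lborel p"
  shows "integrable (\<sigma> \<Otimes>\<^sub>M lborel) (\<lambda>(l, s). of_real (u l) * p s)"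
proof (rule pair.Fubini_integrable)
  note [measurable] = borel_measurable_integrable[OF u] borel_measurable_integrable[OF p]
  show "(\<lambda>(l, s). complex_of_real (u l) * p s) \<in> borel_measurable (\<sigma> \<Otimes>\<^sub>M lborel)" by measurable
  show "integrable \<sigma> (\<lambda>l. LBINT s. norm (case (l, s) of (l, s) \<Rightarrow> complex_of_real (u l) * p s))"
    using integrable_mult_left[OF integrable_abs[OF u], of "LBINT s. cmod (p s)"] by (simp add: norm_mult)
  show "AE l in \<sigma>. integrable lborel (\<lambda>s. case (l, s) of (l, s) \<Rightarrow> complex_of_real (u l) * p s)"
    using p by simp
qed

text \<open>The square is expanded into a double integral over \<open>s\<close> and
  \<open>t\<close>, and the measure is integrated first, where \<open>cis_int_mult\<close> produces
  the potential. The interchange is done one variable at a time: \<open>s\<close> for fixed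
  \<open>t\<close>, then \<open>t\<close> with \<open>q\<close> kept whole.\<close>

lemma transform_sq_integral:
  fixes p :: "real \<Rightarrow> complex"
  assumes p: "integrable lborel p" and supp: "\<And>s. s \<notin> {0..r} \<Longrightarrow> p s = 0"
  defines "q \<equiv> \<lambda>l. LBINT s. p s * cis_int r l s"
  shows "(LINT l|\<sigma>. q l * cnj (q l)) = (LINT t|lborel. cnj (p t) * (LINT s|lborel. p s *
      (levy_potential (r - t) + levy_potential (s - r) - levy_potential (s - t))))"
proof -
  note [measurable] = borel_measurable_integrable[OF p, simplified]
  \<comment> \<open>A single \<open>cis_int\<close> is bounded by \<open>sqrt (u l)\<close>, so the
    product of two is bounded by \<open>u l\<close>, which is integrable for the measure.\<close>
  define u where "u l = (2 * r\<^sup>2 + 8) * (1 / (1 + l\<^sup>2))" for l :: real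
  have u: "integrable \<sigma> u" unfolding u_def by (rule integrable_mult_right[OF int_\<sigma>])
  have u_nonneg: "0 \<le> u l" for l by (simp add: u_def add_nonneg_nonneg)
  have [measurable]: "u \<in> borel_measurable borel" unfolding u_def by measurable
  have A: "cmod (p s * cis_int r l s) \<le> cmod (p s) * sqrt (u l)" for s l
    using cis_int_bound[of s r l] supp[of s] by (cases "s \<in> {0..r}") (auto simp: norm_mult u_def intro!: mult_left_mono)
  define c where "c = (LBINT s. cmod (p s))"
  have pA: "integrable lborel (\<lambda>s. p s * cis_int r l s)" for l
  proof (rule Bochner_Integration.integrable_bound)
    show "integrable lborel (\<lambda>s. cmod (p s) * sqrt (u l))" using p by simp
    show "AE s in lborel. norm (p s * cis_int r l s) \<le> norm (cmod (p s) * sqrt (u l))"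
      using A u_nonneg by simp
  qed measurable
  have q_le: "cmod (q l) \<le> c * sqrt (u l)" for l
  proof -
    have "cmod (q l) \<le> (LBINT s. cmod (p s * cis_int r l s))" unfolding q_def by (rule integral_norm_bound)
    also have "\<dots> \<le> (LBINT s. cmod (p s) * sqrt (u l))"
      by (intro integral_mono integrable_norm pA A) (use p in simp)
    finally show ?thesis by (simp add: c_def)
  qed
  have q_meas [measurable]: "q \<in> borel_measurable borel" unfolding q_def by measurable
  have pair1: "integrable (\<sigma> \<Otimes>\<^sub>M lborel) (\<lambda>(l, s). p s * cis_int r l s * cnj (cis_int r l t))" if t: "t \<in> {0..r}" for t
  proof (rule Bochner_Integration.integrable_bound[OF integrable_pair_prod[OF u p]])
    have "cmod (p s * cis_int r l s * cnj (cis_int r l t)) \<le> cmod (p s) * sqrt (u l) * sqrt (u l)" for l s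
      unfolding norm_mult[of "p s * _"] complex_mod_cnj
      using cis_int_bound[of t r l] t by (intro mult_mono A) (auto simp: u_def)
    also have "cmod (p s) * sqrt (u l) * sqrt (u l) = cmod (complex_of_real (u l) * p s)" for l s
      using u_nonneg[of l] by (simp add: norm_mult)
    finally show "AE x in \<sigma> \<Otimes>\<^sub>M lborel. norm (case x of (l, s) \<Rightarrow> p s * cis_int r l s * cnj (cis_int r l t))
       \<le> norm (case x of (l, s) \<Rightarrow> complex_of_real (u l) * p s)"
      by (intro AE_I2) (simp only: split_beta)
  qed measurable
  have inner: "(LINT l|\<sigma>. q l * cnj (cis_int r l t)) = (LINT s|lborel. p s *
      (levy_potential (r - t) + levy_potential (s - r) - levy_potential (s - t)))" if t: "t \<in> {0..r}" for t
  proof -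
    have "(LINT l|\<sigma>. q l * cnj (cis_int r l t)) = (LINT l|\<sigma>. LINT s|lborel. p s * cis_int r l s * cnj (cis_int r l t))"
      by (simp add: q_def)
    also have "\<dots> = (LINT s|lborel. LINT l|\<sigma>. p s * cis_int r l s * cnj (cis_int r l t))"
      by (rule pair.Fubini_integral[OF pair1[OF t], symmetric])
    also have "\<dots> = (LBINT s. p s * (levy_potential (r - t) + levy_potential (s - r) - levy_potential (s - t)))"
    proof (rule Bochner_Integration.integral_cong[OF refl])
      fix s
      show "(LINT l|\<sigma>. p s * cis_int r l s * cnj (cis_int r l t)) = p s * (levy_potential (r - t) + levy_potential (s - r) - levy_potential (s - t))"
      proof (cases "s \<in> {0..r}")
        case True
        have "(LINT l|\<sigma>. p s * cis_int r l s * cnj (cis_int r l t))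
            = (LINT l|\<sigma>. p s * (levy_kernel (r - t) l + levy_kernel (s - r) l - levy_kernel (s - t) l))"
          using cis_int_mult[of s r t] True t by (simp add: mult.assoc)
        also have "\<dots> = p s * (LINT l|\<sigma>. levy_kernel (r - t) l + levy_kernel (s - r) l - levy_kernel (s - t) l)"
          by (rule integral_mult_right_zero)
        finally show ?thesis by (simp add: levy_kernel_integrable levy_potential_def)
      qed (simp add: supp)
    qed
    finally show ?thesis .
  qed
  have pair2: "integrable (\<sigma> \<Otimes>\<^sub>M lborel) (\<lambda>(l, t). q l * cnj (p t * cis_int r l t))"
  proof (rule Bochner_Integration.integrable_bound)
    show "integrable (\<sigma> \<Otimes>\<^sub>M lborel) (\<lambda>(l, t). complex_of_real (c * u l) * p t)"
      by (rule integrable_pair_prod[OF integrable_mult_right[OF u] p])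
    have "cmod (q l * cnj (p t * cis_int r l t)) \<le> (c * sqrt (u l)) * (cmod (p t) * sqrt (u l))" for l t
      unfolding norm_mult[of "q l"] complex_mod_cnj using u_nonneg[of l] by (intro mult_mono A q_le) (auto simp: c_def)
    also have "(c * sqrt (u l)) * (cmod (p t) * sqrt (u l)) = cmod (complex_of_real (c * u l) * p t)" for l t
    proof -
      have "0 \<le> c" by (simp add: c_def)
      then have "cmod (complex_of_real (c * u l) * p t) = c * (sqrt (u l) * sqrt (u l)) * cmod (p t)"
        using u_nonneg[of l] by (simp add: norm_mult)
      then show ?thesis by (simp only: mult_ac)
    qed
    finally show "AE x in \<sigma> \<Otimes>\<^sub>M lborel. norm (case x of (l, t) \<Rightarrow> q l * cnj (p t * cis_int r l t))
       \<le> norm (case x of (l, t) \<Rightarrow> complex_of_real (c * u l) * p t)"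
      by (intro AE_I2) (simp only: split_beta)
  qed measurable
  have "(LINT l|\<sigma>. q l * cnj (q l)) = (LINT l|\<sigma>. LINT t|lborel. q l * cnj (p t * cis_int r l t))"
  proof (rule Bochner_Integration.integral_cong[OF refl])
    fix l
    have "cnj (q l) = (LBINT t. cnj (p t * cis_int r l t))" unfolding q_def by (rule Bochner_Integration.integral_cnj[symmetric])
    then show "q l * cnj (q l) = (LBINT t. q l * cnj (p t * cis_int r l t))" by (simp only: integral_mult_right_zero)
  qed
  also have "\<dots> = (LINT t|lborel. LINT l|\<sigma>. q l * cnj (p t * cis_int r l t))"
    by (rule pair.Fubini_integral[OF pair2, symmetric])
  also have "\<dots> = (LBINT t. cnj (p t) * (LBINT s. p s *
      (levy_potential (r - t) + levy_potential (s - r) - levy_potential (s - t))))"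
  proof (rule Bochner_Integration.integral_cong[OF refl])
    fix t
    show "(LINT l|\<sigma>. q l * cnj (p t * cis_int r l t)) = cnj (p t) * (LINT s|lborel. p s *
      (levy_potential (r - t) + levy_potential (s - r) - levy_potential (s - t)))"
    proof (cases "t \<in> {0..r}")
      case True
      have "(LINT l|\<sigma>. q l * cnj (p t * cis_int r l t)) = (LINT l|\<sigma>. cnj (p t) * (q l * cnj (cis_int r l t)))"
        by (simp add: mult_ac)
      also have "\<dots> = cnj (p t) * (LINT l|\<sigma>. q l * cnj (cis_int r l t))" by (rule integral_mult_right_zero)
      finally show ?thesis using inner[OF True] by simp
    qed (simp add: supp)
  qed
  finally show ?thesis .
qed

end

section \<open>The second primitive of the accelerant and its second differences\<close>

text \<open>The kernel of the second primitive: the oriented integral of \<open>(x - u) * H u\<close> over \<open>u\<close> from \<open>0\<close> to \<open>x\<close>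
  equals the integral of \<open>H u * primitive2 x u\<close>, for either sign of \<open>x\<close>.\<close>
definition primitive2 :: "real \<Rightarrow> real \<Rightarrow> real" where
  "primitive2 x u = (if 0 \<le> u \<and> u \<le> x \<or> x \<le> u \<and> u < 0 then \<bar>x - u\<bar> else 0)"

text \<open>The right-hand side is the length of the intersection of \<open>[s, r]\<close> with
  \<open>[t + u, r + u]\<close>, the correlation of two indicators at shift
  \<open>u\<close>.\<close>

lemma primitive2_second_difference:
  assumes "s \<le> r" "t \<le> r"
  shows "primitive2 (r - t) u + primitive2 (s - r) u - primitive2 (s - t) u = max 0 (min r (r + u) - max s (t + u))"
  using assms by (auto simp: primitive2_def max_def min_def abs_if)

lemma primitive2_measurable [measurable]: "primitive2 x \<in> borel_measurable borel"
  unfolding primitive2_def by measurable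

lemma primitive2_mult_integrable:
  fixes H :: "real \<Rightarrow> complex"
  assumes "integrable lborel H" shows "integrable lborel (\<lambda>u. H u * of_real (primitive2 x u))"
proof (rule Bochner_Integration.integrable_bound)
  note [measurable] = borel_measurable_integrable[OF assms, simplified]
  show "integrable lborel (\<lambda>u. of_real \<bar>x\<bar> * H u)" using assms by simp
  have "\<bar>primitive2 x u\<bar> \<le> \<bar>x\<bar>" for u by (auto simp: primitive2_def)
  from mult_left_mono[OF this norm_ge_zero] have "cmod (H u) * \<bar>primitive2 x u\<bar> \<le> cmod (H u) * \<bar>x\<bar>" for u .
  then show "AE u in lborel. norm (H u * of_real (primitive2 x u)) \<le> norm (of_real \<bar>x\<bar> * H u)"
    by (simp add: norm_mult mult.commute)
  show "(\<lambda>u. H u * of_real (primitive2 x u)) \<in> borel_measurable lborel" by measurable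
qed

text \<open>Formally the second derivative of \<open>K\<close> is a point mass at 0 plus
  \<open>H\<close>, the kernel of identity plus convolution. Its second differences are therefore
  the values of the corresponding form on indicators of \<open>[s, r]\<close> and
  \<open>[t, r]\<close>. The proof compares, for each \<open>u\<close>, the weight with which
  \<open>H u\<close> enters both sides.\<close>

lemma second_difference:
  fixes H :: "real \<Rightarrow> complex"
  assumes H: "integrable lborel H" and st: "s \<in> {0..r}" "t \<in> {0..r}"
  defines "K \<equiv> \<lambda>x. of_real (\<bar>x\<bar> / 2) + (LBINT u. H u * of_real (primitive2 x u))"
  shows "K (r - t) + K (s - r) - K (s - t)
    = (LBINT v. indicator {s..r} v * (indicator {t..r} v + (LBINT w. indicator {t..r} w * H (v - w))))"
proof -
  note [measurable] = borel_measurable_integrable[OF H, simplified]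
  have ind: "integrable lborel (\<lambda>v. indicator {a..c} v :: complex)" for a c :: real
  proof -
    have "(\<lambda>v. complex_of_real (indicator {a..c} v)) = (\<lambda>v. indicator {a..c} v)" by (auto simp: indicator_def)
    then show ?thesis using square_integrable_imp_integrable[OF square_integrable_indicator[of a c], of a c] by simp
  qed
  have int_ind: "(LBINT v. indicator {a..c} v :: complex) = of_real (max 0 (c - a))" for a c :: real
  proof -
    have "(LBINT v. indicator {a..c} v :: complex) = (LBINT v. complex_of_real (indicator {a..c} v))"
      by (rule Bochner_Integration.integral_cong) (auto simp: indicator_def)
    also have "\<dots> = of_real (LBINT v. indicator {a..c} v)" by (rule integral_complex_of_real)
    also have "(LBINT v. indicator {a..c} v) = max 0 (c - a)" by (simp add: max_def)
    finally show ?thesis .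
  qed
  define f where "f v u = indicator {s..r} v * (indicator {t..r} (v - u) * H u)" for v u
  have pair: "integrable (lborel \<Otimes>\<^sub>M lborel) (\<lambda>(v, u). f v u)"
  proof (rule Bochner_Integration.integrable_bound[OF integrable_prod_pair[OF ind[of s r] H]])
    show "(\<lambda>(v, u). f v u) \<in> borel_measurable (lborel \<Otimes>\<^sub>M lborel)" unfolding f_def by measurable
  qed (auto simp: f_def norm_mult indicator_def)
  have inner1: "indicator {s..r} v * (LBINT w. indicator {t..r} w * H (v - w)) = (LBINT u. f v u)" for v
  proof -
    have "(LBINT w. indicator {t..r} w * H (v - w)) = (LBINT u. indicator {t..r} (v - u) * H u)"
      using integral_reflect(1)[of "\<lambda>w. indicator {t..r} w * H (v - w)" v] by simp
    then show ?thesis by (simp add: f_def)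
  qed
  have inner2: "(LBINT v. f v u) = H u * of_real (primitive2 (r - t) u) + H u * of_real (primitive2 (s - r) u) - H u * of_real (primitive2 (s - t) u)" for u
  proof -
    have "(LBINT v. f v u) = (LBINT v. H u * indicator {max s (t + u)..min r (r + u)} v)"
      by (rule Bochner_Integration.integral_cong) (auto simp: f_def indicator_def)
    also have "\<dots> = H u * of_real (max 0 (min r (r + u) - max s (t + u)))"
      unfolding integral_mult_right_zero int_ind ..
    also have "\<dots> = H u * of_real (primitive2 (r - t) u + primitive2 (s - r) u - primitive2 (s - t) u)"
      using primitive2_second_difference[of s r t u] st by simp
    finally show ?thesis by (simp add: algebra_simps)
  qed
  have "(LBINT v. indicator {s..r} v * (indicator {t..r} v + (LBINT w. indicator {t..r} w * H (v - w))))
     = (LBINT v. indicator {max s t..r} v + (LBINT u. f v u))"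
    unfolding inner1[symmetric] by (rule Bochner_Integration.integral_cong) (auto simp: indicator_def)
  also have "\<dots> = (LBINT v. indicator {max s t..r} v) + (LBINT v. LBINT u. f v u)"
    by (rule Bochner_Integration.integral_add[OF ind lborel_pair.integrable_fst[OF pair]])
  also have "(LBINT v. LBINT u. f v u) = (LBINT u. LBINT v. f v u)"
    by (rule lborel_pair.Fubini_integral[OF pair, symmetric])
  also have "\<dots> = (LBINT u. H u * of_real (primitive2 (r - t) u)) + (LBINT u. H u * of_real (primitive2 (s - r) u))
      - (LBINT u. H u * of_real (primitive2 (s - t) u))"
    unfolding inner2 by (simp add: primitive2_mult_integrable[OF H])
  also have "(LBINT v. indicator {max s t..r} v) = complex_of_real (\<bar>r - t\<bar> / 2) + of_real (\<bar>s - r\<bar> / 2) - of_real (\<bar>s - t\<bar> / 2)"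
  proof -
    have "max 0 (r - max s t) = \<bar>r - t\<bar> / 2 + \<bar>s - r\<bar> / 2 - \<bar>s - t\<bar> / 2"
      using st by (auto simp: max_def abs_if field_simps)
    then show ?thesis unfolding int_ind by (simp only: of_real_add of_real_diff)
  qed
  finally show ?thesis unfolding K_def by simp
qed

section \<open>The form of identity plus convolution on absolutely continuous functions\<close>

locale hermitian_convolution =
  fixes r :: real and H :: "real \<Rightarrow> complex"
  assumes r: "0 < r" and H: "square_integrable H" and H_supp: "\<And>x. x \<notin> {-r..r} \<Longrightarrow> H x = 0"
    and H_herm: "\<And>x. H (- x) = cnj (H x)"
begin

lemma H_measurable [measurable]: "H \<in> borel_measurable borel"
  using H by (rule square_integrable_measurable)

lemma H_integrable: "integrable lborel H"
  using square_integrable_imp_integrable[OF H H_supp] by simp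

text \<open>The difference \<open>v - w\<close> is opposite to that in
  \<open>accelerant_operator\<close>, which amounts to conjugating the kernel. The resolvent
  equation takes this form after the reflection \<open>\<gamma> v = G r (r - v)\<close>, and so does
  the form obtained from the measure in \<open>form_eq\<close>.\<close>

definition conv :: "(real \<Rightarrow> complex) \<Rightarrow> real \<Rightarrow> complex" where
  "conv f w = (LBINT v. f v * H (v - w))"

lemma conv_int: "square_integrable f \<Longrightarrow> integrable lborel (\<lambda>v. f v * H (v - w))"
  by (intro square_integrable_mult(1) square_integrable_translate(1) H)

lemma conv_bound: "square_integrable f \<Longrightarrow> cmod (conv f w) \<le> sqrt (sq_norm f * sq_norm H)"
  unfolding conv_def using square_integrable_mult(3)[OF _ square_integrable_translate(1)[OF H], of f w]
  by (intro real_le_rsqrt) (simp add: square_integrable_translate(2)[OF H])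

lemma conv_measurable [measurable]:
  assumes [measurable]: "f \<in> borel_measurable borel" shows "conv f \<in> borel_measurable borel"
  unfolding conv_def by measurable

lemma H_reflect: "cnj (H (x - y)) = H (y - x)"
  using H_herm[of "x - y"] by simp

lemma conv_mult_integrable:
  assumes f: "integrable lborel f" and g: "square_integrable g"
  shows "integrable lborel (\<lambda>w. f w * conv g w)"
proof (rule Bochner_Integration.integrable_bound)
  note [measurable] = borel_measurable_integrable[OF f, simplified] square_integrable_measurable[OF g]
  show "integrable lborel (\<lambda>w. of_real (sqrt (sq_norm g * sq_norm H)) * f w)" using f by simp
  from mult_left_mono[OF conv_bound[OF g] norm_ge_zero]
  have "cmod (f w) * cmod (conv g w) \<le> cmod (f w) * sqrt (sq_norm g * sq_norm H)" for w .
  then show "AE w in lborel. norm (f w * conv g w) \<le> norm (of_real (sqrt (sq_norm g * sq_norm H)) * f w)"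
    by (simp add: norm_mult mult.commute)
  show "(\<lambda>w. f w * conv g w) \<in> borel_measurable lborel" by measurable
qed

lemma pair_integrable:
  assumes f: "integrable lborel f" and g: "square_integrable g"
  shows "integrable (lborel \<Otimes>\<^sub>M lborel) (\<lambda>(w, v). f w * (H (v - w) * g v))"
proof -
  have "integrable (lborel \<Otimes>\<^sub>M lborel) (\<lambda>(w, v). f w * (cnj (H (w - v)) * g v))"
    by (rule integrable_triple[OF f square_integrable_cnj[OF H] g])
  then show ?thesis by (simp add: H_reflect)
qed

lemma conv_symmetric:
  assumes f: "square_integrable f" "integrable lborel f" and g: "square_integrable g" "integrable lborel g"
  shows "(LBINT w. cnj (f w) * conv g w) = cnj (LBINT w. cnj (g w) * conv f w)"
proof -
  note pair = pair_integrable[OF integrable_cnj[OF f(2)] g(1)]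
  have "(LBINT w. cnj (f w) * conv g w) = (LBINT w. LBINT v. cnj (f w) * (H (v - w) * g v))"
    unfolding conv_def integral_mult_right_zero by (simp add: mult.commute)
  also have "\<dots> = (LBINT v. LBINT w. cnj (f w) * (H (v - w) * g v))"
    by (rule lborel_pair.Fubini_integral[OF pair, symmetric])
  also have "\<dots> = (LBINT v. cnj (cnj (g v) * conv f v))"
  proof (rule Bochner_Integration.integral_cong[OF refl])
    fix v
    have "(LBINT w. cnj (f w) * (H (v - w) * g v)) = (LBINT w. g v * cnj (f w * H (w - v)))"
      by (simp add: H_reflect mult_ac)
    also have "\<dots> = g v * cnj (conv f v)"
      unfolding integral_mult_right_zero Bochner_Integration.integral_cnj conv_def ..
    finally show "(LBINT w. cnj (f w) * (H (v - w) * g v)) = cnj (cnj (g v) * conv f v)" by simp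
  qed
  finally show ?thesis by (simp only: Bochner_Integration.integral_cnj)
qed

end

locale AC_form = hermitian_convolution +
  fixes p :: "real \<Rightarrow> complex"
  assumes p: "square_integrable p" and p_supp: "\<And>x. x \<notin> {0..r} \<Longrightarrow> p x = 0"
begin

lemma p_integrable: "integrable lborel p"
  using square_integrable_imp_integrable[OF p p_supp] by simp

lemma p_measurable [measurable]: "p \<in> borel_measurable borel"
  using p by (rule square_integrable_measurable)

text \<open>The cutoff lets \<open>\<phi>\<close> jump to 0 at \<open>r\<close>. That jump causes
  the boundary terms with \<open>\<phi> r\<close> in the identities below.\<close>

definition \<phi> :: "real \<Rightarrow> complex" where
  "\<phi> v = indicator {0..r} v * (LBINT s. indicator {0..v} s * p s)"

lemma \<phi>_measurable [measurable]: "\<phi> \<in> borel_measurable borel"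
  unfolding \<phi>_def using measurable_primitive[OF p_measurable] by measurable

lemma \<phi>_supp: "v \<notin> {0..r} \<Longrightarrow> \<phi> v = 0"
  by (simp add: \<phi>_def)

lemma \<phi>_bound: "cmod (\<phi> v) \<le> (LBINT s. cmod (p s))"
proof -
  have "cmod (LBINT s. indicator {0..v} s * p s) \<le> (LBINT s. cmod (p s))"
    by (rule L1_bound_integral(2)[OF p_integrable]) (auto simp: indicator_def)
  then show ?thesis by (cases "v \<in> {0..r}") (simp_all add: \<phi>_def)
qed

lemma \<phi>_square_integrable: "square_integrable \<phi>"
  by (rule square_integrable_bounded[OF _ \<phi>_supp \<phi>_bound]) measurable

lemma \<phi>_integrable: "integrable lborel \<phi>"
  using square_integrable_imp_integrable[OF \<phi>_square_integrable \<phi>_supp] by simp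

lemma \<phi>_0: "\<phi> 0 = 0"
proof -
  have "AE s in lborel. indicator {0..0} s * p s = 0"
    using AE_lborel_singleton[of 0] by eventually_elim (auto simp: indicator_def)
  then have "(LBINT s. indicator {0..0} s * p s) = 0" by (rule integral_eq_zero_AE)
  then show ?thesis by (simp add: \<phi>_def)
qed

lemma \<phi>_AC: "x \<in> {0..r} \<Longrightarrow> \<phi> x = \<phi> 0 + (LBINT s. indicator {0..x} s * p s)"
  unfolding \<phi>_0 by (simp add: \<phi>_def)

lemma \<phi>_r: "\<phi> r = (LBINT s. p s)"
proof -
  have "(LBINT s. indicator {0..r} s * p s) = (LBINT s. p s)"
    by (rule Bochner_Integration.integral_cong) (use p_supp in \<open>auto simp: indicator_def\<close>)
  then show ?thesis using r by (simp add: \<phi>_def)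
qed

lemma \<phi>_swap:
  assumes k: "integrable lborel k"
  shows "(LBINT v. \<phi> v * k v) = (LBINT s. p s * (LBINT v. indicator {s..r} v * k v))"
proof -
  have "(LBINT v. \<phi> v * k v) = (LBINT v. indicator {0..r} v * ((LBINT s. indicator {0..v} s * p s) * k v))"
    by (simp add: \<phi>_def mult.assoc)
  also have "\<dots> = (LBINT s. indicator {0..r} s * (p s * (LBINT v. indicator {s..r} v * k v)))"
    by (rule primitive_swap[OF p_integrable k])
  also have "\<dots> = (LBINT s. p s * (LBINT v. indicator {s..r} v * k v))"
    by (rule Bochner_Integration.integral_cong) (use p_supp in \<open>auto simp: indicator_def\<close>)
  finally show ?thesis .
qed

lemma \<phi>_swap':
  assumes k: "integrable lborel (\<lambda>v. indicator {0..r} v * k v)"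
  shows "(LBINT v. \<phi> v * k v) = (LBINT s. p s * (LBINT v. indicator {s..r} v * k v))"
proof -
  have "(LBINT v. \<phi> v * k v) = (LBINT v. \<phi> v * (indicator {0..r} v * k v))"
    by (rule Bochner_Integration.integral_cong) (use \<phi>_supp in \<open>auto simp: indicator_def\<close>)
  also have "\<dots> = (LBINT s. p s * (LBINT v. indicator {s..r} v * (indicator {0..r} v * k v)))"
    by (rule \<phi>_swap[OF k])
  also have "\<dots> = (LBINT s. p s * (LBINT v. indicator {s..r} v * k v))"
  proof (rule Bochner_Integration.integral_cong[OF refl])
    fix s
    show "p s * (LBINT v. indicator {s..r} v * (indicator {0..r} v * k v)) = p s * (LBINT v. indicator {s..r} v * k v)"
    proof (cases "s \<in> {0..r}")
      case True
      then have "indicator {s..r} v * (indicator {0..r} v * k v) = indicator {s..r} v * k v" for v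
        by (auto simp: indicator_def)
      then show ?thesis by (simp only:)
    qed (simp add: p_supp)
  qed
  finally show ?thesis .
qed

lemma \<phi>_transform: "(LBINT s. p s * cis_int r l s) = (LBINT v. \<phi> v * cis (l * v))"
proof -
  have "integrable lborel (\<lambda>v. indicator {0..r} v * cis (l * v))"
    by (rule bounded_integrable[of _ 0 r 1])
      (auto simp: norm_mult indicator_def)
  from \<phi>_swap'[OF this] show ?thesis by (simp add: cis_int_def)
qed

definition form :: complex where
  "form = (LBINT w. cnj (\<phi> w) * (\<phi> w + conv \<phi> w))"

text \<open>Integrating \<open>p s\<close> against the indicator of \<open>[s, r]\<close> produces
  \<open>\<phi>\<close>, as in \<open>\<phi>_swap'\<close>. This is applied in the variable
  \<open>s\<close> and then, conjugated, in \<open>t\<close>.\<close>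

lemma form_eq:
  assumes U: "\<And>s t. s \<in> {0..r} \<Longrightarrow> t \<in> {0..r} \<Longrightarrow> U s t =
      (LBINT v. indicator {s..r} v * (indicator {t..r} v + (LBINT w. indicator {t..r} w * H (v - w))))"
  shows "(LBINT t. cnj (p t) * (LBINT s. p s * U s t)) = form"
proof -
  have indc: "square_integrable (\<lambda>w. indicator {t..r} w :: complex)" for t
    by (rule square_integrable_bounded[of _ t r 1]) (auto simp: indicator_def)
  define k where "k w = \<phi> w + conv \<phi> w" for w
  have [measurable]: "k \<in> borel_measurable borel" unfolding k_def by measurable
  have k_le: "cmod (k w) \<le> (LBINT s. cmod (p s)) + sqrt (sq_norm \<phi> * sq_norm H)" for w
    unfolding k_def using \<phi>_bound[of w] conv_bound[OF \<phi>_square_integrable, of w] norm_triangle_ineq[of "\<phi> w" "conv \<phi> w"] by linarith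
  have k_int: "integrable lborel (\<lambda>w. indicator {0..r} w * cnj (k w))"
    by (rule bounded_integrable[of _ 0 r "(LBINT s. cmod (p s)) + sqrt (sq_norm \<phi> * sq_norm H)"])
      (use k_le order_trans[OF norm_ge_zero k_le] in \<open>auto simp: norm_mult indicator_def\<close>)
  have inner: "(LBINT s. p s * U s t) = (LBINT w. indicator {t..r} w * k w)" if t: "t \<in> {0..r}" for t
  proof -
    define h where "h v = indicator {t..r} v + (LBINT w. indicator {t..r} w * H (v - w))" for v
    note Ht = square_integrable_conv_bound[OF H indc[of t]]
    have comm: "(LBINT w. indicator {t..r} w * H (v - w)) = (LBINT w. H (v - w) * indicator {t..r} w)" for v
      by (simp add: mult.commute)
    have h_meas [measurable]: "h \<in> borel_measurable borel" unfolding h_def by measurable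
    have h_le: "cmod (h v) \<le> 1 + sqrt (sq_norm H * sq_norm (\<lambda>w. indicator {t..r} w))" for v
    proof -
      have "cmod (h v) \<le> cmod (indicator {t..r} v) + cmod (LBINT w. indicator {t..r} w * H (v - w))"
        unfolding h_def by (rule norm_triangle_ineq)
      also have "\<dots> \<le> 1 + sqrt (sq_norm H * sq_norm (\<lambda>w. indicator {t..r} w))"
        unfolding comm by (intro add_mono Ht(3)) (auto simp: indicator_def)
      finally show ?thesis .
    qed
    have h_int: "integrable lborel (\<lambda>v. indicator {0..r} v * h v)"
      by (rule bounded_integrable[of _ 0 r "1 + sqrt (sq_norm H * sq_norm (\<lambda>w. indicator {t..r} w))"])
        (use h_le order_trans[OF norm_ge_zero h_le] in \<open>auto simp: norm_mult indicator_def\<close>)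
    have i1: "integrable lborel (\<lambda>v. \<phi> v * indicator {t..r} v)"
      using indicator_integrable[OF \<phi>_integrable, of t r] by (simp add: mult.commute)
    have "(LBINT s. p s * U s t) = (LBINT s. p s * (LBINT v. indicator {s..r} v * h v))"
      by (rule Bochner_Integration.integral_cong) (use U[OF _ t] p_supp in \<open>auto simp: h_def\<close>)
    also have "\<dots> = (LBINT v. \<phi> v * h v)" by (rule \<phi>_swap'[OF h_int, symmetric])
    also have "\<dots> = (LBINT v. \<phi> v * indicator {t..r} v + (LBINT w. \<phi> v * (H (v - w) * indicator {t..r} w)))"
      unfolding h_def comm integral_mult_right_zero distrib_left ..
    also have "\<dots> = (LBINT v. \<phi> v * indicator {t..r} v) + (LBINT v. LBINT w. \<phi> v * (H (v - w) * indicator {t..r} w))"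
      by (intro Bochner_Integration.integral_add i1 lborel_pair.integrable_fst integrable_triple \<phi>_integrable H indc)
    also have "(LBINT v. LBINT w. \<phi> v * (H (v - w) * indicator {t..r} w)) = (LBINT w. LBINT v. \<phi> v * (H (v - w) * indicator {t..r} w))"
      by (intro lborel_pair.Fubini_integral[symmetric] integrable_triple \<phi>_integrable H indc)
    also have "\<dots> = (LBINT w. indicator {t..r} w * conv \<phi> w)"
    proof (rule Bochner_Integration.integral_cong[OF refl])
      fix w
      have "(LBINT v. \<phi> v * (H (v - w) * indicator {t..r} w)) = (LBINT v. indicator {t..r} w * (\<phi> v * H (v - w)))"
        by (simp add: mult_ac)
      also have "\<dots> = indicator {t..r} w * conv \<phi> w" unfolding integral_mult_right_zero conv_def ..
      finally show "(LBINT v. \<phi> v * (H (v - w) * indicator {t..r} w)) = indicator {t..r} w * conv \<phi> w" .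
    qed
    also have "(LBINT v. \<phi> v * indicator {t..r} v) + \<dots> = (LBINT w. \<phi> w * indicator {t..r} w + indicator {t..r} w * conv \<phi> w)"
    proof (rule Bochner_Integration.integral_add[OF i1, symmetric])
      have "integrable lborel (\<lambda>w. indicator {t..r} w :: complex)"
        by (rule bounded_integrable[of _ t r 1]) (auto simp: indicator_def)
      then show "integrable lborel (\<lambda>w. indicator {t..r} w * conv \<phi> w)"
        by (rule conv_mult_integrable[OF _ \<phi>_square_integrable])
    qed
    finally show ?thesis by (simp add: k_def distrib_left mult.commute)
  qed
  have "(LBINT t. cnj (p t) * (LBINT s. p s * U s t)) = (LBINT t. cnj (p t * (LBINT w. indicator {t..r} w * cnj (k w))))"
  proof (rule Bochner_Integration.integral_cong[OF refl])
    fix t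
    have "cnj (LBINT w. indicator {t..r} w * cnj (k w)) = (LBINT w. cnj (indicator {t..r} w * cnj (k w)))"
      by (rule Bochner_Integration.integral_cnj[symmetric])
    also have "\<dots> = (LBINT w. indicator {t..r} w * k w)"
      by (rule Bochner_Integration.integral_cong) (auto simp: indicator_def)
    finally show "cnj (p t) * (LBINT s. p s * U s t) = cnj (p t * (LBINT w. indicator {t..r} w * cnj (k w)))"
      using inner[of t] p_supp[of t] by (cases "t \<in> {0..r}") simp_all
  qed
  also have "\<dots> = cnj (LBINT w. \<phi> w * cnj (k w))"
    unfolding Bochner_Integration.integral_cnj \<phi>_swap'[OF k_int] ..
  also have "\<dots> = (LBINT w. cnj (\<phi> w * cnj (k w)))" by (rule Bochner_Integration.integral_cnj[symmetric])
  also have "\<dots> = form" by (simp add: form_def k_def)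
  finally show ?thesis .
qed

text \<open>\<open>H\<close> has no derivative, so differentiation of the convolution has to fall on
  \<open>\<phi>\<close>. It gives the convolution of \<open>p\<close> and a boundary term from the
  jump at \<open>r\<close>; the one at 0 is absent because \<open>\<phi> 0 = 0\<close>.\<close>

lemma conv_\<phi>_AC:
  assumes v: "v \<in> {0..r}"
  shows "conv \<phi> v = conv \<phi> 0 + (LBINT x. indicator {0..v} x * (conv p x - \<phi> r * H (r - x)))"
    and "integrable lborel (\<lambda>x. indicator {0..v} x * (conv p x - \<phi> r * H (r - x)))"
proof -
  define a where "a t x = (LBINT w. indicator {t..r} w * H (w - x))" for t x
  have Hx: "integrable lborel (\<lambda>w. H (w - x))" for x using H_integrable by (simp add: integral_translate)
  have HR: "integrable lborel (\<lambda>x. H (y - x))" for y using H_integrable by (simp add: integral_reflect)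
  have iv: "integrable lborel (\<lambda>x. indicator {0..v} x :: complex)" "square_integrable (\<lambda>x. indicator {0..v} x :: complex)"
    using square_integrable_imp_integrable[of "\<lambda>x. indicator {0..v} x" 0 v] square_integrable_bounded[of "\<lambda>x. indicator {0..v} x" 0 v 1]
    by (auto simp: indicator_def)
  have conv_eq: "conv \<phi> x = (LBINT t. p t * a t x)" for x
    unfolding conv_def a_def by (rule \<phi>_swap[OF Hx])
  \<comment> \<open>As \<open>x\<close> grows from 0 to \<open>v\<close>, the window
    \<open>[t - x, r - x]\<close> slides to the left: \<open>[t - v, t]\<close> enters and
    \<open>[r - v, r]\<close> leaves. The indicators disagree with this only at the end points
    \<open>t\<close> and \<open>r - v\<close>.\<close>
  have a_diff: "a t v - a t 0 = (LBINT x. indicator {0..v} x * H (t - x)) - (LBINT x. indicator {0..v} x * H (r - x))"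
    if t: "t \<in> {0..r}" for t
  proof -
    have iH: "integrable lborel (\<lambda>u. indicator {c..d} u * H u)" for c d by (rule indicator_integrable[OF H_integrable])
    have a: "a t x = (LBINT u. indicator {t - x..r - x} u * H u)" for x
    proof -
      have "a t x = (LBINT w. indicator {t - x..r - x} (w - x) * H (w - x))"
        unfolding a_def by (rule Bochner_Integration.integral_cong) (auto simp: indicator_def)
      also have "\<dots> = (LBINT u. indicator {t - x..r - x} u * H u)"
        by (rule integral_translate(1)[of "\<lambda>u. indicator {t - x..r - x} u * H u"])
      finally show ?thesis .
    qed
    have c: "(LBINT x. indicator {0..v} x * H (y - x)) = (LBINT u. indicator {y - v..y} u * H u)" for y
    proof -
      have "(LBINT x. indicator {0..v} x * H (y - x)) = (LBINT x. indicator {y - v..y} (y - x) * H (y - x))"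
        by (rule Bochner_Integration.integral_cong) (auto simp: indicator_def)
      also have "\<dots> = (LBINT u. indicator {y - v..y} u * H u)"
        by (rule integral_reflect(1)[of "\<lambda>u. indicator {y - v..y} u * H u"])
      finally show ?thesis .
    qed
    have "(LBINT u. indicator {t - v..r - v} u * H u - indicator {t..r} u * H u)
       = (LBINT u. indicator {t - v..t} u * H u - indicator {r - v..r} u * H u)"
    proof (rule integral_cong_AE)
      show "AE u in lborel. indicator {t - v..r - v} u * H u - indicator {t..r} u * H u = indicator {t - v..t} u * H u - indicator {r - v..r} u * H u"
        using AE_lborel_singleton[of t] AE_lborel_singleton[of "r - v"]
        by eventually_elim (use t v in \<open>auto simp: indicator_def\<close>)
    qed measurable
    then show ?thesis unfolding a c by (simp add: Bochner_Integration.integral_diff[OF iH iH])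
  qed
  have pairs: "integrable (lborel \<Otimes>\<^sub>M lborel) (\<lambda>(x, t). indicator {0..v} x * (H (t - x) * p t))"
    by (rule pair_integrable[OF iv(1) p])
  have p1: "integrable lborel (\<lambda>x. indicator {0..v} x * conv p x)"
    by (rule conv_mult_integrable[OF iv(1) p])
  have p2: "integrable lborel (\<lambda>x. \<phi> r * (indicator {0..v} x * H (r - x)))"
    by (intro integrable_mult_right indicator_integrable HR)
  have eq: "indicator {0..v} x * (conv p x - \<phi> r * H (r - x)) = indicator {0..v} x * conv p x - \<phi> r * (indicator {0..v} x * H (r - x))" for x
    by (simp add: algebra_simps)
  show "integrable lborel (\<lambda>x. indicator {0..v} x * (conv p x - \<phi> r * H (r - x)))"
    unfolding eq by (rule Bochner_Integration.integrable_diff[OF p1 p2])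
  have c1: "(LBINT x. indicator {0..v} x * conv p x) = (LBINT t. p t * (LBINT x. indicator {0..v} x * H (t - x)))"
  proof -
    have "(LBINT x. indicator {0..v} x * conv p x) = (LBINT x. LBINT t. indicator {0..v} x * (H (t - x) * p t))"
      by (simp add: conv_def mult.commute)
    also have "\<dots> = (LBINT t. LBINT x. indicator {0..v} x * (H (t - x) * p t))"
      by (rule lborel_pair.Fubini_integral[OF pairs, symmetric])
    also have "\<dots> = (LBINT t. p t * (LBINT x. indicator {0..v} x * H (t - x)))"
    proof (rule Bochner_Integration.integral_cong[OF refl])
      fix t
      have "(LBINT x. indicator {0..v} x * (H (t - x) * p t)) = (LBINT x. p t * (indicator {0..v} x * H (t - x)))"
        by (simp add: mult_ac)
      then show "(LBINT x. indicator {0..v} x * (H (t - x) * p t)) = p t * (LBINT x. indicator {0..v} x * H (t - x))"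
        by (simp only: integral_mult_right_zero)
    qed
    finally show ?thesis .
  qed
  have i_t: "integrable lborel (\<lambda>t. p t * (LBINT x. indicator {0..v} x * H (t - x)))"
  proof -
    have "integrable lborel (\<lambda>t. LBINT x. p t * (H (t - x) * indicator {0..v} x))"
      by (intro lborel_pair.integrable_fst integrable_triple p_integrable H iv)
    then show ?thesis by (simp only: integral_mult_right_zero mult.commute[of "H _"])
  qed
  have i_a: "integrable lborel (\<lambda>t. p t * a t x)" for x
  proof -
    have "cmod (a t x) \<le> (LBINT w. cmod (H (w - x)))" for t
      unfolding a_def using borel_measurable_integrable[OF Hx[of x]] by (intro L1_bound_integral(2)[OF Hx]) (auto simp: indicator_def)
    from mult_left_mono[OF this norm_ge_zero]
    have *: "cmod (p t) * cmod (a t x) \<le> cmod (p t) * (LBINT w. cmod (H (w - x)))" for t .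
    have "indicator {t..r} w = (if t \<le> w \<and> w \<le> r then 1 else 0 :: complex)" for t w by (simp add: indicator_def)
    then have [measurable]: "(\<lambda>t. a t x) \<in> borel_measurable borel" unfolding a_def by simp
    show ?thesis
    proof (rule Bochner_Integration.integrable_bound)
      show "integrable lborel (\<lambda>t. of_real (LBINT w. cmod (H (w - x))) * p t)" using p_integrable by simp
      show "AE t in lborel. norm (p t * a t x) \<le> norm (of_real (LBINT w. cmod (H (w - x))) * p t)"
        using * by (simp add: norm_mult mult.commute)
    qed measurable
  qed
  have "conv \<phi> v - conv \<phi> 0 = (LBINT t. p t * a t v - p t * a t 0)"
    unfolding conv_eq by (rule Bochner_Integration.integral_diff[OF i_a i_a, symmetric])
  also have "\<dots> = (LBINT t. p t * (LBINT x. indicator {0..v} x * H (t - x)) - p t * (LBINT x. indicator {0..v} x * H (r - x)))"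
  proof (rule Bochner_Integration.integral_cong[OF refl])
    fix t
    show "p t * a t v - p t * a t 0 = p t * (LBINT x. indicator {0..v} x * H (t - x)) - p t * (LBINT x. indicator {0..v} x * H (r - x))"
      using a_diff[of t] p_supp[of t] by (cases "t \<in> {0..r}") (simp_all add: right_diff_distrib[symmetric])
  qed
  also have "\<dots> = (LBINT t. p t * (LBINT x. indicator {0..v} x * H (t - x))) - (LBINT t. p t * (LBINT x. indicator {0..v} x * H (r - x)))"
    by (rule Bochner_Integration.integral_diff[OF i_t integrable_mult_left[OF p_integrable]])
  also have "(LBINT t. p t * (LBINT x. indicator {0..v} x * H (r - x))) = \<phi> r * (LBINT x. indicator {0..v} x * H (r - x))"
    unfolding integral_mult_left_zero \<phi>_r ..
  also have "(LBINT t. p t * (LBINT x. indicator {0..v} x * H (t - x))) - \<dots>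
      = (LBINT x. indicator {0..v} x * (conv p x - \<phi> r * H (r - x)))"
    unfolding eq Bochner_Integration.integral_diff[OF p1 p2] c1 integral_mult_right_zero ..
  finally show "conv \<phi> v = conv \<phi> 0 + (LBINT x. indicator {0..v} x * (conv p x - \<phi> r * H (r - x)))"
    by (simp add: algebra_simps)
qed

lemma cnj_\<phi>_AC: "x \<in> {0..r} \<Longrightarrow> cnj (\<phi> x) = cnj (\<phi> 0) + (LBINT s. indicator {0..x} s * cnj (p s))"
proof -
  assume x: "x \<in> {0..r}"
  have "(LBINT s. indicator {0..x} s * cnj (p s)) = (LBINT s. cnj (indicator {0..x} s * p s))"
    by (rule Bochner_Integration.integral_cong) (auto simp: indicator_def)
  also have "\<dots> = cnj (LBINT s. indicator {0..x} s * p s)" by (rule Bochner_Integration.integral_cnj)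
  finally show ?thesis using \<phi>_AC[OF x] by simp
qed

text \<open>The fundamental theorem for the square of \<open>cmod \<phi>\<close>, whose derivative
  is twice the real part of \<open>cnj \<phi> * p\<close>.\<close>

lemma p_\<phi>_real_part: "(LBINT x. cnj (\<phi> x) * p x) + cnj (LBINT x. cnj (\<phi> x) * p x) = \<phi> r * cnj (\<phi> r)"
proof -
  have p1: "integrable lborel (\<lambda>u. indicator {0..r} u * p u)" by (rule indicator_integrable[OF p_integrable])
  have p2: "integrable lborel (\<lambda>u. indicator {0..r} u * cnj (p u))" by (intro indicator_integrable integrable_cnj p_integrable)
  have d1: "indicator {0..r} x * (p x * k) = p x * k" for x k using p_supp[of x] by (auto simp: indicator_def)
  have d2: "indicator {0..r} x * (k * cnj (p x)) = k * cnj (p x)" for x k using p_supp[of x] by (auto simp: indicator_def)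
  have "cnj (LBINT x. cnj (\<phi> x) * p x) = (LBINT x. \<phi> x * cnj (p x))"
    unfolding Bochner_Integration.integral_cnj[symmetric] by simp
  then show ?thesis
    using AC_integral_by_parts(3)[OF p1 p2 \<phi>_AC cnj_\<phi>_AC less_imp_le[OF r]]
    unfolding d1 d2 \<phi>_0
    by (simp add: mult.commute)
qed

text \<open>The fundamental theorem for \<open>cnj \<phi> * conv \<phi>\<close>. By
  \<open>conv_symmetric\<close> the term in which the derivative falls on \<open>cnj \<phi>\<close>
  is the conjugate of the other one. The boundary term of \<open>conv_\<phi>_AC\<close> and the end
  value \<open>conv \<phi> r\<close> involve the same pairing with \<open>H (r - w)\<close> and make
  up the right-hand side.\<close>

lemma conv_p_\<phi>_real_part:
  "(LBINT w. cnj (\<phi> w) * conv p w) + cnj (LBINT w. cnj (\<phi> w) * conv p w)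
     = \<phi> r * (LBINT w. cnj (\<phi> w) * H (r - w)) + cnj (\<phi> r * (LBINT w. cnj (\<phi> w) * H (r - w)))"
proof -
  define h where "h = (LBINT w. cnj (\<phi> w) * H (r - w))"
  have p2: "integrable lborel (\<lambda>u. indicator {0..r} u * cnj (p u))" by (intro indicator_integrable integrable_cnj p_integrable)
  have d1: "indicator {0..r} x * (cnj (p x) * k) = cnj (p x) * k" for x k using p_supp[of x] by (auto simp: indicator_def)
  have d2: "indicator {0..r} x * (cnj (\<phi> x) * k) = cnj (\<phi> x) * k" for x k using \<phi>_supp[of x] by (auto simp: indicator_def)
  have rr: "r \<in> {0..r}" using r by simp
  have i1: "integrable lborel (\<lambda>w. cnj (\<phi> w) * conv p w)"
    by (intro conv_mult_integrable integrable_cnj \<phi>_integrable p)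
  have i2: "integrable lborel (\<lambda>w. \<phi> r * (cnj (\<phi> w) * H (r - w)))"
    by (intro integrable_mult_right square_integrable_mult(1) square_integrable_cnj \<phi>_square_integrable square_integrable_reflect(1) H)
  have conv_r: "conv \<phi> r = cnj h"
    unfolding h_def Bochner_Integration.integral_cnj[symmetric] conv_def by (simp add: H_reflect)
  have "(LBINT x. cnj (p x) * conv \<phi> x) + (LBINT x. cnj (\<phi> x) * (conv p x - \<phi> r * H (r - x)))
      = cnj (\<phi> r) * conv \<phi> r"
    using AC_integral_by_parts(3)[OF p2 conv_\<phi>_AC(2)[OF rr] cnj_\<phi>_AC conv_\<phi>_AC(1) less_imp_le[OF r]]
    unfolding d1 d2 \<phi>_0 by simp
  also have "(LBINT x. cnj (\<phi> x) * (conv p x - \<phi> r * H (r - x))) = (LBINT x. cnj (\<phi> x) * conv p x - \<phi> r * (cnj (\<phi> x) * H (r - x)))"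
    by (rule Bochner_Integration.integral_cong) (simp_all add: algebra_simps)
  also have "\<dots> = (LBINT x. cnj (\<phi> x) * conv p x) - \<phi> r * h"
    unfolding Bochner_Integration.integral_diff[OF i1 i2] h_def integral_mult_right_zero ..
  also have "(LBINT x. cnj (p x) * conv \<phi> x) = cnj (LBINT x. cnj (\<phi> x) * conv p x)"
    by (rule conv_symmetric[OF p p_integrable \<phi>_square_integrable \<phi>_integrable])
  finally show ?thesis unfolding h_def[symmetric] conv_r by (simp add: algebra_simps)
qed

end

section \<open>Zeros in the upper half plane\<close>

locale zero_of_transform = hermitian_convolution +
  fixes \<gamma> :: "real \<Rightarrow> complex" and z :: complex
  assumes \<gamma>: "square_integrable \<gamma>" and \<gamma>_supp: "\<And>x. x \<notin> {0..r} \<Longrightarrow> \<gamma> x = 0"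
    and \<gamma>_eq: "AE w in lborel. w \<in> {0..r} \<longrightarrow> \<gamma> w + conv \<gamma> w = H (r - w)"
    and zero: "exp (\<i> * z * of_real r) = (LBINT v. \<gamma> v * exp (\<i> * z * of_real v))"
begin

lemma \<gamma>_measurable [measurable]: "\<gamma> \<in> borel_measurable borel"
  using \<gamma> by (rule square_integrable_measurable)

lemma \<gamma>_integrable: "integrable lborel \<gamma>"
  using square_integrable_imp_integrable[OF \<gamma> \<gamma>_supp] by simp

lemma exp_bound: "x \<in> {0..r} \<Longrightarrow> cmod (exp (w * of_real x)) \<le> exp (cmod w * r)"
proof -
  assume x: "x \<in> {0..r}"
  have "Re (w * of_real x) \<le> cmod (w * of_real x)" by (rule complex_Re_le_cmod)
  also have "\<dots> \<le> cmod w * r" using x by (simp add: norm_mult mult_left_mono)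
  finally show ?thesis by simp
qed

text \<open>The source term \<open>\<i> * \<gamma>\<close> times the integrating factor of the
  differential equation for \<open>\<Phi>\<close>.\<close>

definition \<gamma>E :: "real \<Rightarrow> complex" where
  "\<gamma>E u = \<i> * (\<gamma> u * exp (\<i> * z * of_real u))"

lemma \<gamma>E_measurable [measurable]: "\<gamma>E \<in> borel_measurable borel"
  unfolding \<gamma>E_def by measurable

lemma \<gamma>E_integrable: "integrable lborel \<gamma>E"
proof (rule Bochner_Integration.integrable_bound)
  show "integrable lborel (\<lambda>u. of_real (exp (cmod (\<i> * z) * r)) * \<gamma> u)" using \<gamma>_integrable by simp
  have "cmod (\<gamma>E u) \<le> cmod (of_real (exp (cmod (\<i> * z) * r)) * \<gamma> u)" for u
  proof (cases "u \<in> {0..r}")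
    case True
    from mult_left_mono[OF exp_bound[OF True, of "\<i> * z"] norm_ge_zero[of "\<gamma> u"]]
    show ?thesis unfolding \<gamma>E_def by (simp add: norm_mult mult.commute)
  qed (simp add: \<gamma>E_def \<gamma>_supp)
  then show "AE u in lborel. norm (\<gamma>E u) \<le> norm (of_real (exp (cmod (\<i> * z) * r)) * \<gamma> u)" by simp
qed measurable

text \<open>The solution of \<open>\<Phi>' = - i z \<Phi> + i \<gamma>\<close>, \<open>\<Phi> 0 = 0\<close>: its Fourier transform is \<open>P / (l - z)\<close>, where \<open>P\<close> is the
  transform that vanishes at \<open>z\<close>.\<close>
definition \<Phi> :: "real \<Rightarrow> complex" where
  "\<Phi> v = indicator {0..r} v * (exp (- (\<i> * z) * of_real v) * (LBINT u. indicator {0..v} u * \<gamma>E u))"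

lemma \<Phi>_measurable [measurable]: "\<Phi> \<in> borel_measurable borel"
  unfolding \<Phi>_def using measurable_primitive[OF \<gamma>E_measurable] by measurable

lemma \<Phi>_square_integrable: "square_integrable \<Phi>"
proof (rule square_integrable_bounded[of _ 0 r])
  fix v
  have b: "cmod (LBINT u. indicator {0..v} u * \<gamma>E u) \<le> (LBINT u. cmod (\<gamma>E u))"
    by (rule L1_bound_integral(2)[OF \<gamma>E_integrable]) (auto simp: indicator_def)
  show "cmod (\<Phi> v) \<le> exp (cmod (- (\<i> * z)) * r) * (LBINT u. cmod (\<gamma>E u))"
  proof (cases "v \<in> {0..r}")
    case True
    then show ?thesis using mult_mono[OF exp_bound[OF True, of "- (\<i> * z)"] b] by (simp add: \<Phi>_def norm_mult)
  qed (simp add: \<Phi>_def)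
  show "v \<notin> {0..r} \<Longrightarrow> \<Phi> v = 0" by (simp add: \<Phi>_def)
qed measurable

definition p :: "real \<Rightarrow> complex" where
  "p v = - (\<i> * z) * \<Phi> v + \<i> * \<gamma> v"

lemma p_square_integrable: "square_integrable p"
proof -
  have "square_integrable (\<lambda>v. - (\<i> * z) * \<Phi> v)"
    by (rule square_integrable_bound[OF \<Phi>_square_integrable, of _ "cmod z"]) (auto simp: norm_mult)
  moreover have "square_integrable (\<lambda>v. \<i> * \<gamma> v)"
    by (rule square_integrable_bound[OF \<gamma>, of _ 1]) (auto simp: norm_mult)
  ultimately show ?thesis unfolding p_def by (rule square_integrable_add(1))
qed

sublocale AC_form r H p
  by standard (use p_square_integrable in \<open>auto simp: p_def \<Phi>_def \<gamma>_supp\<close>)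

text \<open>The product rule for the exponential and the primitive of \<open>\<gamma>E\<close> shows
  that the explicit \<open>\<Phi>\<close> is the primitive of its own derivative \<open>p\<close>.
  The identities of \<open>AC_form\<close> thereby apply to it.\<close>

lemma \<phi>_eq: "\<phi> = \<Phi>"
proof
  fix x
  show "\<phi> x = \<Phi> x"
  proof (cases "x \<in> {0..r}")
    case True
    then have x: "0 \<le> x" "x \<le> r" by auto
    define F where "F v = exp (- (\<i> * z) * of_real v)" for v :: real
    define f where "f v = - (\<i> * z) * F v" for v
    define G where "G v = (LBINT u. indicator {0..v} u * \<gamma>E u)" for v
    have G0: "G 0 = 0"
    proof -
      have "AE s in lborel. indicator {0..0} s * \<gamma>E s = 0"
        using AE_lborel_singleton[of 0] by eventually_elim (auto simp: indicator_def)
      then show ?thesis unfolding G_def by (rule integral_eq_zero_AE)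
    qed
    have f_int: "integrable lborel (\<lambda>u. indicator {0..x} u * f u)"
      using exp_primitive(1)[OF x(1), of "- (\<i> * z)"] by (simp add: f_def F_def)
    have F_AC: "F y = F 0 + (LBINT u. indicator {0..y} u * f u)" if "y \<in> {0..x}" for y
      using exp_primitive(2)[of y "- (\<i> * z)"] that by (simp add: f_def F_def)
    have G_AC: "G y = G 0 + (LBINT u. indicator {0..y} u * \<gamma>E u)" if "y \<in> {0..x}" for y
      unfolding G0 by (simp add: G_def)
    note parts = AC_integral_by_parts[OF f_int indicator_integrable[OF \<gamma>E_integrable] F_AC G_AC x(1)]
    have "\<phi> x = (LBINT s. indicator {0..x} s * p s)" using True by (simp add: \<phi>_def)
    also have "\<dots> = (LBINT s. indicator {0..x} s * (f s * G s) + indicator {0..x} s * (F s * \<gamma>E s))"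
    proof (rule Bochner_Integration.integral_cong[OF refl])
      fix s
      have "F s * \<gamma>E s = \<i> * \<gamma> s * (exp (- (\<i> * z) * of_real s) * exp (\<i> * z * of_real s))"
        by (simp add: F_def \<gamma>E_def mult_ac)
      also have "exp (- (\<i> * z) * of_real s) * exp (\<i> * z * of_real s) = 1" unfolding exp_add[symmetric] by simp
      finally have "F s * \<gamma>E s = \<i> * \<gamma> s" by simp
      then show "indicator {0..x} s * p s = indicator {0..x} s * (f s * G s) + indicator {0..x} s * (F s * \<gamma>E s)"
        using x by (cases "s \<in> {0..x}") (auto simp: p_def \<Phi>_def f_def F_def G_def)
    qed
    also have "\<dots> = (LBINT s. indicator {0..x} s * (f s * G s)) + (LBINT s. indicator {0..x} s * (F s * \<gamma>E s))"
      by (rule Bochner_Integration.integral_add[OF parts(1,2)])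
    also have "\<dots> = F x * G x" using parts(3) by (simp add: G0)
    also have "\<dots> = \<Phi> x" using True by (simp add: \<Phi>_def F_def G_def)
    finally show ?thesis .
  qed (simp add: \<phi>_def \<Phi>_def)
qed

text \<open>The only use of the assumption \<open>zero\<close>: it evaluates the primitive of
  \<open>\<gamma>E\<close> at \<open>r\<close>, so that the boundary terms no longer depend on
  \<open>\<gamma>\<close>.\<close>

lemma \<phi>_end: "\<phi> r = \<i>"
proof -
  have "(LBINT u. indicator {0..r} u * \<gamma>E u) = (LBINT u. \<i> * (\<gamma> u * exp (\<i> * z * of_real u)))"
    by (rule Bochner_Integration.integral_cong) (use \<gamma>_supp in \<open>auto simp: \<gamma>E_def indicator_def\<close>)
  also have "\<dots> = \<i> * exp (\<i> * z * of_real r)" unfolding zero by (rule integral_mult_right_zero)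
  finally have "\<Phi> r = \<i> * (exp (- (\<i> * z) * of_real r) * exp (\<i> * z * of_real r))" using r by (simp add: \<Phi>_def mult_ac)
  also have "exp (- (\<i> * z) * of_real r) * exp (\<i> * z * of_real r) = 1" unfolding exp_add[symmetric] by simp
  finally show ?thesis by (simp add: \<phi>_eq)
qed

lemma conv_p: "conv p w = - (\<i> * z) * conv \<phi> w + \<i> * conv \<gamma> w"
proof -
  have "conv p w = (LBINT v. - (\<i> * z) * (\<phi> v * H (v - w)) + \<i> * (\<gamma> v * H (v - w)))"
    unfolding conv_def p_def \<phi>_eq by (rule Bochner_Integration.integral_cong) (simp_all add: algebra_simps)
  also have "\<dots> = (LBINT v. - (\<i> * z) * (\<phi> v * H (v - w))) + (LBINT v. \<i> * (\<gamma> v * H (v - w)))"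
    by (intro Bochner_Integration.integral_add integrable_mult_right conv_int \<phi>_square_integrable \<gamma>)
  finally show ?thesis unfolding conv_def integral_mult_right_zero .
qed

text \<open>On \<open>[0, r]\<close> the equation for \<open>\<gamma>\<close> gives \<open>p + conv
  p = - (\<i> * z) * (\<phi> + conv \<phi>) + \<i> * H (r - w)\<close>. Pair this with
  \<open>\<phi>\<close> and add the conjugate. The left side is known from the two real part lemmas
  and equals 1 plus a term with \<open>h\<close>; the same term appears on the right and cancels.
  What remains is \<open>2 * Im z\<close> times the form, which is real by the symmetry of
  \<open>conv\<close>.\<close>

lemma form_value: "form * of_real (2 * Im z) = 1"
proof -
  define X where "X = (LBINT w. cnj (\<phi> w) * p w)"
  define Y where "Y = (LBINT w. cnj (\<phi> w) * conv p w)"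
  define h where "h = (LBINT w. cnj (\<phi> w) * H (r - w))"
  have c\<phi>: "integrable lborel (\<lambda>w. cnj (\<phi> w))" by (rule integrable_cnj[OF \<phi>_integrable])
  have iX: "integrable lborel (\<lambda>w. cnj (\<phi> w) * p w)"
    by (intro square_integrable_mult(1) square_integrable_cnj \<phi>_square_integrable p)
  have iY: "integrable lborel (\<lambda>w. cnj (\<phi> w) * conv p w)" by (rule conv_mult_integrable[OF c\<phi> p])
  have i\<phi>: "integrable lborel (\<lambda>w. cnj (\<phi> w) * \<phi> w)"
    by (intro square_integrable_mult(1) square_integrable_cnj \<phi>_square_integrable)
  have ic: "integrable lborel (\<lambda>w. cnj (\<phi> w) * conv \<phi> w)" by (rule conv_mult_integrable[OF c\<phi> \<phi>_square_integrable])
  have ih: "integrable lborel (\<lambda>w. cnj (\<phi> w) * H (r - w))"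
    by (intro square_integrable_mult(1) square_integrable_cnj \<phi>_square_integrable square_integrable_reflect(1) H)
  have form_split: "form = (LBINT w. cnj (\<phi> w) * \<phi> w) + (LBINT w. cnj (\<phi> w) * conv \<phi> w)"
    unfolding form_def distrib_left by (rule Bochner_Integration.integral_add[OF i\<phi> ic])
  have "cnj (LBINT w. cnj (\<phi> w) * \<phi> w) = (LBINT w. cnj (\<phi> w) * \<phi> w)"
    unfolding Bochner_Integration.integral_cnj[symmetric] by (simp add: mult.commute)
  then have form_real: "cnj form = form"
    unfolding form_split complex_cnj_add
    using conv_symmetric[OF \<phi>_square_integrable \<phi>_integrable \<phi>_square_integrable \<phi>_integrable] by simp
  have i_form: "integrable lborel (\<lambda>w. cnj (\<phi> w) * (\<phi> w + conv \<phi> w))"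
    unfolding distrib_left by (rule Bochner_Integration.integrable_add[OF i\<phi> ic])
  have "X + Y = (LBINT w. cnj (\<phi> w) * p w + cnj (\<phi> w) * conv p w)"
    unfolding X_def Y_def by (rule Bochner_Integration.integral_add[OF iX iY, symmetric])
  also have "\<dots> = (LBINT w. - (\<i> * z) * (cnj (\<phi> w) * (\<phi> w + conv \<phi> w)) + \<i> * (cnj (\<phi> w) * H (r - w)))"
  proof (rule integral_cong_AE)
    show "AE w in lborel. cnj (\<phi> w) * p w + cnj (\<phi> w) * conv p w
      = - (\<i> * z) * (cnj (\<phi> w) * (\<phi> w + conv \<phi> w)) + \<i> * (cnj (\<phi> w) * H (r - w))"
      using \<gamma>_eq
    proof eventually_elim
      case (elim w)
      show ?case
      proof (cases "w \<in> {0..r}")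
        case True
        then have e: "H (r - w) = \<gamma> w + conv \<gamma> w" using elim by simp
        show ?thesis unfolding conv_p e by (simp add: p_def \<phi>_eq[symmetric] algebra_simps)
      qed (simp add: \<phi>_supp)
    qed
  qed measurable
  also have "\<dots> = (LBINT w. - (\<i> * z) * (cnj (\<phi> w) * (\<phi> w + conv \<phi> w))) + (LBINT w. \<i> * (cnj (\<phi> w) * H (r - w)))"
    by (intro Bochner_Integration.integral_add integrable_mult_right i_form ih)
  also have "\<dots> = - (\<i> * z) * form + \<i> * h"
    unfolding integral_mult_right_zero form_def h_def ..
  finally have XY: "X + Y = - (\<i> * z) * form + \<i> * h" .
  have "X + cnj X = 1" using p_\<phi>_real_part unfolding X_def[symmetric] \<phi>_end by simp
  moreover have "Y + cnj Y = \<i> * h + cnj (\<i> * h)"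
    using conv_p_\<phi>_real_part unfolding Y_def[symmetric] h_def[symmetric] \<phi>_end .
  ultimately have "1 + (\<i> * h + cnj (\<i> * h)) = (X + cnj X) + (Y + cnj Y)" by simp
  also have "\<dots> = (X + Y) + cnj (X + Y)" by simp
  also have "\<dots> = (- (\<i> * z) + cnj (- (\<i> * z))) * form + (\<i> * h + cnj (\<i> * h))"
    unfolding XY by (simp add: form_real algebra_simps)
  finally have "1 = (- (\<i> * z) + cnj (- (\<i> * z))) * form" by simp
  also have "- (\<i> * z) + cnj (- (\<i> * z)) = of_real (2 * Im z)"
    by (simp add: complex_eq_iff)
  finally show ?thesis by (simp add: mult.commute)
qed

text \<open>Integration by parts of \<open>\<phi>\<close> against the exponential. The end value
  \<open>\<i>\<close> supplies \<open>cis (l * r)\<close>, and inserting the definition of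
  \<open>p\<close> moves the factor \<open>of_real l - z\<close> in front of the transform of
  \<open>\<phi>\<close>.\<close>

lemma transform_quotient:
  "(of_real l - z) * (LBINT v. \<phi> v * cis (l * v)) = cis (l * r) - (LBINT v. \<gamma> v * cis (l * v))"
proof -
  define E where "E v = exp (\<i> * of_real l * of_real v)" for v :: real
  have E: "E v = cis (l * v)" for v by (simp add: E_def cis_conv_exp mult.assoc)
  have [measurable]: "E \<in> borel_measurable borel" unfolding E_def by measurable
  have iE: "integrable lborel (\<lambda>v. f v * E v)" if f: "integrable lborel f" for f
  proof (rule Bochner_Integration.integrable_bound[OF f])
    note [measurable] = borel_measurable_integrable[OF f]
    show "(\<lambda>v. f v * E v) \<in> borel_measurable lborel" by measurable
  qed (simp add: E norm_mult)
  have d1: "indicator {0..r} x * (p x * k) = p x * k" for x k using p_supp[of x] by (auto simp: indicator_def)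
  have d2: "indicator {0..r} x * (\<phi> x * k) = \<phi> x * k" for x k using \<phi>_supp[of x] by (auto simp: indicator_def)
  have E_AC: "E x = E 0 + (LBINT u. indicator {0..x} u * (\<i> * of_real l * E u))" if "x \<in> {0..r}" for x
    using exp_primitive(2)[of x "\<i> * of_real l"] that by (simp add: E_def)
  have E_int: "integrable lborel (\<lambda>u. indicator {0..r} u * (\<i> * of_real l * E u))"
    using exp_primitive(1)[of r "\<i> * of_real l"] r by (simp add: E_def)
  have "(LBINT x. p x * E x) + (LBINT x. \<phi> x * (\<i> * of_real l * E x)) = \<i> * E r"
    using AC_integral_by_parts(3)[OF indicator_integrable[OF p_integrable] E_int \<phi>_AC E_AC less_imp_le[OF r]]
    unfolding d1 d2 \<phi>_0 \<phi>_end by simp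
  also have "(LBINT x. \<phi> x * (\<i> * of_real l * E x)) = (LBINT x. \<i> * of_real l * (\<phi> x * E x))"
    by (rule Bochner_Integration.integral_cong) (simp_all add: mult_ac)
  also have "\<dots> = \<i> * of_real l * (LBINT x. \<phi> x * E x)" by (rule integral_mult_right_zero)
  also have "(LBINT x. p x * E x) = (LBINT x. - (\<i> * z) * (\<phi> x * E x) + \<i> * (\<gamma> x * E x))"
    unfolding p_def \<phi>_eq by (rule Bochner_Integration.integral_cong) (simp_all add: algebra_simps)
  also have "\<dots> = (LBINT x. - (\<i> * z) * (\<phi> x * E x)) + (LBINT x. \<i> * (\<gamma> x * E x))"
    by (intro Bochner_Integration.integral_add integrable_mult_right iE \<phi>_integrable \<gamma>_integrable)
  also have "\<dots> = - (\<i> * z) * (LBINT x. \<phi> x * E x) + \<i> * (LBINT x. \<gamma> x * E x)"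
    unfolding integral_mult_right_zero ..
  finally have "\<i> * ((of_real l - z) * (LBINT x. \<phi> x * E x)) = \<i> * (E r - (LBINT x. \<gamma> x * E x))"
    by (simp add: algebra_simps)
  then show ?thesis unfolding E by simp
qed

end

section \<open>From the Lebesgue data of the statement to Borel versions\<close>

lemma L2_on_borel_version:
  assumes "L2_on {a..c} f"
  obtains f' where "square_integrable f'" "\<And>x. x \<notin> {a..c} \<Longrightarrow> f' x = 0"
    "AE x in lborel. x \<in> {a..c} \<longrightarrow> f' x = f x"
proof -
  have m: "(\<lambda>x. indicator {a..c} x *\<^sub>R f x) \<in> borel_measurable lebesgue"
    and i: "integrable lebesgue (\<lambda>x. indicator {a..c} x *\<^sub>R (cmod (f x))\<^sup>2)"
    using assms by (auto simp: L2_on_def set_borel_measurable_def set_integrable_def)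
  obtain g where g [measurable]: "g \<in> borel_measurable borel" and ae: "AE x in lborel. indicator {a..c} x *\<^sub>R f x = g x"
    using borel_version[OF m] by blast
  show thesis
  proof
    let ?f = "\<lambda>x. indicator {a..c} x * g x"
    have "AE x in lborel. indicator {a..c} x *\<^sub>R (cmod (f x))\<^sup>2 = (cmod (?f x))\<^sup>2"
      using ae by eventually_elim (auto simp: indicator_def split: if_splits)
    from lebesgue_integral_borel_version(2)[OF borel_measurable_integrable[OF i] _ this]
    have "integrable lborel (\<lambda>x. (cmod (?f x))\<^sup>2)" using i by simp
    then show "square_integrable ?f" by (simp add: square_integrable_def)
    show "AE x in lborel. x \<in> {a..c} \<longrightarrow> ?f x = f x" using ae by eventually_elim auto
  qed auto
qed

lemma borel_measurable_lebesgue_AE: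
  fixes f f' :: "real \<Rightarrow> complex"
  assumes f': "f' \<in> borel_measurable borel" and "AE x in lborel. f x = f' x"
  shows "f \<in> borel_measurable lebesgue"
proof -
  have ae: "AE x in lebesgue. f x = f' x" by (rule AE_completion[OF assms(2)])
  have ae': "AE x in lebesgue. f' x = f x" by (rule eventually_mono[OF ae]) simp
  have m: "f' \<in> borel_measurable lebesgue" by (rule measurable_completion) (simp add: f')
  show ?thesis by (rule borel_measurable_AE[of f' f, OF m ae'])
qed

lemma AE_lborel_reflect:
  fixes P :: "real \<Rightarrow> bool"
  assumes "AE x in lborel. P x" shows "AE x in lborel. P (c - x)"
proof -
  obtain N where N: "{x \<in> space lborel. \<not> P x} \<subseteq> N" "emeasure lborel N = 0" "N \<in> sets lborel"
    using assms by (rule AE_E)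
  have [measurable]: "N \<in> sets borel" using N(3) by simp
  have "AE x in lborel. x \<notin> N" using N(2,3) by (intro AE_not_in) auto
  then have "AE x in lborel. c + (-1) * x \<notin> N"
    by (intro AE_borel_affine) auto
  then show ?thesis by eventually_elim (use N(1) in auto)
qed

text \<open>For \<open>s\<close> in \<open>[0, r]\<close> and \<open>u\<close> in
  \<open>[0, t]\<close> the difference \<open>s - u\<close> stays in \<open>[-r, r]\<close>, where
  the cut-off version agrees with the accelerant almost everywhere. Reflection preserves null
  sets.\<close>

lemma conv_borel_version:
  fixes H H0 f f' :: "real \<Rightarrow> complex"
  assumes [measurable]: "H \<in> borel_measurable borel" "f' \<in> borel_measurable borel"
    and H: "AE x in lborel. x \<in> {-r..r} \<longrightarrow> H x = H0 x"
    and f: "AE x in lborel. x \<in> {0..t} \<longrightarrow> f' x = f x" and supp: "\<And>x. x \<notin> {0..t} \<Longrightarrow> f' x = 0"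
    and "s \<in> {0..r}" "t \<le> r"
  shows "(LINT u:{0..t}|lebesgue. H0 (s - u) * f u) = (LBINT u. H (s - u) * f' u)"
  unfolding set_lebesgue_integral_def
proof (rule lebesgue_integral_borel_version(1))
  show ae: "AE u in lborel. indicator {0..t} u *\<^sub>R (H0 (s - u) * f u) = H (s - u) * f' u"
    using AE_lborel_reflect[OF H, of s] f
  proof eventually_elim
    case (elim u)
    show ?case
    proof (cases "u \<in> {0..t}")
      case True
      then have "s - u \<in> {-r..r}" using assms(6,7) by auto
      then show ?thesis using elim True by simp
    qed (simp add: supp)
  qed
  show "(\<lambda>u. H (s - u) * f' u) \<in> borel_measurable borel" by measurable
  then show "(\<lambda>u. indicator {0..t} u *\<^sub>R (H0 (s - u) * f u)) \<in> borel_measurable lebesgue"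
    using ae by (rule borel_measurable_lebesgue_AE)
qed

text \<open>An accelerant is Hermitian only almost everywhere. Averaging a version with its
  reflected conjugate gives the symmetry at every point and stays in the same class on
  \<open>[-r, r]\<close>.\<close>

lemma hermitian_borel_version:
  assumes "accelerant H0" "0 < r"
  obtains H where "hermitian_convolution r H" "AE x in lborel. x \<in> {-r..r} \<longrightarrow> H x = H0 x"
proof -
  have "L2_on {-r..r} H0" and "AE x in lebesgue. H0 (- x) = cnj (H0 x)"
    using assms by (auto simp: accelerant_def)
  then have herm: "AE x in lborel. H0 (- x) = cnj (H0 x)" by (simp add: AE_completion_iff)
  obtain H1 where H1: "square_integrable H1" "\<And>x. x \<notin> {-r..r} \<Longrightarrow> H1 x = 0"
    "AE x in lborel. x \<in> {-r..r} \<longrightarrow> H1 x = H0 x"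
    by (rule L2_on_borel_version[OF \<open>L2_on {-r..r} H0\<close>]) blast
  define H where "H x = H1 x / 2 + cnj (H1 (0 - x)) / 2" for x
  show thesis
  proof
    show "hermitian_convolution r H"
    proof
      have 1: "square_integrable (\<lambda>x. H1 x / 2)"
        by (rule square_integrable_bound[OF H1(1), of _ 1]) (use square_integrable_measurable[OF H1(1)] in \<open>auto simp: norm_divide\<close>)
      have 2: "square_integrable (\<lambda>x. cnj (H1 (0 - x)) / 2)"
        by (rule square_integrable_bound[OF square_integrable_cnj[OF square_integrable_reflect(1)[OF H1(1), of 0]], of _ 1])
          (use square_integrable_measurable[OF H1(1)] in \<open>auto simp: norm_divide\<close>)
      show "square_integrable H" unfolding H_def by (rule square_integrable_add(1)[OF 1 2])
      show "H x = 0" if "x \<notin> {-r..r}" for x using H1(2)[of x] H1(2)[of "0 - x"] that by (auto simp: H_def)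
      show "H (- x) = cnj (H x)" for x by (simp add: H_def add.commute)
    qed fact
    show "AE x in lborel. x \<in> {-r..r} \<longrightarrow> H x = H0 x"
      using H1(3) AE_lborel_reflect[OF H1(3), of 0] herm
      by eventually_elim (auto simp: H_def)
  qed
qed

text \<open>A nonzero element of the kernel of identity plus convolution would make the quadratic
  form vanish, against its strict positivity. In this form positivity feeds the compactness argument
  of \<open>solutions_bounded\<close>.\<close>

lemma accelerant_injective:
  assumes acc: "accelerant H0" and H: "hermitian_convolution r H" and ae: "AE x in lborel. x \<in> {-r..r} \<longrightarrow> H x = H0 x"
    and t: "t \<in> {0<..r}" and f: "square_integrable f" and supp: "\<And>s. s \<notin> {0..t} \<Longrightarrow> f s = 0"
    and eq: "\<And>s. s \<in> {0..t} \<Longrightarrow> f s + (LBINT u. H (s - u) * f u) = 0"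
  shows "sq_norm f = 0"
proof (rule ccontr)
  assume nz: "sq_norm f \<noteq> 0"
  have [measurable]: "f \<in> borel_measurable borel" "H \<in> borel_measurable borel"
    using square_integrable_measurable[OF f] hermitian_convolution.H_measurable[OF H] by auto
  have "L2_on {0..t} f"
    unfolding L2_on_def set_borel_measurable_def set_integrable_def
  proof
    show "(\<lambda>x. indicator {0..t} x *\<^sub>R f x) \<in> borel_measurable lebesgue"
      by (rule measurable_completion) measurable
    have "(\<lambda>x. indicator {0..t} x *\<^sub>R (cmod (f x))\<^sup>2) = (\<lambda>x. (cmod (f x))\<^sup>2)"
      using supp by (auto simp: indicator_def fun_eq_iff)
    then show "integrable lebesgue (\<lambda>x. indicator {0..t} x *\<^sub>R (cmod (f x))\<^sup>2)"
      using f by (simp add: square_integrable_def integrable_completion)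
  qed
  moreover have "\<not> (AE x in lebesgue. x \<in> {0..t} \<longrightarrow> f x = 0)"
  proof
    assume "AE x in lebesgue. x \<in> {0..t} \<longrightarrow> f x = 0"
    then have "AE x in lborel. x \<in> {0..t} \<longrightarrow> f x = 0" by (simp add: AE_completion_iff)
    then have "AE x in lborel. (cmod (f x))\<^sup>2 = 0" by eventually_elim (use supp in auto)
    then have "sq_norm f = 0" unfolding sq_norm_def by (rule integral_eq_zero_AE)
    with nz show False by contradiction
  qed
  ultimately have "0 < Re (LINT x:{0..t}|lebesgue. (f x + accelerant_operator H0 t f x) * cnj (f x))"
    using acc t unfolding accelerant_def by auto
  moreover have "indicator {0..t} x *\<^sub>R ((f x + accelerant_operator H0 t f x) * cnj (f x)) = 0" for x
  proof (cases "x \<in> {0..t}")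
    case True
    have "accelerant_operator H0 t f x = (LBINT u. H (x - u) * f u)"
      unfolding accelerant_operator_def
      by (rule conv_borel_version[OF _ _ ae]) (use supp True t in auto)
    then show ?thesis using eq[OF True] by simp
  qed simp
  ultimately show False by (simp add: set_lebesgue_integral_def)
qed

text \<open>The orthogonality relation: \<open>\<gamma> s\<close> is \<open>\<Gamma>\<^sub>r(r - s, 0)\<close>.\<close>
lemma krein_representation:
  assumes A: "L2_on {0..r} A" and krein: "krein_system A P Ps" and acc: "accelerant_of A H0" and r: "0 < r"
    and hc: "hermitian_convolution r H" and ae: "AE x in lborel. x \<in> {-r..r} \<longrightarrow> H x = H0 x"
  obtains \<gamma> where "square_integrable \<gamma>" "\<And>x. x \<notin> {0..r} \<Longrightarrow> \<gamma> x = 0"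
    "AE w in lborel. w \<in> {0..r} \<longrightarrow> \<gamma> w + hermitian_convolution.conv H \<gamma> w = H (r - w)"
    "\<And>z. P r z = exp (\<i> * z * of_real r) - (LBINT v. \<gamma> v * exp (\<i> * z * of_real v))"
proof -
  interpret hermitian_convolution r H by (fact hc)
  obtain A1 where A1: "square_integrable A1" "\<And>x. x \<notin> {0..r} \<Longrightarrow> A1 x = 0" "AE x in lborel. x \<in> {0..r} \<longrightarrow> A1 x = A x"
    by (rule L2_on_borel_version[OF A]) blast
  define b where "b x = cnj (A1 x)" for x
  have b: "square_integrable b" unfolding b_def by (rule square_integrable_cnj[OF A1(1)])
  have b_supp: "b x = 0" if "x \<notin> {0..r}" for x using A1(2)[OF that] by (simp add: b_def)
  have b_ae: "AE x in lborel. x \<in> {0..r} \<longrightarrow> b x = cnj (A x)" using A1(3) by eventually_elim (simp add: b_def)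
  obtain G C where G: "(\<lambda>(r, s). G r s) \<in> borel_measurable (borel \<Otimes>\<^sub>M borel)"
    "\<And>r s. s \<notin> {0..r} \<Longrightarrow> G r s = 0"
    "\<And>r s. s \<in> {0..r} \<Longrightarrow> G r s = b s - (LBINT \<rho>. indicator {..r} \<rho> * b \<rho> * cnj (G \<rho> (\<rho> - s)))"
    "\<And>x s. s \<in> {0..x} \<Longrightarrow> x \<le> r \<Longrightarrow> cmod (G x s - b s) \<le> C"
    by (rule volterra_kernel_exists[OF b b_supp]) blast+
  interpret volterra_kernel b r G C
    by standard (use b b_supp r G in auto)
  obtain \<Gamma> where \<Gamma>: "\<And>t. t > 0 \<Longrightarrow> resolvent_kernel H0 t (\<Gamma> t)"
    and A_ae: "AE t in lebesgue. t > 0 \<longrightarrow> cnj (A t) = H0 t - (LINT u:{0..t}|lebesgue. H0 (t - u) * \<Gamma> t u 0)"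
    using acc by (auto simp: accelerant_of_def)
  have "\<exists>f. t \<in> {0<..r} \<longrightarrow> square_integrable f \<and> (\<forall>x. x \<notin> {0..t} \<longrightarrow> f x = 0) \<and>
      (AE x in lborel. x \<in> {0..t} \<longrightarrow> f x = \<Gamma> t x 0)" for t
  proof (cases "t \<in> {0<..r}")
    case True
    then have "0 \<in> {0..t}" "0 < t" by auto
    with \<Gamma>[of t] have "L2_on {0..t} (\<lambda>x. \<Gamma> t x 0)" unfolding resolvent_kernel_def by blast
    then show ?thesis by (rule L2_on_borel_version) blast
  qed blast
  then have "\<forall>t. \<exists>f. t \<in> {0<..r} \<longrightarrow> square_integrable f \<and> (\<forall>x. x \<notin> {0..t} \<longrightarrow> f x = 0) \<and>
      (AE x in lborel. x \<in> {0..t} \<longrightarrow> f x = \<Gamma> t x 0)" by (rule allI)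
  \<comment> \<open>The versions are chosen independently for each length, so nothing relates
    \<open>g t\<close> for different \<open>t\<close>.\<close>
  from choice[OF this] obtain g where g': "\<forall>t. t \<in> {0<..r} \<longrightarrow> square_integrable (g t) \<and> (\<forall>x. x \<notin> {0..t} \<longrightarrow> g t x = 0) \<and>
      (AE x in lborel. x \<in> {0..t} \<longrightarrow> g t x = \<Gamma> t x 0)" by (rule exE)
  have g: "\<And>t. t \<in> {0<..r} \<Longrightarrow> square_integrable (g t)"
    "\<And>t x. t \<in> {0<..r} \<Longrightarrow> x \<notin> {0..t} \<Longrightarrow> g t x = 0"
    "\<And>t. t \<in> {0<..r} \<Longrightarrow> AE x in lborel. x \<in> {0..t} \<longrightarrow> g t x = \<Gamma> t x 0"
    using g' by blast+
  have conv_g: "(LINT u:{0..t}|lebesgue. H0 (s - u) * \<Gamma> t u 0) = (LBINT u. H (s - u) * g t u)"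
    if "t \<in> {0<..r}" "s \<in> {0..r}" for t s
    by (rule conv_borel_version[OF _ _ ae g(3)[OF that(1)]])
      (use g(2)[OF that(1)] square_integrable_measurable[OF g(1)[OF that(1)]] that in auto)
  have g_eq: "AE s in lborel. s \<in> {0..t} \<longrightarrow> g t s + (LBINT u. H (s - u) * g t u) = H s" if t: "t \<in> {0<..r}" for t
  proof -
    have "AE s in lebesgue. s \<in> {0..t} \<longrightarrow> \<Gamma> t s 0 + (LINT u:{0..t}|lebesgue. H0 (s - u) * \<Gamma> t u 0) = H0 (s - 0)"
    proof -
      have "0 \<in> {0..t}" "0 < t" using t by auto
      with \<Gamma>[of t] show ?thesis unfolding resolvent_kernel_def by blast
    qed
    then have "AE s in lborel. s \<in> {0..t} \<longrightarrow> \<Gamma> t s 0 + (LINT u:{0..t}|lebesgue. H0 (s - u) * \<Gamma> t u 0) = H0 (s - 0)"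
      by (simp add: AE_completion_iff)
    then show ?thesis using g(3)[OF t] ae
    proof eventually_elim
      case (elim s)
      show ?case
      proof
        assume s: "s \<in> {0..t}"
        then have "s \<in> {0..r}" "s \<in> {-r..r}" using t by auto
        then show "g t s + (LBINT u. H (s - u) * g t u) = H s"
          using elim s conv_g[OF t, of s] by simp
      qed
    qed
  qed
  obtain Cg where Cg: "\<And>t. t \<in> {0<..r} \<Longrightarrow> sq_norm (g t) \<le> Cg"
    by (rule solutions_bounded[of r H g])
      (use r H_supp g g_eq hermitian_convolution.H[OF hc] accelerant_injective[OF _ hc ae] acc in \<open>auto simp: accelerant_of_def\<close>)
  interpret res: resolvent_family b r G C H g Cg
  proof
    show "square_integrable H" by (rule hermitian_convolution.H[OF hc])
    show "H (- x) = cnj (H x)" for x by (rule hermitian_convolution.H_herm[OF hc])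
    have "AE t in lborel. t > 0 \<longrightarrow> cnj (A t) = H0 t - (LINT u:{0..t}|lebesgue. H0 (t - u) * \<Gamma> t u 0)"
      using A_ae by (simp add: AE_completion_iff)
    then show "AE t in lborel. t \<in> {0<..r} \<longrightarrow> b t = H t - (LBINT u. H (t - u) * g t u)"
      using b_ae ae
    proof eventually_elim
      case (elim t)
      show ?case
      proof
        assume t: "t \<in> {0<..r}"
        then have "t \<in> {0..r}" "t \<in> {-r..r}" by auto
        then show "b t = H t - (LBINT u. H (t - u) * g t u)"
          using elim t conv_g[OF t, of t] by simp
      qed
    qed
  qed (use g g_eq Cg in auto)
  have rr: "r \<in> {0..r}" "r \<le> r" using r by auto
  define \<gamma> where "\<gamma> v = G r (r - v)" for v
  show thesis
  proof
    show "square_integrable \<gamma>" unfolding \<gamma>_def by (rule square_integrable_reflect(1)[OF G_square_integrable[OF rr(2)]])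
    show "\<gamma> x = 0" if "x \<notin> {0..r}" for x unfolding \<gamma>_def using that by (intro G_supp) auto
    show "AE w in lborel. w \<in> {0..r} \<longrightarrow> \<gamma> w + hermitian_convolution.conv H \<gamma> w = H (r - w)"
      using AE_lborel_reflect[OF res.resolvent_equation[OF rr(1)], of r]
    proof eventually_elim
      case (elim w)
      have "hermitian_convolution.conv H \<gamma> w = (LBINT v. H (r - w - (r - v)) * G r (r - v))"
        unfolding hermitian_convolution.conv_def[OF hc] \<gamma>_def by (simp add: mult.commute)
      also have "\<dots> = (LBINT u. H (r - w - u) * G r u)"
        by (rule integral_reflect(1)[of "\<lambda>u. H (r - w - u) * G r u"])
      finally show ?case using elim by (auto simp: \<gamma>_def)
    qed
    fix z
    have "(LBINT v. \<gamma> v * exp (\<i> * z * of_real v)) = (LBINT v. G r (r - v) * exp (\<i> * z * of_real (r - (r - v))))"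
      by (simp add: \<gamma>_def)
    also have "\<dots> = (LBINT s. G r s * exp (\<i> * z * of_real (r - s)))"
      by (rule integral_reflect(1)[of "\<lambda>s. G r s * exp (\<i> * z * of_real (r - s))"])
    also have "\<dots> = (LBINT s. exp (\<i> * z * of_real r) * (G r s * exp (- (\<i> * z) * of_real s)))"
    proof (rule Bochner_Integration.integral_cong[OF refl])
      fix s
      have "exp (\<i> * z * of_real (r - s)) = exp (\<i> * z * of_real r) * exp (- (\<i> * z) * of_real s)"
        unfolding exp_add[symmetric] by (simp add: algebra_simps)
      then show "G r s * exp (\<i> * z * of_real (r - s)) = exp (\<i> * z * of_real r) * (G r s * exp (- (\<i> * z) * of_real s))"
        by (simp add: mult_ac)
    qed
    also have "\<dots> = exp (\<i> * z * of_real r) * (LBINT s. G r s * exp (- (\<i> * z) * of_real s))"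
      by (rule integral_mult_right_zero)
    finally show "P r z = exp (\<i> * z * of_real r) - (LBINT v. \<gamma> v * exp (\<i> * z * of_real v))"
      unfolding krein_solution_unique[OF krein b_ae rr(1)] kernel_P_def by (simp add: right_diff_distrib)
  qed
qed

text \<open>\<open>\<epsilon>\<close> is the sign of the oriented integral and \<open>S\<close> the
  open interval between 0 and \<open>x\<close>. The two integrands may differ at the end points
  only, apart from the null set where \<open>H\<close> and \<open>H0\<close> differ.\<close>

lemma interval_integral_primitive2:
  fixes H H0 :: "real \<Rightarrow> complex"
  assumes [measurable]: "H \<in> borel_measurable borel" and ae: "AE x in lborel. x \<in> {-r..r} \<longrightarrow> H x = H0 x"
    and x: "\<bar>x\<bar> \<le> r"
  shows "(LINT s=0..x|lebesgue. (of_real (x - s) * H0 s)) = (LBINT u. H u * of_real (primitive2 x u))"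
proof -
  define \<epsilon> where "\<epsilon> = (if 0 \<le> x then 1 else - 1 :: real)"
  define S where "S = (if 0 \<le> x then {0<..<x} else {x<..<0})"
  have lhs: "(LINT s=0..x|lebesgue. (of_real (x - s) * H0 s)) = (LINT s|lebesgue. \<epsilon> *\<^sub>R (indicator S s *\<^sub>R (of_real (x - s) * H0 s)))"
    unfolding interval_lebesgue_integral_def set_lebesgue_integral_def \<epsilon>_def S_def
    by (auto simp: zero_ereal_def)
  have ae': "AE s in lborel. \<epsilon> *\<^sub>R (indicator S s *\<^sub>R (of_real (x - s) * H0 s)) = H s * of_real (primitive2 x s)"
    using ae AE_lborel_singleton[of 0] AE_lborel_singleton[of x]
    by eventually_elim (use x in \<open>auto simp: \<epsilon>_def S_def primitive2_def indicator_def abs_if algebra_simps\<close>)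
  have m: "(\<lambda>s. H s * of_real (primitive2 x s)) \<in> borel_measurable borel" by measurable
  show ?thesis unfolding lhs
    by (rule lebesgue_integral_borel_version(1)[OF borel_measurable_lebesgue_AE[OF m ae'] m ae'])
qed

theorem theorem10p1:
  fixes A :: "real \<Rightarrow> complex"
    and P Ps :: "real \<Rightarrow> complex \<Rightarrow> complex"
    and \<sigma> :: "real measure"
    and a b r :: real
  assumes "\<And>R. R > 0 \<Longrightarrow> L2_on {0..R} A"
    and "krein_system A P Ps"
    and "spectral_measure_of A \<sigma>"
    and "a < b"
    and "{a<..<b} \<inter> measure_support \<sigma> = {}"
    and "r > 0"
  shows "\<forall>z \<in> Omega \<sigma> (sup_on_real_line (P r)). P r z \<noteq> 0"
proof (intro ballI notI)
  fix z assume z_Omega: "z \<in> Omega \<sigma> (sup_on_real_line (P r))" and Pz: "P r z = 0"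
  define M where "M = sup_on_real_line (P r)"
  obtain x y where z: "z = Complex x y" and y: "y > 0"
    and small: "(LINT l|\<sigma>. 2 * y / ((l - x)\<^sup>2 + y\<^sup>2)) < 1 / M\<^sup>2"
    using z_Omega by (auto simp: Omega_def M_def)
  have sets_\<sigma>: "sets \<sigma> = sets borel" and int_\<sigma>: "integrable \<sigma> (\<lambda>l. 1 / (1 + l\<^sup>2))"
    using assms(3) by (auto simp: spectral_measure_of_def)
  interpret Levy_Khintchine_measure \<sigma> by standard (fact sets_\<sigma> int_\<sigma>)+
  obtain H0 \<beta> where acc: "accelerant_of A H0"
    and levy: "\<And>x::real. of_real (\<bar>x\<bar> / 2) + (LINT s=0..x|lebesgue. (of_real (x - s) * H0 s)) =
           \<i> * of_real (\<beta> * x) + levy_potential x"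
    using assms(3) unfolding spectral_measure_of_def levy_potential_def by blast
  obtain H where H: "hermitian_convolution r H" and ae: "AE x in lborel. x \<in> {-r..r} \<longrightarrow> H x = H0 x"
    using acc assms(6) by (auto simp: accelerant_of_def intro: hermitian_borel_version)
  obtain \<gamma> where \<gamma>: "square_integrable \<gamma>" "\<And>x. x \<notin> {0..r} \<Longrightarrow> \<gamma> x = 0"
    "AE w in lborel. w \<in> {0..r} \<longrightarrow> \<gamma> w + hermitian_convolution.conv H \<gamma> w = H (r - w)"
    and P: "\<And>z. P r z = exp (\<i> * z * of_real r) - (LBINT v. \<gamma> v * exp (\<i> * z * of_real v))"
    by (rule krein_representation[OF assms(1)[OF assms(6)] assms(2) acc assms(6) H ae]) blast
  interpret hermitian_convolution r H by (fact H)
  \<comment> \<open>With the representation of \<open>P\<close> inserted, \<open>P r z = 0\<close>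
    is exactly the assumption \<open>zero\<close> of this locale.\<close>
  interpret zero_of_transform r H \<gamma> z
    by standard (use \<gamma> P[of z] Pz in auto)
  define q where "q l = (LBINT v. \<phi> v * cis (l * v))" for l
  have P_real: "P r (of_real l) = cis (l * r) - (LBINT v. \<gamma> v * cis (l * v))" for l
    unfolding P by (simp add: cis_conv_exp mult.assoc)
  have Pq: "(of_real l - z) * q l = P r (of_real l)" for l
    unfolding q_def transform_quotient P_real ..
  have potential: "levy_potential x = of_real (\<bar>x\<bar> / 2) + (LBINT u. H u * of_real (primitive2 x u)) - \<i> * of_real (\<beta> * x)"
    if "\<bar>x\<bar> \<le> r" for x
    using levy[of x] interval_integral_primitive2[OF H_measurable ae that] by (simp add: algebra_simps)
  have "(LINT l|\<sigma>. q l * cnj (q l)) = (LINT t|lborel. cnj (p t) * (LINT s|lborel. p s *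
      (levy_potential (r - t) + levy_potential (s - r) - levy_potential (s - t))))"
    using transform_sq_integral[of p r, OF p_integrable p_supp] unfolding \<phi>_transform q_def by simp
  also have "\<dots> = form"
  proof (rule form_eq)
    fix s t assume st: "s \<in> {0..r}" "t \<in> {0..r}"
    then have *: "\<bar>r - t\<bar> \<le> r" "\<bar>s - r\<bar> \<le> r" "\<bar>s - t\<bar> \<le> r" by auto
    \<comment> \<open>The arguments satisfy \<open>(r - t) + (s - r) = s - t\<close>, so the unknown
      linear term of the Levy-Khintchine formula drops out.\<close>
    have "\<i> * of_real (\<beta> * (r - t)) + \<i> * of_real (\<beta> * (s - r)) - \<i> * of_real (\<beta> * (s - t)) = 0"
      by (simp add: algebra_simps)
    then show "levy_potential (r - t) + levy_potential (s - r) - levy_potential (s - t) =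
      (LBINT v. indicator {s..r} v * (indicator {t..r} v + (LBINT w. indicator {t..r} w * H (v - w))))"
      unfolding potential[OF *(1)] potential[OF *(2)] potential[OF *(3)] second_difference[OF H_integrable st, symmetric]
      by (simp add: algebra_simps)
  qed
  finally have "(LINT l|\<sigma>. complex_of_real ((cmod (q l))\<^sup>2)) = form"
    by (simp only: complex_norm_square[symmetric])
  then have form_eq': "form = complex_of_real (LINT l|\<sigma>. (cmod (q l))\<^sup>2)"
    unfolding integral_complex_of_real by (rule sym)
  have "Im z = y" by (simp add: z)
  then have "complex_of_real (LINT l|\<sigma>. (cmod (q l))\<^sup>2) * of_real (2 * y) = 1"
    using form_value unfolding form_eq' by (simp only:)
  then have "(LINT l|\<sigma>. (cmod (q l))\<^sup>2) * (2 * y) = 1"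
    unfolding of_real_mult[symmetric] of_real_eq_1_iff .
  moreover have "(LINT l|\<sigma>. (cmod (q l))\<^sup>2) * (2 * y) \<le> M\<^sup>2 * (LINT l|\<sigma>. 2 * y / ((l - x)\<^sup>2 + y\<^sup>2))"
  proof -
    have P_le: "cmod (P r (of_real l)) \<le> M" for l
      unfolding M_def sup_on_real_line_def
    proof (rule cSUP_upper)
      \<comment> \<open>Without boundedness the real supremum would carry no information. The
        representation bounds \<open>P\<close> on the real line by 1 plus the integral of
        \<open>cmod \<gamma>\<close>.\<close>
      show "bdd_above (range (\<lambda>l::real. cmod (P r (of_real l))))"
      proof (rule bdd_aboveI2)
        fix l :: real
        have "cmod (LBINT v. \<gamma> v * cis (l * v)) \<le> (LBINT v. cmod (\<gamma> v * cis (l * v)))"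
          by (rule integral_norm_bound)
        also have "\<dots> = (LBINT v. cmod (\<gamma> v))" by (simp add: norm_mult)
        finally show "cmod (P r (of_real l)) \<le> 1 + (LBINT v. cmod (\<gamma> v))"
          unfolding P_real using norm_triangle_ineq4[of "cis (l * r)" "LBINT v. \<gamma> v * cis (l * v)"] by simp
      qed
    qed simp
    have den: "(l - x)\<^sup>2 + y\<^sup>2 > 0" for l using y by (simp add: add_nonneg_pos)
    have q_sq: "(cmod (q l))\<^sup>2 \<le> M\<^sup>2 * (1 / ((l - x)\<^sup>2 + y\<^sup>2))" for l
    proof -
      have "(cmod (of_real l - z))\<^sup>2 = (l - x)\<^sup>2 + y\<^sup>2" by (simp add: z cmod_power2)
      then have "(cmod (q l))\<^sup>2 * ((l - x)\<^sup>2 + y\<^sup>2) = (cmod (P r (of_real l)))\<^sup>2"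
        unfolding Pq[symmetric] norm_mult by (simp add: power_mult_distrib mult.commute)
      also have "\<dots> \<le> M\<^sup>2" using P_le[of l] by (intro power_mono) auto
      finally show ?thesis using den[of l] by (simp add: pos_le_divide_eq)
    qed
    have int: "integrable \<sigma> (\<lambda>l. 1 / ((l - x)\<^sup>2 + y\<^sup>2))"
    proof (rule Bochner_Integration.integrable_bound)
      \<comment> \<open>From \<open>l\<^sup>2 \<le> 2 * (l - x)\<^sup>2 + 2 * x\<^sup>2\<close>: the
        2 handles the first term, and the quotient by \<open>y\<^sup>2\<close> lets the remaining
        \<open>1 + 2 * x\<^sup>2\<close> be absorbed by the summand \<open>y\<^sup>2\<close> of the
        denominator.\<close>
      define c where "c = 2 + (1 + 2 * x\<^sup>2) / y\<^sup>2"
      show "integrable \<sigma> (\<lambda>l. c * (1 / (1 + l\<^sup>2)))" by (rule integrable_mult_right[OF int_\<sigma>])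
      have "norm (1 / ((l - x)\<^sup>2 + y\<^sup>2)) \<le> norm (c * (1 / (1 + l\<^sup>2)))" for l
      proof -
        have "0 \<le> c" using y by (simp add: c_def)
        have "l\<^sup>2 \<le> 2 * (l - x)\<^sup>2 + 2 * x\<^sup>2"
          using zero_le_power2[of "l - 2 * x"] by (simp add: power2_eq_square algebra_simps)
        moreover have "(1 + 2 * x\<^sup>2) = (1 + 2 * x\<^sup>2) / y\<^sup>2 * y\<^sup>2" using y by simp
        moreover have "0 \<le> (1 + 2 * x\<^sup>2) / y\<^sup>2 * (l - x)\<^sup>2" "0 \<le> 2 * y\<^sup>2" by auto
        ultimately have "1 + l\<^sup>2 \<le> c * ((l - x)\<^sup>2 + y\<^sup>2)"
          unfolding c_def distrib_left distrib_right by linarith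
        then have "1 / ((l - x)\<^sup>2 + y\<^sup>2) \<le> c * (1 / (1 + l\<^sup>2))"
          using den[of l] by (simp add: divide_simps add_pos_nonneg mult.commute)
        then show ?thesis using den[of l] \<open>0 \<le> c\<close> by simp
      qed
      then show "AE l in \<sigma>. norm (1 / ((l - x)\<^sup>2 + y\<^sup>2)) \<le> norm (c * (1 / (1 + l\<^sup>2)))" by simp
    qed measurable
    have "(LINT l|\<sigma>. (cmod (q l))\<^sup>2) \<le> (LINT l|\<sigma>. M\<^sup>2 * (1 / ((l - x)\<^sup>2 + y\<^sup>2)))"
      by (rule integral_mono'[OF integrable_mult_right[OF int] q_sq]) (use den in \<open>auto intro!: mult_nonneg_nonneg less_imp_le\<close>)
    also have "\<dots> = M\<^sup>2 * (LINT l|\<sigma>. 1 / ((l - x)\<^sup>2 + y\<^sup>2))" by (rule integral_mult_right_zero)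
    finally have "(LINT l|\<sigma>. (cmod (q l))\<^sup>2) * (2 * y) \<le> M\<^sup>2 * (LINT l|\<sigma>. 1 / ((l - x)\<^sup>2 + y\<^sup>2)) * (2 * y)"
      using y by (intro mult_right_mono) auto
    also have "\<dots> = M\<^sup>2 * (LINT l|\<sigma>. 2 * y * (1 / ((l - x)\<^sup>2 + y\<^sup>2)))"
      unfolding integral_mult_right_zero by (simp only: mult_ac)
    finally show ?thesis by simp
  qed
  ultimately have ge: "1 \<le> M\<^sup>2 * (LINT l|\<sigma>. 2 * y / ((l - x)\<^sup>2 + y\<^sup>2))" by simp
  \<comment> \<open>The inequality itself excludes \<open>M = 0\<close>, for which
    \<open>1 / M\<^sup>2\<close> would be 0 by convention and cancelling \<open>M\<^sup>2\<close>
    would fail.\<close>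
  then have "M \<noteq> 0" by auto
  then have "M\<^sup>2 * (LINT l|\<sigma>. 2 * y / ((l - x)\<^sup>2 + y\<^sup>2)) < M\<^sup>2 * (1 / M\<^sup>2)"
    using small by (intro mult_strict_left_mono) auto
  with ge \<open>M \<noteq> 0\<close> show False by simp
qed

end
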